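(* Let $a > 0$ with $a \neq 1$, let $n \geq 2$ be an integer, and let $s \in \mathbb{R}$. Assume that there is a number $C$ such that for every radial function $f \in C_0^\infty(\mathbb{R}^n \setminus \{0\})$, $$\left( \int_{\mathbb{R}^n} \sup_{|t| < 1} \left| (S^a f)[x](t) \right|^2 \, dx \right)^{1/2} \leq C \, \| f \|_{H^s(\mathbb{R}^n)} ,$$ with $C$ independent of $f$. Then $s \geq a/4$.
   Context: The Fourier transform of $f$ is $\widehat f(\xi) = \int_{\mathbb{R}^n} e^{-i x\cdot \xi} f(x)\,dx$. For $x \in \mathbb{R}^n$ and $t \in \mathbb{R}$, $$(S^a f)[x](t) = \frac{1}{(2\pi)^n} \int_{\mathbb{R}^n} e^{i(x\cdot\xi + t|\xi|^a)} \widehat f(\xi)\, d\xi .$$ The inhomogeneous Sobolev norm is $\|f\|_{H^s(\mathbb{R}^n)} = \left( \int_{\mathbb{R}^n} (1+|\xi|^2)^s |\widehat f(\xi)|^2 \, d\xi \right)^{1/2}$. $C_0^\infty(\mathbb{R}^n\setminus\{0\})$ denotes the smooth functions with compact support contained in $\mathbb{R}^n \setminus \{0\}$. A function $f$ is radial if $f(x)$ depends only on $|x|$. *)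

theory Defs
  imports "HOL-Analysis.Analysis"
begin

text \<open>
  \<open>C_k_diff k f\<close>: \<open>f\<close> has continuous directional derivatives of all orders up to \<open>k\<close>
  on the whole space.
\<close>
primrec C_k_diff :: "nat \<Rightarrow> ('a::real_normed_vector \<Rightarrow> 'b::real_normed_vector) \<Rightarrow> bool" where
  "C_k_diff 0 f \<longleftrightarrow> continuous_on UNIV f"
| "C_k_diff (Suc k) f \<longleftrightarrow>
     (\<forall>x. f differentiable (at x)) \<and>
     (\<forall>v. C_k_diff k (\<lambda>x. frechet_derivative f (at x) v))"

definition smooth :: "('a::real_normed_vector \<Rightarrow> 'b::real_normed_vector) \<Rightarrow> bool" where
  "smooth f \<longleftrightarrow> (\<forall>k. C_k_diff k f)"

definition supp :: "('a::topological_space \<Rightarrow> 'b::zero) \<Rightarrow> 'a set" where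
  "supp f = closure {x. f x \<noteq> 0}"

text \<open>
  For open \<open>U\<close>, elements of \<open>C\<^sub>0\<^sup>\<infinity>(U)\<close> are represented by their extensions by zero,
  so smoothness is required on the whole space.
\<close>
definition test_functions :: "'a::euclidean_space set \<Rightarrow> ('a \<Rightarrow> complex) set" where
  "test_functions U = {f. smooth f \<and> compact (supp f) \<and> supp f \<subseteq> U}"

definition radial :: "('a::real_normed_vector \<Rightarrow> 'b) \<Rightarrow> bool" where
  "radial f \<longleftrightarrow> (\<forall>x y. norm x = norm y \<longrightarrow> f x = f y)"

definition fourier :: "('a::euclidean_space \<Rightarrow> complex) \<Rightarrow> 'a \<Rightarrow> complex" where
  "fourier f \<xi> = (LINT x|lborel. exp (- (\<i> * of_real (x \<bullet> \<xi>))) * f x)"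

definition dispersive :: "real \<Rightarrow> ('a::euclidean_space \<Rightarrow> complex) \<Rightarrow> 'a \<Rightarrow> real \<Rightarrow> complex" where
  "dispersive a f x t =
     1 / of_real ((2 * pi) ^ DIM('a)) *
     (LINT \<xi>|lborel. exp (\<i> * of_real (x \<bullet> \<xi> + t * norm \<xi> powr a)) * fourier f \<xi>)"

definition esqrt :: "ennreal \<Rightarrow> ennreal" where
  "esqrt u = (if u = \<infinity> then \<infinity> else ennreal (sqrt (enn2real u)))"

lemma esqrt_power2: "esqrt u ^ 2 = u"
proof (cases "u = \<infinity>")
  case True
  then show ?thesis by (simp add: esqrt_def power2_eq_square ennreal_top_mult)
next
  case False
  then show ?thesis
    by (simp add: esqrt_def ennreal_power less_top)
qed

definition sobolev_norm :: "real \<Rightarrow> ('a::euclidean_space \<Rightarrow> complex) \<Rightarrow> ennreal" where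
  "sobolev_norm s f =
     esqrt (\<integral>\<^sup>+ \<xi>. ennreal ((1 + (norm \<xi>)\<^sup>2) powr s * (cmod (fourier f \<xi>))\<^sup>2) \<partial>lborel)"

end

theory Submission
  imports Defs "HOL-Computational_Algebra.Polynomial"
    "HOL-Probability.Characteristic_Functions" "HOL-Probability.Sinc_Integral"
begin

text \<open>
  The maximal operator grows because a radial wave packet sweeps through many disjoint shells while it stays
  coherent. Take a radial \<open>f\<close> with frequencies close to \<open>\<bar>\<xi>\<bar> = N\<close>, supported in a shell of thickness about
  \<open>N powr (a/2 - 1)\<close>. It moves radially with speed \<open>a * N powr (a - 1)\<close>, and up to time 1 it hardly spreads:
  the second order term of \<open>\<bar>\<xi>\<bar> powr a\<close> at \<open>\<bar>\<xi>\<bar> = N\<close> only produces a phase of order 1. So within the time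
  interval it crosses about \<open>N powr (a/2)\<close> disjoint shells, and at the moment when it sits in one of them, that shell
  carries a fixed fraction of the conserved energy \<open>\<parallel>f\<parallel>\<^sup>2\<close>. The supremum over \<open>t\<close> sees all these moments at
  once, hence the square of the left-hand side is at least \<open>c * N powr (a/2) * \<parallel>f\<parallel>\<^sup>2\<close>, while the square of
  the right-hand side is at most \<open>C * N powr (2*s) * \<parallel>f\<parallel>\<^sup>2\<close>. Letting \<open>N\<close> tend to infinity gives
  \<open>a/2 \<le> 2*s\<close>.

  After a dilation the frequency is 1 and the available time is large. The packets are then the functions
  \<open>wave F x = exp (- \<i> * \<bar>x\<bar>) * F \<bar>x\<bar>\<close>, where \<open>F\<close> is a bump of width \<open>1/\<mu>\<close> around a radius of size
  \<open>1/\<mu>\<^sup>2\<close>, observed up to a time \<open>c/\<mu>\<^sup>2\<close>. At such radii the curvature of the spheres, which enters the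
  Laplacian through \<open>(n - 1)/r\<close>, is as small as two derivatives of the bump, so that it can be treated as an error term
  and the radial problem behaves like a one-dimensional one.

  Four facts carry the proof. Multiplying the Fourier transform of a packet by \<open>\<bar>\<xi>\<bar>\<^sup>2 - 1\<close> produces the transform of
  a packet that is smaller by a factor \<open>\<mu>\<close> (\<open>fourier_packet_op_power\<close>); with the Plancherel identity this localises the packet to
  the unit sphere in frequency. Near that sphere \<open>\<bar>\<xi>\<bar> powr a\<close> agrees with an affine function of \<open>\<bar>\<xi>\<bar>\<^sup>2\<close> to
  second order, so a bump that is transported with speed \<open>a\<close> solves the evolution equation up to a residual of relative
  size \<open>\<mu>\<^sup>2\<close> (\<open>residual_L2\<close>). Duhamel's formula (\<open>interaction_duhamel\<close>) then shows that for times up to \<open>c/\<mu>\<^sup>2\<close>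
  the true solution has a definite part of its energy in the transported shell (\<open>packet_mass_at_time\<close>). Summing over
  about \<open>1/\<mu>\<close> disjoint shells gives \<open>maximal_function_lower\<close>.
\<close>

section \<open>A bump function with all its derivatives\<close>

text \<open>
  One function together with all its derivatives. Composing with an inner function of several variables brings in every
  derivative of the outer one, so all of them have to be named.
\<close>

definition deriv_chain :: "(nat \<Rightarrow> real \<Rightarrow> 'b::real_normed_vector) \<Rightarrow> real set \<Rightarrow> bool" where
  "deriv_chain d W \<longleftrightarrow> (\<forall>j. \<forall>r\<in>W. (d j has_vector_derivative d (Suc j) r) (at r))"

text \<open>
  The \<open>j\<close>th derivative of \<open>exp (- 1 / (1 - u\<^sup>2))\<close> is that exponential times \<open>P / (1 - u\<^sup>2) ^ (2 * j)\<close> with a polynomial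
  numerator \<open>P\<close>; the recursion for \<open>P\<close> is the quotient rule. The index of \<open>bump\<close> below is the order of the derivative.
\<close>

primrec bump_poly :: "nat \<Rightarrow> real poly" where
  "bump_poly 0 = 1"
| "bump_poly (Suc j) = pderiv (bump_poly j) * [:1, 0, -1:]\<^sup>2
     + smult (4 * real j) ([:0, 1:] * [:1, 0, -1:] * bump_poly j) - [:0, 2:] * bump_poly j"

definition bump :: "nat \<Rightarrow> real \<Rightarrow> real" where
  "bump j u = (if \<bar>u\<bar> < 1 then poly (bump_poly j) u / (1 - u\<^sup>2) ^ (2 * j) * exp (- 1 / (1 - u\<^sup>2)) else 0)"

lemma bump_zero: "\<bar>u\<bar> \<ge> 1 \<Longrightarrow> bump j u = 0"
  by (simp add: bump_def)

lemma exp_ge_power_over_fact: "0 \<le> (x::real) \<Longrightarrow> x ^ m / fact m \<le> exp x"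
  using sum_le_suminf[OF summable_exp_generic[of x], of "{m}"]
  by (simp add: exp_def divide_inverse mult.commute)

text \<open>
  The exponential beats every power of \<open>1 / (1 - u\<^sup>2)\<close>. Two powers are kept in reserve: a bound that is quadratic in
  the distance to the end points forces the derivative to exist and to vanish there.
\<close>

lemma bump_quadratic_bound: "\<exists>C\<ge>0. \<forall>u. \<bar>u\<bar> < 1 \<longrightarrow> \<bar>bump j u\<bar> \<le> C * (1 - u\<^sup>2)\<^sup>2"
proof -
  have "bounded (poly (bump_poly j) ` {-1..1})"
    by (intro compact_imp_bounded compact_continuous_image continuous_intros) auto
  then obtain B where B: "\<And>u. u \<in> {-1..1} \<Longrightarrow> \<bar>poly (bump_poly j) u\<bar> \<le> B"
    unfolding bounded_iff by (auto simp del: atLeastAtMost_iff)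
  have B0: "B \<ge> 0" using B[of 0] by auto
  let ?m = "2 * j + 2"
  have "\<bar>bump j u\<bar> \<le> (B * fact ?m) * (1 - u\<^sup>2)\<^sup>2" if u: "\<bar>u\<bar> < 1" for u
  proof -
    define w where "w = 1 - u\<^sup>2"
    have w: "w > 0" using u by (simp add: w_def abs_square_less_1)
    have "(1 / w) ^ ?m / fact ?m \<le> exp (1 / w)"
      by (rule exp_ge_power_over_fact) (use w in simp)
    then have "(1 / w) ^ ?m * exp (- (1 / w)) \<le> fact ?m"
      by (simp add: exp_minus divide_inverse[symmetric] divide_le_eq mult.commute[of "fact _"] pos_divide_le_eq del: fact_Suc power_Suc)
    then have *: "exp (- (1 / w)) \<le> fact ?m * w ^ ?m"
      using w by (simp add: field_simps)
    have "\<bar>bump j u\<bar> = \<bar>poly (bump_poly j) u\<bar> / w ^ (2 * j) * exp (- (1 / w))"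
      using u w by (simp add: bump_def w_def abs_mult)
    also have "\<dots> \<le> B / w ^ (2 * j) * (fact ?m * w ^ ?m)"
      using B[of u] u w B0 * by (intro mult_mono divide_right_mono) (auto simp: abs_less_iff)
    also have "\<dots> = B * fact ?m * w\<^sup>2"
      using w by (simp add: power_add power2_eq_square)
    finally show ?thesis by (simp add: w_def)
  qed
  then show ?thesis using B0 by (intro exI[of _ "B * fact ?m"]) auto
qed

lemma bump_bounded: "\<exists>C\<ge>0. \<forall>u. \<bar>bump j u\<bar> \<le> C"
proof -
  obtain C where C: "C \<ge> 0" "\<And>u. \<bar>u\<bar> < 1 \<Longrightarrow> \<bar>bump j u\<bar> \<le> C * (1 - u\<^sup>2)\<^sup>2"
    using bump_quadratic_bound[of j] by auto
  have "\<bar>bump j u\<bar> \<le> C" for u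
  proof (cases "\<bar>u\<bar> < 1")
    case True
    then have "u\<^sup>2 \<le> 1" by (simp add: abs_square_le_1)
    then have "(1 - u\<^sup>2)\<^sup>2 \<le> 1" by (simp add: abs_square_le_1)
    then have "C * (1 - u\<^sup>2)\<^sup>2 \<le> C * 1" using C(1) by (rule mult_left_mono)
    then show ?thesis using C(2)[OF True] by simp
  next
    case False
    then show ?thesis using C(1) by (simp add: bump_def)
  qed
  then show ?thesis using C(1) by auto
qed

lemma has_real_derivative_zero_quadratic:
  fixes f :: "real \<Rightarrow> real"
  assumes "f u = 0" "\<And>x. \<bar>f x\<bar> \<le> K * (x - u)\<^sup>2"
  shows "(f has_real_derivative 0) (at u)"
proof -
  have "((\<lambda>x. (f x - f u) / (x - u)) \<longlongrightarrow> 0) (at u)"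
  proof (rule Lim_null_comparison)
    show "\<forall>\<^sub>F x in at u. norm ((f x - f u) / (x - u)) \<le> K * \<bar>x - u\<bar>"
      unfolding eventually_at_filter
    proof (rule always_eventually, intro allI impI)
      fix x assume "x \<noteq> u"
      then show "norm ((f x - f u) / (x - u)) \<le> K * \<bar>x - u\<bar>"
        using assms(2)[of x] assms(1)
        by (simp add: divide_le_eq abs_mult[symmetric] power2_eq_square mult.assoc)
    qed
    show "((\<lambda>x. K * \<bar>x - u\<bar>) \<longlongrightarrow> 0) (at u)"
      by (auto intro!: tendsto_eq_intros)
  qed
  then show ?thesis by (simp add: has_field_derivative_iff)
qed

text \<open>
  Inside the interval this is the recursion for \<open>bump_poly\<close>. At and beyond the end points the function is dominated by a
  multiple of \<open>(x - u)\<^sup>2\<close>, which makes the derivative zero.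
\<close>

lemma bump_has_derivative: "(bump j has_real_derivative bump (Suc j) u) (at u)"
proof (cases "\<bar>u\<bar> < 1")
  case True
  let ?g = "\<lambda>u. poly (bump_poly j) u * (inverse (1 - u\<^sup>2)) ^ (2 * j) * exp (- inverse (1 - u\<^sup>2))"
  define w where "w = 1 - u\<^sup>2"
  have w: "w > 0" using True by (simp add: w_def abs_square_less_1)
  have dinv: "((\<lambda>u. inverse (1 - u\<^sup>2)) has_real_derivative (2 * u * inverse w ^ 2)) (at u)"
    using w unfolding w_def
    by (auto intro!: derivative_eq_intros simp: power2_eq_square field_simps)
  have dpow: "((\<lambda>u. (inverse (1 - u\<^sup>2)) ^ (2 * j)) has_real_derivative
      (real (2 * j) * (2 * u * inverse w ^ 2) * inverse w ^ (2 * j - 1))) (at u)"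
    by (rule derivative_eq_intros dinv refl)+ (simp add: w_def)
  have p: "(poly (bump_poly j) has_real_derivative poly (pderiv (bump_poly j)) u) (at u)"
    by (rule poly_DERIV)
  have pw: "real (2 * j) * (2 * u * inverse w ^ 2) * inverse w ^ (2 * j - 1) = 4 * real j * u * inverse w ^ (2 * j + 1)"
    by (cases j) (simp_all add: algebra_simps power_add power2_eq_square)
  have dexp: "((\<lambda>u. exp (- inverse (1 - u\<^sup>2))) has_real_derivative exp (- inverse w) * (- (2 * u * inverse w ^ 2))) (at u)"
    using DERIV_chain2[OF DERIV_exp DERIV_minus[OF dinv]] by (simp add: w_def)
  define I where "I = inverse w"
  have wI: "w * I = 1" using w by (simp add: I_def)
  define X where "X = I ^ (2 * j)"
  have "(?g has_real_derivative bump (Suc j) u) (at u)"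
  proof (rule DERIV_cong[OF DERIV_mult[OF DERIV_mult[OF p dpow] dexp]])
    let ?p = "poly (bump_poly j) u" and ?p' = "poly (pderiv (bump_poly j)) u" and ?e = "exp (- I)"
    have "bump (Suc j) u = (?p' * w\<^sup>2 + 4 * real j * u * w * ?p - 2 * u * ?p) * (X * I * I) * ?e"
    proof -
      have "poly (bump_poly (Suc j)) u = ?p' * w\<^sup>2 + 4 * real j * u * w * ?p - 2 * u * ?p"
        by (simp add: w_def power2_eq_square algebra_simps)
      moreover have "bump (Suc j) u = poly (bump_poly (Suc j)) u * (X * I * I) * ?e"
        using True unfolding bump_def w_def[symmetric]
        by (simp add: I_def X_def divide_inverse power_inverse del: bump_poly.simps)
      ultimately show ?thesis by simp
    qed
    also have "\<dots> = ?p' * (w * I) * (w * I) * X * ?e + 4 * real j * u * ?p * X * I * (w * I) * ?e - 2 * u * ?p * X * I * I * ?e"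
      by (simp add: algebra_simps power2_eq_square)
    also have "\<dots> = ?p' * X * ?e + 4 * real j * u * ?p * X * I * ?e - 2 * u * ?p * X * I * I * ?e"
      by (simp add: wI)
    finally show "(?p' * inverse (1 - u\<^sup>2) ^ (2 * j) + real (2 * j) * (2 * u * (inverse w)\<^sup>2) * inverse w ^ (2 * j - 1) * ?p) * exp (- inverse (1 - u\<^sup>2)) +
      exp (- inverse w) * - (2 * u * (inverse w)\<^sup>2) * (?p * inverse (1 - u\<^sup>2) ^ (2 * j)) = bump (Suc j) u"
      unfolding pw unfolding w_def[symmetric] I_def[symmetric]
      by (simp add: X_def power_add algebra_simps power2_eq_square)
  qed
  moreover have "\<forall>\<^sub>F x in nhds u. bump j x = ?g x"
  proof -
    have "open {u::real. \<bar>u\<bar> < 1}"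
      by (intro open_Collect_less continuous_intros)
    then have "\<forall>\<^sub>F x in nhds u. x \<in> {u::real. \<bar>u\<bar> < 1}"
      using True by (intro eventually_nhds_in_open) auto
    then show ?thesis
      by eventually_elim (simp add: bump_def divide_inverse power_inverse)
  qed
  ultimately show ?thesis
    by (subst DERIV_cong_ev[OF refl _ refl])
next
  case False
  obtain C where C: "C \<ge> 0" "\<And>u. \<bar>u\<bar> < 1 \<Longrightarrow> \<bar>bump j u\<bar> \<le> C * (1 - u\<^sup>2)\<^sup>2"
    using bump_quadratic_bound[of j] by auto
  have "(bump j has_real_derivative 0) (at u)"
  proof (rule has_real_derivative_zero_quadratic)
    show "bump j u = 0" using False by (simp add: bump_def)
    show "\<bar>bump j x\<bar> \<le> C * (\<bar>u\<bar> + 1)\<^sup>2 * (x - u)\<^sup>2" for x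
    proof (cases "\<bar>x\<bar> < 1")
      case True
      have "0 \<le> 1 - x\<^sup>2" using True by (simp add: abs_square_le_1)
      moreover have "1 - x\<^sup>2 \<le> u\<^sup>2 - x\<^sup>2"
        using False abs_le_square_iff[of 1 u] by simp
      moreover have "u\<^sup>2 - x\<^sup>2 \<le> \<bar>u + x\<bar> * \<bar>x - u\<bar>"
        unfolding abs_mult[symmetric] by (simp add: power2_eq_square algebra_simps)
      moreover have "\<bar>u + x\<bar> * \<bar>x - u\<bar> \<le> (\<bar>u\<bar> + 1) * \<bar>x - u\<bar>"
        using True by (intro mult_right_mono) auto
      ultimately have "(1 - x\<^sup>2)\<^sup>2 \<le> ((\<bar>u\<bar> + 1) * \<bar>x - u\<bar>)\<^sup>2"
        by (intro power_mono) auto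
      then have "C * (1 - x\<^sup>2)\<^sup>2 \<le> C * ((\<bar>u\<bar> + 1)\<^sup>2 * (x - u)\<^sup>2)"
        using C(1) by (intro mult_left_mono) (simp_all add: power_mult_distrib)
      then show ?thesis using C(2)[OF True] by simp
    qed (use C(1) in \<open>simp add: bump_def\<close>)
  qed
  then show ?thesis using False by (simp add: bump_def)
qed

lemma bump_lower: "\<bar>u\<bar> \<le> 1/2 \<Longrightarrow> bump 0 u \<ge> exp (- 4 / 3)"
proof -
  assume u: "\<bar>u\<bar> \<le> 1/2"
  then have "u\<^sup>2 \<le> (1/2)\<^sup>2" using abs_le_square_iff[of u "1/2"] by simp
  then have "u\<^sup>2 \<le> 1/4" by (simp add: power2_eq_square)
  then have "1 / (1 - u\<^sup>2) \<le> 4 / 3" by (simp add: field_simps)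
  then show ?thesis using u by (simp add: bump_def)
qed

section \<open>Smooth functions on open sets\<close>

text \<open>
  The version of \<open>C_k_diff\<close> on an open set. It is needed because the norm is smooth only away from the origin, where
  the packets vanish identically.
\<close>

primrec C_k_on :: "nat \<Rightarrow> 'a set \<Rightarrow> ('a::real_normed_vector \<Rightarrow> 'b::real_normed_vector) \<Rightarrow> bool" where
  "C_k_on 0 U f \<longleftrightarrow> continuous_on U f"
| "C_k_on (Suc k) U f \<longleftrightarrow>
     (\<forall>x\<in>U. f differentiable (at x)) \<and>
     (\<forall>v. C_k_on k U (\<lambda>x. frechet_derivative f (at x) v))"

lemma C_k_on_UNIV: "C_k_on k UNIV f \<longleftrightarrow> C_k_diff k f"
  by (induction k arbitrary: f) auto

lemma frechet_derivative_cong_open: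
  assumes "open U" "x \<in> U" "\<And>x. x \<in> U \<Longrightarrow> f x = g x"
  shows "frechet_derivative f (at x) = frechet_derivative g (at x)"
proof -
  have "(f has_derivative D) (at x) \<longleftrightarrow> (g has_derivative D) (at x)" for D
    using has_derivative_transform_within_open[OF _ assms(1,2), of f D UNIV g]
      has_derivative_transform_within_open[OF _ assms(1,2), of g D UNIV f] assms(3) by auto
  then show ?thesis by (simp add: frechet_derivative_def)
qed

lemma C_k_on_cong:
  assumes "open U" "\<And>x. x \<in> U \<Longrightarrow> f x = g x"
  shows "C_k_on k U f \<longleftrightarrow> C_k_on k U g"
  using assms(2)
proof (induction k arbitrary: f g)
  case 0
  then show ?case by (simp cong: continuous_on_cong)
next
  case (Suc k)
  have "(f has_derivative D) (at x) \<longleftrightarrow> (g has_derivative D) (at x)" if "x \<in> U" for x D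
    using has_derivative_transform_within_open[OF _ assms(1) that, of f D UNIV g]
      has_derivative_transform_within_open[OF _ assms(1) that, of g D UNIV f] Suc.prems by auto
  then have "f differentiable (at x) \<longleftrightarrow> g differentiable (at x)" if "x \<in> U" for x
    using that by (simp add: differentiable_def)
  moreover have "C_k_on k U (\<lambda>x. frechet_derivative f (at x) v) \<longleftrightarrow> C_k_on k U (\<lambda>x. frechet_derivative g (at x) v)" for v
    by (rule Suc.IH) (simp add: frechet_derivative_cong_open[OF assms(1) _ Suc.prems])
  ultimately show ?case by auto
qed

lemma C_k_on_SucI:
  assumes "open U" "\<And>x. x \<in> U \<Longrightarrow> (f has_derivative f' x) (at x)" "\<And>v. C_k_on k U (\<lambda>x. f' x v)"
  shows "C_k_on (Suc k) U f"
proof -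
  have "f' x = frechet_derivative f (at x)" if "x \<in> U" for x
    using frechet_derivative_at[OF assms(2)[OF that]] .
  then have "C_k_on k U (\<lambda>x. frechet_derivative f (at x) v)" for v
    using assms(3)[of v] by (subst C_k_on_cong[OF assms(1), of _ "\<lambda>x. f' x v"]) auto
  then show ?thesis using assms(2) by (auto simp: differentiable_def)
qed

lemma C_k_on_Suc_has_derivative:
  "C_k_on (Suc k) U f \<Longrightarrow> x \<in> U \<Longrightarrow> (f has_derivative frechet_derivative f (at x)) (at x)"
  using frechet_derivative_works by auto

lemma C_k_on_Suc_frechet: "C_k_on (Suc k) U f \<Longrightarrow> C_k_on k U (\<lambda>x. frechet_derivative f (at x) v)"
  by simp

lemma C_k_on_decr: "C_k_on (Suc k) U f \<Longrightarrow> C_k_on k U f"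
proof (induction k arbitrary: f)
  case 0
  then show ?case
    by (auto intro!: continuous_at_imp_continuous_on differentiable_imp_continuous_within)
next
  case (Suc k)
  have "\<forall>x\<in>U. f differentiable (at x)" and "\<And>v. C_k_on (Suc k) U (\<lambda>x. frechet_derivative f (at x) v)"
    using Suc.prems unfolding C_k_on.simps(2)[of "Suc k"] by blast+
  then show ?case by (subst C_k_on.simps(2)) (auto intro: Suc.IH simp del: C_k_on.simps)
qed

lemma C_k_on_const: "open U \<Longrightarrow> C_k_on k U (\<lambda>x. c)"
proof (induction k arbitrary: c)
  case (Suc k)
  then show ?case by (intro C_k_on_SucI[where f' = "\<lambda>x v. 0"]) auto
qed auto

lemma C_k_on_bounded_linear:
  assumes "open U" "bounded_linear L" shows "C_k_on k U L"
proof (cases k)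
  case 0
  then show ?thesis using assms(2) by (simp add: linear_continuous_on)
next
  case (Suc j)
  show ?thesis unfolding Suc
    by (rule C_k_on_SucI[OF assms(1), where f' = "\<lambda>x. L"])
       (auto intro: bounded_linear_imp_has_derivative assms C_k_on_const)
qed

lemma C_k_on_add:
  assumes U: "open U"
  shows "C_k_on k U f \<Longrightarrow> C_k_on k U g \<Longrightarrow> C_k_on k U (\<lambda>x. f x + g x)"
proof (induction k arbitrary: f g)
  case 0
  then show ?case by (auto intro: continuous_on_add)
next
  case (Suc k)
  show ?case
    by (rule C_k_on_SucI[OF U has_derivative_add[OF Suc.prems[THEN C_k_on_Suc_has_derivative]]])
       (assumption | intro Suc.IH Suc.prems[THEN C_k_on_Suc_frechet])+
qed

lemma (in bounded_bilinear) C_k_on_prod: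
  assumes U: "open U"
  shows "C_k_on k U f \<Longrightarrow> C_k_on k U g \<Longrightarrow> C_k_on k U (\<lambda>x. prod (f x) (g x))"
proof (induction k arbitrary: f g)
  case 0
  then show ?case by (auto intro: continuous_on)
next
  case (Suc k)
  show ?case
    by (rule C_k_on_SucI[OF U FDERIV[OF Suc.prems[THEN C_k_on_Suc_has_derivative]]])
       (assumption | intro C_k_on_add U Suc.IH Suc.prems[THEN C_k_on_decr] Suc.prems[THEN C_k_on_Suc_frechet])+
qed

text \<open>
  A directional derivative of \<open>d j \<circ> u\<close> is \<open>d (Suc j) \<circ> u\<close> times a directional derivative of \<open>u\<close>, so the composites
  with the members of a chain are closed under differentiation up to products.
\<close>

lemma C_k_on_chain_compose:
  assumes "open U" and d: "deriv_chain d W" and u: "C_k_on k U u" and "u ` U \<subseteq> W"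
  shows "C_k_on k U (\<lambda>x. d j (u x))"
  using u
proof (induction k arbitrary: j)
  case 0
  have "continuous_on W (d j)"
    using d unfolding deriv_chain_def
    by (meson continuous_at_imp_continuous_on has_vector_derivative_continuous)
  then show ?case using 0 assms(4) continuous_on_compose2 by fastforce
next
  case (Suc k)
  have D: "((\<lambda>x. d j (u x)) has_derivative (\<lambda>v. frechet_derivative u (at x) v *\<^sub>R d (Suc j) (u x))) (at x)" if "x \<in> U" for x
  proof -
    have "(d j has_derivative (\<lambda>h. h *\<^sub>R d (Suc j) (u x))) (at (u x))"
      using d assms(4) that unfolding deriv_chain_def has_vector_derivative_def by auto
    from has_derivative_compose[OF C_k_on_Suc_has_derivative[OF Suc.prems that] this]
    show ?thesis .
  qed
  show ?case
    by (rule C_k_on_SucI[OF assms(1) D])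
       (assumption | intro bounded_bilinear.C_k_on_prod[OF bounded_bilinear_scaleR] assms(1) Suc.IH
          Suc.prems[THEN C_k_on_decr] Suc.prems[THEN C_k_on_Suc_frechet])+
qed

lemma C_k_on_Un:
  assumes "open U" "open V" "C_k_on k U f" "C_k_on k V f"
  shows "C_k_on k (U \<union> V) f"
  using assms(3,4)
proof (induction k arbitrary: f)
  case 0
  then show ?case using assms by (auto intro: continuous_on_open_Un)
qed auto

lemma deriv_chain_inverse: "deriv_chain (\<lambda>j r::real. (- 1) ^ j * fact j * inverse r ^ (Suc j)) {0<..}"
  unfolding deriv_chain_def
proof (intro allI ballI)
  fix j and r :: real assume r: "r \<in> {0<..}"
  show "((\<lambda>r. (- 1) ^ j * fact j * inverse r ^ Suc j) has_vector_derivative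
            (- 1) ^ Suc j * fact (Suc j) * inverse r ^ Suc (Suc j)) (at r)"
    unfolding has_real_derivative_iff_has_vector_derivative[symmetric]
    by (rule DERIV_cong[OF DERIV_cmult[OF DERIV_power[OF DERIV_inverse]]])
       (use r in \<open>auto simp: power_Suc2 numeral_2_eq_2 algebra_simps\<close>)
qed

text \<open>
  The derivative of the norm in direction \<open>v\<close> is \<open>(x \<bullet> v) / norm x\<close>. This involves only a linear function and the norm
  itself, at one degree of differentiability less, so the induction closes.
\<close>

lemma C_k_on_norm: "C_k_on k (UNIV - {0}) (norm :: 'a::real_inner \<Rightarrow> real)"
proof (induction k)
  case 0
  show ?case by (auto intro: continuous_intros)
next
  case (Suc k)
  have U: "open (UNIV - {0::'a})" by auto
  have inv: "C_k_on k (UNIV - {0}) (\<lambda>x::'a. inverse (norm x))"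
    using C_k_on_chain_compose[OF U deriv_chain_inverse Suc, of 0] by (auto simp: image_subset_iff)
  have lin: "C_k_on k (UNIV - {0}) (\<lambda>x::'a. x \<bullet> v)" for v
    by (intro C_k_on_bounded_linear U bounded_linear_inner_left)
  show ?case
  proof (rule C_k_on_SucI[OF U])
    show "(norm has_derivative (\<lambda>v. inverse (norm x) * (x \<bullet> v))) (at x)" if "x \<in> UNIV - {0}" for x :: 'a
      using has_derivative_norm[of x] that by (simp add: sgn_div_norm inner_commute divide_inverse)
    show "C_k_on k (UNIV - {0}) (\<lambda>x::'a. inverse (norm x) * (x \<bullet> v))" for v
      by (rule bounded_bilinear.C_k_on_prod[OF bounded_bilinear_mult U inv lin])
  qed
qed

section \<open>Fourier transforms of integrable functions\<close>

lemma integrable_pair_times: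
  fixes f :: "'a::euclidean_space \<Rightarrow> complex" and h :: "'b::euclidean_space \<Rightarrow> complex"
  assumes f: "integrable lborel f" and h: "integrable lborel h"
  shows "integrable (lborel \<Otimes>\<^sub>M lborel) (\<lambda>(x, y). f x * h y)"
proof -
  have [measurable]: "f \<in> borel_measurable borel" "h \<in> borel_measurable borel"
    using f h by auto
  show ?thesis
    by (rule lborel_pair.Fubini_integrable)
       (use f h in \<open>auto simp: norm_mult split_beta' intro!: always_eventually\<close>)
qed

text \<open>
  The form in which Fubini's theorem is used below: all double integrals have an integrand of product type up to a
  unimodular oscillating factor.
\<close>

lemma integrable_pair_bound:
  fixes f :: "'a::euclidean_space \<Rightarrow> complex" and h :: "'b::euclidean_space \<Rightarrow> complex"
  assumes f: "integrable lborel f" and h: "integrable lborel h"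
    and F: "case_prod F \<in> borel_measurable (lborel \<Otimes>\<^sub>M lborel)"
    and le: "\<And>x y. cmod (F x y) \<le> cmod (f x) * cmod (h y)"
  shows "integrable (lborel \<Otimes>\<^sub>M lborel) (case_prod F)"
  by (rule Bochner_Integration.integrable_bound[OF integrable_pair_times[OF f h] F])
     (auto simp: norm_mult split_beta' intro!: always_eventually le)

lemma cmod_exp_imaginary [simp]: "cmod (exp (\<i> * of_real t)) = 1" "cmod (exp (- (\<i> * of_real t))) = 1"
  using norm_exp_i_times[of t] norm_exp_i_times[of "-t"] by simp_all

lemma exp_imaginary_measurable [measurable]:
  "f \<in> borel_measurable M \<Longrightarrow> (\<lambda>x. exp (\<i> * complex_of_real (f x))) \<in> borel_measurable M"
  "f \<in> borel_measurable M \<Longrightarrow> (\<lambda>x. exp (- (\<i> * complex_of_real (f x)))) \<in> borel_measurable M"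
proof -
  have *: "continuous_on UNIV (\<lambda>t. exp (\<i> * complex_of_real t))" "continuous_on UNIV (\<lambda>t. exp (- (\<i> * complex_of_real t)))"
    by (intro continuous_intros)+
  show "f \<in> borel_measurable M \<Longrightarrow> (\<lambda>x. exp (\<i> * complex_of_real (f x))) \<in> borel_measurable M"
    using borel_measurable_continuous_on[OF *(1)] .
  show "f \<in> borel_measurable M \<Longrightarrow> (\<lambda>x. exp (- (\<i> * complex_of_real (f x)))) \<in> borel_measurable M"
    using borel_measurable_continuous_on[OF *(2)] .
qed

lemma cnj_measurable [measurable]:
  "f \<in> borel_measurable M \<Longrightarrow> (\<lambda>x. cnj (f x)) \<in> borel_measurable M"
  by (rule borel_measurable_continuous_on[where f = cnj]) (intro continuous_intros)

lemma fourier_measurable [measurable]: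
  fixes f :: "'a::euclidean_space \<Rightarrow> complex"
  assumes [measurable]: "f \<in> borel_measurable borel"
  shows "fourier f \<in> borel_measurable borel"
  unfolding fourier_def[abs_def] by measurable

lemma integrable_fourier_integrand:
  fixes f :: "'a::euclidean_space \<Rightarrow> complex"
  assumes f: "integrable lborel f"
  shows "integrable lborel (\<lambda>x. exp (- (\<i> * of_real (x \<bullet> \<xi>))) * f x)"
proof (rule Bochner_Integration.integrable_bound[OF f])
  have [measurable]: "f \<in> borel_measurable borel" using f by auto
  show "(\<lambda>x. exp (- (\<i> * of_real (x \<bullet> \<xi>))) * f x) \<in> borel_measurable lborel" by measurable
qed (auto simp: norm_mult)

lemma cmod_fourier_le:
  fixes f :: "'a::euclidean_space \<Rightarrow> complex"
  assumes f: "integrable lborel f"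
  shows "cmod (fourier f \<xi>) \<le> (LINT x|lborel. cmod (f x))"
  unfolding fourier_def by (rule order_trans[OF integral_norm_bound]) (simp add: norm_mult)

lemma fourier_add:
  fixes f g :: "'a::euclidean_space \<Rightarrow> complex"
  assumes "integrable lborel f" "integrable lborel g"
  shows "fourier (\<lambda>x. f x + g x) \<xi> = fourier f \<xi> + fourier g \<xi>"
  unfolding fourier_def distrib_left
  by (intro Bochner_Integration.integral_add integrable_fourier_integrand assms)

lemma fourier_cmult: "fourier (\<lambda>x. c * f x) \<xi> = c * fourier f \<xi>"
  unfolding fourier_def by (subst integral_mult_right_zero[symmetric]) (simp add: ac_simps)

lemma fourier_sum:
  fixes f :: "'i \<Rightarrow> 'a::euclidean_space \<Rightarrow> complex"
  assumes "\<And>i. i \<in> I \<Longrightarrow> integrable lborel (f i)"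
  shows "fourier (\<lambda>x. \<Sum>i\<in>I. f i x) \<xi> = (\<Sum>i\<in>I. fourier (f i) \<xi>)"
  unfolding fourier_def sum_distrib_left
  by (intro Bochner_Integration.integral_sum integrable_fourier_integrand assms)

lemma nn_integral_scale:
  fixes f :: "'a::euclidean_space \<Rightarrow> ennreal"
  assumes [measurable]: "f \<in> borel_measurable borel" and c: "c > 0"
  shows "(\<integral>\<^sup>+x. f x \<partial>lborel) = ennreal (c ^ DIM('a)) * (\<integral>\<^sup>+x. f (c *\<^sub>R x) \<partial>lborel)"
  by (subst lborel_affine[of c 0])
     (use c in \<open>simp_all add: nn_integral_density nn_integral_distr nn_integral_cmult\<close>)

lemma integral_scale:
  fixes f :: "'a::euclidean_space \<Rightarrow> complex"
  assumes [measurable]: "f \<in> borel_measurable borel" and c: "c > 0"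
  shows "(LINT x|lborel. f x) = of_real (c ^ DIM('a)) * (LINT x|lborel. f (c *\<^sub>R x))"
  by (subst lborel_affine[of c 0])
     (use c in \<open>simp_all add: integral_density integral_distr scaleR_conv_of_real\<close>)

lemma fourier_scale:
  fixes f :: "'a::euclidean_space \<Rightarrow> complex"
  assumes [measurable]: "f \<in> borel_measurable borel" and c: "c > 0"
  shows "fourier (\<lambda>x. f (c *\<^sub>R x)) \<xi> = fourier f (\<xi> /\<^sub>R c) / of_real (c ^ DIM('a))"
proof -
  have "fourier f (\<xi> /\<^sub>R c) = of_real (c ^ DIM('a)) * (LINT x|lborel. exp (- (\<i> * of_real ((c *\<^sub>R x) \<bullet> (\<xi> /\<^sub>R c)))) * f (c *\<^sub>R x))"
    unfolding fourier_def by (rule integral_scale) (use c in measurable)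
  moreover have "(c *\<^sub>R x) \<bullet> (\<xi> /\<^sub>R c) = x \<bullet> \<xi>" for x
    using c by simp
  ultimately show ?thesis using c by (simp only:) (simp add: fourier_def)
qed

lemma integral_translate:
  fixes f :: "'a::euclidean_space \<Rightarrow> complex"
  assumes [measurable]: "f \<in> borel_measurable borel"
  shows "(LINT x|lborel. f (v + x)) = (LINT x|lborel. f x)"
  by (subst (2) lborel_distr_plus[of v, symmetric]) (simp add: integral_distr)

lemma integrable_translate:
  fixes f :: "'a::euclidean_space \<Rightarrow> complex"
  assumes f: "integrable lborel f"
  shows "integrable lborel (\<lambda>x. f (v + x))"
proof -
  have "integrable (distr lborel borel ((+) v)) f" using f by (simp add: lborel_distr_plus)
  then show ?thesis by (subst (asm) integrable_distr_eq) (use f in auto)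
qed

lemma integrable_continuous_compact_support:
  fixes f :: "'a::euclidean_space \<Rightarrow> complex"
  assumes "continuous_on UNIV f" "\<And>x. norm x > R \<Longrightarrow> f x = 0"
  shows "integrable lborel f"
proof -
  have "integrable lborel (\<lambda>x. indicator (cball 0 R) x *\<^sub>R f x)"
    by (intro borel_integrable_compact continuous_on_subset[OF assms(1)]) auto
  also have "(\<lambda>x. indicator (cball 0 R) x *\<^sub>R f x) = f"
    using assms(2) by (auto simp: indicator_def fun_eq_iff)
  finally show ?thesis .
qed

text \<open>
  By the fundamental theorem of calculus, \<open>f (v + x) - f x\<close> is the integral of \<open>f' (s *\<^sub>R v + x) v\<close> over
  \<open>0 \<le> s \<le> 1\<close>. Integrating in \<open>x\<close>, the left side gives zero by translation invariance, and every \<open>s\<close> on the right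
  contributes the same value.
\<close>

lemma integral_directional_derivative_eq_0:
  fixes f :: "'a::euclidean_space \<Rightarrow> complex"
  assumes D: "\<And>x. (f has_derivative f' x) (at x)"
    and cont: "continuous_on UNIV (\<lambda>x. f' x v)"
    and supp: "\<And>x. norm x > R \<Longrightarrow> f x = 0" "\<And>x. norm x > R \<Longrightarrow> f' x v = 0"
  shows "(LINT x|lborel. f' x v) = 0"
proof -
  let ?g = "\<lambda>x. f' x v"
  have contf: "continuous_on UNIV f"
    using D by (meson continuous_at_imp_continuous_on has_derivative_continuous)
  have [measurable]: "f \<in> borel_measurable borel" "?g \<in> borel_measurable borel"
    using contf cont by (auto intro: borel_measurable_continuous_onI)
  have intf: "integrable lborel f" and intg: "integrable lborel ?g"
    by (rule integrable_continuous_compact_support[OF contf supp(1)], assumption)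
       (rule integrable_continuous_compact_support[OF cont supp(2)])
  have FTC: "(LINT s|lborel. indicator {0..1::real} s *\<^sub>R ?g (s *\<^sub>R v + x)) = f (v + x) - f x" for x
  proof -
    have "(LINT s|lborel. indicator {0..1::real} s *\<^sub>R ?g (s *\<^sub>R v + x)) = f (1 *\<^sub>R v + x) - f (0 *\<^sub>R v + x)"
    proof (rule integral_FTC_atLeastAtMost)
      fix s :: real
      have "((\<lambda>s. s *\<^sub>R v + x) has_derivative (\<lambda>h. h *\<^sub>R v)) (at s within {0..1})"
        by (auto intro!: derivative_eq_intros)
      from has_derivative_compose[OF this D]
      have "((\<lambda>s. f (s *\<^sub>R v + x)) has_derivative (\<lambda>h. f' (s *\<^sub>R v + x) (h *\<^sub>R v))) (at s within {0..1})" .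
      then show "((\<lambda>s. f (s *\<^sub>R v + x)) has_vector_derivative ?g (s *\<^sub>R v + x)) (at s within {0..1})"
        using linear_scale[OF has_derivative_linear[OF D]] by (simp add: has_vector_derivative_def)
    next
      show "continuous_on {0..1} (\<lambda>s. ?g (s *\<^sub>R v + x))"
        by (rule continuous_on_compose2[OF cont]) (auto intro!: continuous_intros)
    qed simp
    then show ?thesis by simp
  qed
  have int2: "integrable (lborel \<Otimes>\<^sub>M lborel) (case_prod (\<lambda>s x. indicator {0..1::real} s *\<^sub>R ?g (s *\<^sub>R v + x)))"
  proof -
    let ?K = "{0..1::real} \<times> cball (0::'a) (R + norm v)"
    have "integrable lborel (\<lambda>p. indicator ?K p *\<^sub>R ?g (fst p *\<^sub>R v + snd p))"
    proof (rule borel_integrable_compact)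
      show "compact ?K" by (intro compact_Times) auto
      show "continuous_on ?K (\<lambda>p. ?g (fst p *\<^sub>R v + snd p))"
        by (rule continuous_on_compose2[OF cont]) (auto intro!: continuous_intros)
    qed
    also have "(\<lambda>p. indicator ?K p *\<^sub>R ?g (fst p *\<^sub>R v + snd p))
        = case_prod (\<lambda>s x. indicator {0..1::real} s *\<^sub>R ?g (s *\<^sub>R v + x))"
    proof (rule ext, clarify)
      fix s :: real and x :: 'a
      show "indicator ?K (s, x) *\<^sub>R ?g (fst (s, x) *\<^sub>R v + snd (s, x)) = indicator {0..1::real} s *\<^sub>R ?g (s *\<^sub>R v + x)"
      proof (cases "s \<in> {0..1} \<and> norm x > R + norm v")
        case True
        have "norm (s *\<^sub>R v) \<le> norm v" using True by (auto simp: mult_left_le_one_le)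
        then have "norm (s *\<^sub>R v + x) > R"
          using True norm_diff_ineq[of x "s *\<^sub>R v"] by (simp add: add.commute)
        then show ?thesis using supp(2) by simp
      qed (auto simp: indicator_def)
    qed
    finally show ?thesis by (simp add: lborel_prod)
  qed
  have "0 = (LINT x|lborel. f (v + x) - f x)"
    using intf by (simp add: integrable_translate integral_translate)
  also have "\<dots> = (LINT x|lborel. (LINT s|lborel. indicator {0..1::real} s *\<^sub>R ?g (s *\<^sub>R v + x)))"
    by (simp only: FTC)
  also have "\<dots> = (LINT s|lborel. (LINT x|lborel. indicator {0..1::real} s *\<^sub>R ?g (s *\<^sub>R v + x)))"
    by (rule lborel_pair.Fubini_integral[OF int2])
  also have "\<dots> = (LINT s|lborel. indicator {0..1::real} s *\<^sub>R (LINT x|lborel. ?g x))"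
    by (simp add: integral_translate[of ?g])
  also have "\<dots> = (LINT x|lborel. ?g x)"
    by simp
  finally show ?thesis by simp
qed

text \<open>
  Integration by parts: the derivative of \<open>exp (- \<i> * (x \<bullet> \<xi>)) * f x\<close> integrates to zero.
\<close>

lemma fourier_directional_derivative:
  fixes f :: "'a::euclidean_space \<Rightarrow> complex"
  assumes D: "\<And>x. (f has_derivative f' x) (at x)"
    and cont: "continuous_on UNIV (\<lambda>x. f' x v)"
    and supp: "\<And>x. norm x > R \<Longrightarrow> f x = 0" "\<And>x. norm x > R \<Longrightarrow> f' x v = 0"
  shows "fourier (\<lambda>x. f' x v) \<xi> = \<i> * of_real (v \<bullet> \<xi>) * fourier f \<xi>"
proof -
  let ?e = "\<lambda>x. exp (- (\<i> * complex_of_real (x \<bullet> \<xi>)))"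
  let ?d = "\<lambda>x v. ?e x * f' x v + (- (\<i> * of_real (v \<bullet> \<xi>)) * ?e x) * f x"
  have contf: "continuous_on UNIV f"
    using D by (meson continuous_at_imp_continuous_on has_derivative_continuous)
  have intf: "integrable lborel f" and intg: "integrable lborel (\<lambda>x. f' x v)"
    by (rule integrable_continuous_compact_support[OF contf supp(1)], assumption)
       (rule integrable_continuous_compact_support[OF cont supp(2)])
  have De: "(?e has_derivative (\<lambda>h. - (\<i> * of_real (h \<bullet> \<xi>)) * ?e x)) (at x)" for x
  proof -
    have "((\<lambda>x. - (\<i> * complex_of_real (x \<bullet> \<xi>))) has_derivative (\<lambda>h. - (\<i> * of_real (h \<bullet> \<xi>)))) (at x)"
      by (auto intro!: derivative_eq_intros)
    from has_derivative_compose[OF this DERIV_exp[unfolded has_field_derivative_def]]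
    show ?thesis by (simp add: mult.commute)
  qed
  have "(LINT x|lborel. ?d x v) = 0"
  proof (rule integral_directional_derivative_eq_0[where f' = ?d and R = R])
    show "((\<lambda>x. ?e x * f x) has_derivative ?d x) (at x)" for x
      by (rule has_derivative_mult[OF De D])
    show "continuous_on UNIV (\<lambda>x. ?d x v)"
      by (intro continuous_intros contf cont)
    show "?e x * f x = 0" "?d x v = 0" if "norm x > R" for x
      using supp[OF that] by simp_all
  qed
  then have "0 = (LINT x|lborel. ?e x * f' x v + (- (\<i> * of_real (v \<bullet> \<xi>))) * (?e x * f x))"
    by (simp add: mult.assoc)
  also have "\<dots> = fourier (\<lambda>x. f' x v) \<xi> + - (\<i> * of_real (v \<bullet> \<xi>)) * fourier f \<xi>"
    unfolding fourier_def
    by (subst Bochner_Integration.integral_add)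
       (auto intro!: integrable_fourier_integrand intf intg integrable_minus integrable_mult_right simp del: mult_minus_left)
  finally show ?thesis by simp
qed

section \<open>Gaussians and the Plancherel identity\<close>

text \<open>
  The standard normal density on the space, written as a product so that its Fourier transform reduces to the
  characteristic function of the one-dimensional normal distribution.
\<close>

definition gauss :: "'a::euclidean_space \<Rightarrow> real" where
  "gauss z = (\<Prod>b\<in>Basis. std_normal_density (z \<bullet> b))"

lemma gauss_eq: "gauss (z::'a::euclidean_space) = exp (- (norm z)\<^sup>2 / 2) / sqrt (2 * pi) ^ DIM('a)"
proof -
  have "(norm z)\<^sup>2 = (\<Sum>b\<in>Basis. (z \<bullet> b)\<^sup>2)"
    by (simp add: norm_eq_sqrt_inner euclidean_inner[of z z] power2_eq_square sum_nonneg)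
  then show ?thesis
    by (simp add: gauss_def std_normal_density_def prod.distrib exp_sum[symmetric] sum_negf sum_divide_distrib power_divide prod_dividef)
qed

lemma gauss_measurable [measurable]: "gauss \<in> borel_measurable borel"
  unfolding gauss_def[abs_def] by measurable

lemma gauss_char:
  fixes \<xi> :: "'a::euclidean_space"
  shows "integrable lborel (\<lambda>z. exp (\<i> * of_real (z \<bullet> \<xi>)) * complex_of_real (gauss z))" (is ?I)
    and "(LINT z|lborel. exp (\<i> * of_real (z \<bullet> \<xi>)) * complex_of_real (gauss z)) = exp (- (norm \<xi>)\<^sup>2 / 2)" (is ?E)
proof -
  interpret product_sigma_finite "\<lambda>_::'a. lborel :: real measure" by standard
  define h where "h b t = iexp ((\<xi> \<bullet> b) * t) * complex_of_real (std_normal_density t)" for b :: 'a and t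
  have hm: "h b \<in> borel_measurable borel" for b
    unfolding h_def[abs_def] by measurable
  have hi: "integrable lborel (h b)" for b
    unfolding h_def
    by (rule Bochner_Integration.integrable_bound[where f="std_normal_density"])
       (auto simp: norm_mult)
  have he: "integral\<^sup>L lborel (h b) = exp (- (\<xi> \<bullet> b)\<^sup>2 / 2)" for b
  proof -
    have "char std_normal_distribution (\<xi> \<bullet> b) = integral\<^sup>L lborel (h b)"
      unfolding char_def h_def
      by (subst integral_density) (auto simp: normal_density_nonneg scaleR_conv_of_real mult.commute)
    then show ?thesis by (simp add: char_std_normal_distribution)
  qed
  have eq: "exp (\<i> * of_real (z \<bullet> \<xi>)) * complex_of_real (gauss z) = (\<Prod>b\<in>Basis. h b (z \<bullet> b))" for z
    by (simp add: h_def gauss_def prod.distrib exp_sum[symmetric] sum_distrib_left euclidean_inner[of z \<xi>] mult.commute)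
  have eq2: "(\<Prod>b\<in>Basis. h b ((\<Sum>b'\<in>Basis. f b' *\<^sub>R b') \<bullet> b)) = (\<Prod>b\<in>Basis. h b (f b))" for f :: "'a \<Rightarrow> real"
    by (intro prod.cong) (auto simp: inner_sum_left inner_Basis if_distrib cong: if_cong)
  have pm: "(\<lambda>z::'a. \<Prod>b\<in>Basis. h b (z \<bullet> b)) \<in> borel_measurable borel"
    using hm by measurable
  show ?I
    unfolding eq
    by (subst lborel_eq, subst integrable_distr_eq) (auto intro!: product_integrable_prod hi pm simp: eq2)
  have "(LINT z|lborel. exp (\<i> * of_real (z \<bullet> \<xi>)) * complex_of_real (gauss z)) = (\<Prod>b\<in>Basis. integral\<^sup>L lborel (h b))"
    unfolding eq by (subst lborel_eq) (simp add: integral_distr pm eq2 product_integral_prod hi)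
  also have "\<dots> = exp (\<Sum>b\<in>Basis. - (complex_of_real (\<xi> \<bullet> b))\<^sup>2 / 2)"
    by (simp add: he exp_sum flip: exp_of_real)
  also have "(\<Sum>b\<in>Basis. - (complex_of_real (\<xi> \<bullet> b))\<^sup>2 / 2) = of_real (- (norm \<xi>)\<^sup>2 / 2)"
    by (simp add: norm_eq_sqrt_inner euclidean_inner[of \<xi> \<xi>] power2_eq_square sum_nonneg sum_negf sum_divide_distrib)
  finally show ?E by (simp flip: exp_of_real)
qed


lemma gauss_nonneg: "gauss z \<ge> 0"
  by (simp add: gauss_eq)

lemma integrable_gauss: "integrable lborel (gauss :: 'a::euclidean_space \<Rightarrow> real)"
  and integral_gauss: "(LINT z|lborel. gauss (z::'a::euclidean_space)) = 1"
proof -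
  have "integrable lborel (\<lambda>z::'a. complex_of_real (gauss z))"
    using gauss_char(1)[of 0] by simp
  then show "integrable lborel (gauss :: 'a \<Rightarrow> real)" by (simp add: complex_of_real_integrable_eq)
  have "(LINT z|lborel. complex_of_real (gauss (z::'a))) = 1"
    using gauss_char(2)[of "0::'a"] by simp
  then show "(LINT z|lborel. gauss (z::'a)) = 1" by (simp add: integral_complex_of_real)
qed

lemma fourier_gauss_dilate:
  fixes z :: "'a::euclidean_space"
  assumes "e > 0"
  shows "integrable lborel (\<lambda>\<xi>::'a. complex_of_real (exp (- (e * norm \<xi>)\<^sup>2 / 2)))"
    and "fourier (\<lambda>\<xi>. complex_of_real (exp (- (e * norm \<xi>)\<^sup>2 / 2))) z
     = of_real ((2 * pi) ^ DIM('a) / e ^ DIM('a) * gauss (z /\<^sub>R e))"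
proof -
  let ?c = "sqrt (2 * pi) ^ DIM('a)"
  have g: "exp (- (e * norm \<xi>)\<^sup>2 / 2) = ?c * gauss (e *\<^sub>R \<xi>)" for \<xi> :: 'a
    using assms by (simp add: gauss_eq)
  have "integrable lborel (\<lambda>\<xi>::'a. complex_of_real (gauss (e *\<^sub>R \<xi>)))"
  proof -
    have "integrable lborel (\<lambda>\<xi>::'a. gauss (e *\<^sub>R \<xi>))"
    proof (rule integrableI_bounded)
      have "(\<integral>\<^sup>+ \<xi>. ennreal (gauss (\<xi>::'a)) \<partial>lborel) = ennreal (e ^ DIM('a)) * (\<integral>\<^sup>+ \<xi>. ennreal (gauss (e *\<^sub>R \<xi>::'a)) \<partial>lborel)"
        by (rule nn_integral_scale) (use assms in auto)
      moreover have "(\<integral>\<^sup>+ \<xi>. ennreal (gauss (\<xi>::'a)) \<partial>lborel) = 1"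
        using nn_integral_eq_integral[OF integrable_gauss] by (simp add: gauss_nonneg integral_gauss)
      ultimately show "(\<integral>\<^sup>+ \<xi>. ennreal (norm (gauss (e *\<^sub>R \<xi>::'a))) \<partial>lborel) < \<infinity>"
        using assms
        by (cases "(\<integral>\<^sup>+ \<xi>. ennreal (gauss (e *\<^sub>R \<xi>::'a)) \<partial>lborel) = \<infinity>")
           (simp_all add: gauss_nonneg ennreal_mult_top less_top)
    qed measurable
    then show ?thesis by (simp add: complex_of_real_integrable_eq)
  qed
  then show "integrable lborel (\<lambda>\<xi>::'a. complex_of_real (exp (- (e * norm \<xi>)\<^sup>2 / 2)))"
    unfolding g by simp
  have "fourier (\<lambda>\<xi>. complex_of_real (gauss (e *\<^sub>R \<xi>))) z = fourier (\<lambda>x. of_real (gauss x)) (z /\<^sub>R e) / of_real (e ^ DIM('a))"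
    by (rule fourier_scale[where f = "\<lambda>x. complex_of_real (gauss x)"]) (use assms in auto)
  moreover have "fourier (\<lambda>x. complex_of_real (gauss x)) \<zeta> = of_real (exp (- (norm \<zeta>)\<^sup>2 / 2))" for \<zeta> :: 'a
    using gauss_char(2)[of "- \<zeta>"] by (simp add: fourier_def exp_of_real)
  moreover have gc: "?c * exp (- (norm \<zeta>)\<^sup>2 / 2) = (2 * pi) ^ DIM('a) * gauss \<zeta>" for \<zeta> :: 'a
  proof -
    have cc: "?c * ?c = (2 * pi) ^ DIM('a)"
      unfolding power_mult_distrib[symmetric] by simp
    have c0: "?c \<noteq> 0" by simp
    have "(2 * pi) ^ DIM('a) * gauss \<zeta> = (?c * ?c) * (exp (- (norm \<zeta>)\<^sup>2 / 2) / ?c)"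
      by (simp only: cc gauss_eq)
    moreover have "(c * c) * (y / c) = c * y" if "c \<noteq> 0" for c y :: real
      using that by simp
    ultimately show ?thesis using c0 by metis
  qed
  ultimately have "fourier (\<lambda>\<xi>. of_real ?c * complex_of_real (gauss (e *\<^sub>R \<xi>))) z
      = of_real (?c * exp (- (norm (z /\<^sub>R e))\<^sup>2 / 2) / e ^ DIM('a))"
    unfolding fourier_cmult by simp
  also have "?c * exp (- (norm (z /\<^sub>R e))\<^sup>2 / 2) / e ^ DIM('a) = (2 * pi) ^ DIM('a) / e ^ DIM('a) * gauss (z /\<^sub>R e)"
    by (simp only: gc times_divide_eq_left)
  finally show "fourier (\<lambda>\<xi>. complex_of_real (exp (- (e * norm \<xi>)\<^sup>2 / 2))) z
     = of_real ((2 * pi) ^ DIM('a) / e ^ DIM('a) * gauss (z /\<^sub>R e))"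
    unfolding g of_real_mult .
qed

lemma fourier_multiplication:
  fixes f h :: "'a::euclidean_space \<Rightarrow> complex"
  assumes f: "integrable lborel f" and h: "integrable lborel h"
  shows "(LINT \<xi>|lborel. fourier f \<xi> * h \<xi>) = (LINT x|lborel. f x * fourier h x)"
proof -
  have [measurable]: "f \<in> borel_measurable borel" "h \<in> borel_measurable borel"
    using f h by auto
  let ?F = "\<lambda>x \<xi>. exp (- (\<i> * of_real (x \<bullet> \<xi>))) * f x * h \<xi>"
  have i: "integrable (lborel \<Otimes>\<^sub>M lborel) (case_prod ?F)"
    by (rule integrable_pair_bound[OF f h]) (measurable, simp add: norm_mult)
  have "(LINT \<xi>|lborel. fourier f \<xi> * h \<xi>) = (LINT \<xi>|lborel. (LINT x|lborel. ?F x \<xi>))"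
    by (simp add: fourier_def)
  also have "\<dots> = (LINT x|lborel. (LINT \<xi>|lborel. ?F x \<xi>))"
    by (rule lborel_pair.Fubini_integral[OF i])
  also have "\<dots> = (LINT x|lborel. (LINT \<xi>|lborel. f x * (exp (- (\<i> * of_real (\<xi> \<bullet> x))) * h \<xi>)))"
    by (simp add: inner_commute ac_simps)
  also have "\<dots> = (LINT x|lborel. f x * fourier h x)"
    by (simp add: fourier_def)
  finally show ?thesis .
qed

abbreviation energy :: "('a::euclidean_space \<Rightarrow> complex) \<Rightarrow> ennreal" where
  "energy f \<equiv> \<integral>\<^sup>+x. ennreal ((cmod (f x))\<^sup>2) \<partial>lborel"

text \<open>
  The Fourier transform of the autocorrelation is \<open>\<bar>fourier g\<bar>\<^sup>2\<close> and its value at 0 is the energy of \<open>g\<close>. This turns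
  the Plancherel identity into Fourier inversion at a single point.
\<close>

definition autocorrelation :: "('a::euclidean_space \<Rightarrow> complex) \<Rightarrow> 'a \<Rightarrow> complex" where
  "autocorrelation g z = (LINT y|lborel. g (y + z) * cnj (g y))"

lemma autocorrelation_fourier:
  fixes g :: "'a::euclidean_space \<Rightarrow> complex"
  assumes g: "integrable lborel g"
  shows "integrable lborel (autocorrelation g)"
    and "fourier (autocorrelation g) \<xi> = of_real ((cmod (fourier g \<xi>))\<^sup>2)"
proof -
  have [measurable]: "g \<in> borel_measurable borel" using g by auto
  have tr: "integrable lborel (\<lambda>z. g (y + z))" for y
    by (rule integrable_translate[OF g])
  have i0: "integrable (lborel \<Otimes>\<^sub>M lborel) (\<lambda>(y, z). g (y + z) * cnj (g y))"
  proof (rule lborel_pair.Fubini_integrable)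
    have "(LINT z|lborel. cmod (g (y + z))) = (LINT z|lborel. cmod (g z))" for y
      by (subst (2) lborel_distr_plus[of y, symmetric]) (simp add: integral_distr)
    then show "integrable lborel (\<lambda>x. LINT y|lborel. cmod (case (x, y) of (y, z) \<Rightarrow> g (y + z) * cnj (g y)))"
      using g by (simp add: norm_mult)
    show "AE x in lborel. integrable lborel (\<lambda>y. case (x, y) of (y, z) \<Rightarrow> g (y + z) * cnj (g y))"
      using tr by (auto intro!: always_eventually)
  qed measurable
  show "integrable lborel (autocorrelation g)"
    unfolding autocorrelation_def[abs_def] using lborel_pair.integrable_snd[OF i0] by simp
  let ?F = "\<lambda>y z. exp (- (\<i> * of_real (z \<bullet> \<xi>))) * (g (y + z) * cnj (g y))"
  have i1: "integrable (lborel \<Otimes>\<^sub>M lborel) (case_prod ?F)"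
    by (rule Bochner_Integration.integrable_bound[OF i0])
       (measurable, auto simp: norm_mult intro!: always_eventually)
  have shift: "(LINT z|lborel. exp (- (\<i> * of_real (z \<bullet> \<xi>))) * g (y + z)) = exp (\<i> * of_real (y \<bullet> \<xi>)) * fourier g \<xi>" for y
  proof -
    have "fourier g \<xi> = (LINT z|lborel. exp (- (\<i> * of_real ((y + z) \<bullet> \<xi>))) * g (y + z))"
      unfolding fourier_def
      by (rule integral_translate[symmetric, where f = "\<lambda>x. exp (- (\<i> * of_real (x \<bullet> \<xi>))) * g x"]) measurable
    also have "\<dots> = (LINT z|lborel. exp (- (\<i> * of_real (y \<bullet> \<xi>))) * (exp (- (\<i> * of_real (z \<bullet> \<xi>))) * g (y + z)))"
      by (simp add: inner_add_left distrib_left exp_add[symmetric] exp_diff exp_minus field_simps)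
    finally have "fourier g \<xi> = exp (- (\<i> * of_real (y \<bullet> \<xi>))) * (LINT z|lborel. (exp (- (\<i> * of_real (z \<bullet> \<xi>))) * g (y + z)))"
      by simp
    then show ?thesis by (simp add: exp_minus field_simps)
  qed
  have "fourier (autocorrelation g) \<xi> = (LINT z|lborel. (LINT y|lborel. ?F y z))"
    unfolding fourier_def autocorrelation_def by simp
  also have "\<dots> = (LINT y|lborel. (LINT z|lborel. ?F y z))"
    by (rule lborel_pair.Fubini_integral[OF i1])
  also have "\<dots> = (LINT y|lborel. cnj (g y) * (LINT z|lborel. exp (- (\<i> * of_real (z \<bullet> \<xi>))) * g (y + z)))"
    by (subst integral_mult_right_zero[symmetric]) (simp add: ac_simps)
  also have "\<dots> = (LINT y|lborel. fourier g \<xi> * cnj (exp (- (\<i> * of_real (y \<bullet> \<xi>))) * g y))"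
    unfolding shift by (simp add: exp_cnj ac_simps)
  also have "\<dots> = fourier g \<xi> * cnj (fourier g \<xi>)"
    unfolding fourier_def by (simp only: integral_mult_right_zero Bochner_Integration.integral_cnj)
  finally show "fourier (autocorrelation g) \<xi> = of_real ((cmod (fourier g \<xi>))\<^sup>2)"
    by (simp add: complex_mult_cnj cmod_def)
qed

text \<open>
  Damp \<open>\<bar>fourier g\<bar>\<^sup>2\<close> by the Gaussian \<open>exp (- (e * norm \<xi>)\<^sup>2 / 2)\<close>. The multiplication formula moves the transform
  to the Gaussian and leaves an average of the autocorrelation at scale \<open>e\<close>. As \<open>e\<close> tends to 0 the average tends to the
  value at the origin, and the damped integrals increase to the full one.
\<close>

lemma plancherel:
  fixes g :: "'a::euclidean_space \<Rightarrow> complex"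
  assumes cont: "continuous_on UNIV g" and supp: "\<And>x. norm x > R \<Longrightarrow> g x = 0"
  shows "energy (fourier g)
       = ennreal ((2 * pi) ^ DIM('a)) * energy g"
proof -
  have g: "integrable lborel g" by (rule integrable_continuous_compact_support[OF cont supp])
  have [measurable]: "g \<in> borel_measurable borel" using g by auto
  let ?k = "autocorrelation g"
  note k = autocorrelation_fourier[OF g]
  have [measurable]: "?k \<in> borel_measurable borel" using k(1) by auto
  have "compact (g ` cball 0 R)"
    by (intro compact_continuous_image continuous_on_subset[OF cont]) auto
  then obtain B0 where B0: "\<And>x. x \<in> cball 0 R \<Longrightarrow> cmod (g x) \<le> B0"
    using compact_imp_bounded bounded_iff by (metis imageI)
  define B where "B = max B0 0"
  have B: "cmod (g x) \<le> B" for x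
    using B0[of x] supp[of x] by (cases "norm x > R") (auto simp: B_def)
  have g2: "integrable lborel (\<lambda>x. B * cmod (g x))" using g by simp
  have k_bound: "cmod (?k z) \<le> (LINT x|lborel. B * cmod (g x))" for z
  proof -
    have le: "cmod (g (y + z) * cnj (g y)) \<le> B * cmod (g y)" for y
      by (simp add: norm_mult mult_right_mono B)
    have "integrable lborel (\<lambda>y. g (y + z) * cnj (g y))"
      by (rule Bochner_Integration.integrable_bound[OF g2])
         (measurable, auto intro!: always_eventually order_trans[OF le abs_ge_self] simp del: norm_mult)
    then show ?thesis
      unfolding autocorrelation_def by (rule Bochner_Integration.integral_norm_bound_integral) (use g2 le in auto)
  qed
  define e where "e m = inverse (real (Suc m))" for m
  have e: "e m > 0" "e \<longlonglongrightarrow> 0" for m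
    unfolding e_def[abs_def] by (simp, rule LIMSEQ_inverse_real_of_nat)
  have k_cont: "(\<lambda>m. ?k (e m *\<^sub>R z)) \<longlonglongrightarrow> ?k 0" for z
    unfolding autocorrelation_def
  proof (rule integral_dominated_convergence[where w = "\<lambda>x. B * cmod (g x)"])
    show "AE x in lborel. (\<lambda>m. g (x + e m *\<^sub>R z) * cnj (g x)) \<longlonglongrightarrow> g (x + 0) * cnj (g x)"
    proof (rule always_eventually, rule allI)
      fix x
      have "isCont g x" using cont by (simp add: continuous_on_eq_continuous_at)
      moreover have "(\<lambda>m. x + e m *\<^sub>R z) \<longlonglongrightarrow> x + 0 *\<^sub>R z"
        by (intro tendsto_intros e)
      ultimately show "(\<lambda>m. g (x + e m *\<^sub>R z) * cnj (g x)) \<longlonglongrightarrow> g (x + 0) * cnj (g x)"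
        by (intro tendsto_intros) (auto intro: isCont_tendsto_compose)
    qed
  qed (auto intro!: g2 always_eventually integrable_norm g simp: norm_mult mult_right_mono B)
  let ?E = "\<lambda>m \<xi>::'a. exp (- (e m * norm \<xi>)\<^sup>2 / 2)"
  let ?A = "\<lambda>m. LINT \<xi>|lborel. of_real ((cmod (fourier g \<xi>))\<^sup>2) * complex_of_real (?E m \<xi>)"
  have A: "?A m = (2 * pi) ^ DIM('a) * (LINT z|lborel. ?k (e m *\<^sub>R z) * of_real (gauss z))" for m
  proof -
    have "?A m = (LINT x|lborel. ?k x * fourier (\<lambda>\<xi>. complex_of_real (?E m \<xi>)) x)"
      unfolding k(2)[symmetric] by (rule fourier_multiplication[OF k(1) fourier_gauss_dilate(1)[OF e(1)]])
    also have "\<dots> = (LINT x|lborel. ?k x * of_real ((2 * pi) ^ DIM('a) / e m ^ DIM('a) * gauss (x /\<^sub>R e m)))"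
      by (simp only: fourier_gauss_dilate(2)[OF e(1)])
    also have "\<dots> = of_real (e m ^ DIM('a)) * (LINT x|lborel. ?k (e m *\<^sub>R x) * of_real ((2 * pi) ^ DIM('a) / e m ^ DIM('a) * gauss ((e m *\<^sub>R x) /\<^sub>R e m)))"
      by (rule integral_scale) (use e in auto)
    also have "\<dots> = of_real (e m ^ DIM('a)) * (LINT x|lborel. of_real ((2 * pi) ^ DIM('a) / e m ^ DIM('a)) * (?k (e m *\<^sub>R x) * of_real (gauss x)))"
      using e(1)[of m] by (simp add: ac_simps)
    also have "\<dots> = (2 * pi) ^ DIM('a) * (LINT z|lborel. ?k (e m *\<^sub>R z) * of_real (gauss z))"
      using e(1)[of m] by (simp only: integral_mult_right_zero) simp
    finally show ?thesis .
  qed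
  have "(\<lambda>m. LINT z|lborel. ?k (e m *\<^sub>R z) * of_real (gauss z)) \<longlonglongrightarrow> (LINT z|lborel. ?k 0 * of_real (gauss (z::'a)))"
  proof (rule integral_dominated_convergence[where w = "\<lambda>z::'a. (LINT x|lborel. B * cmod (g x)) * gauss z"])
    show "AE z in lborel. (\<lambda>m. ?k (e m *\<^sub>R z) * of_real (gauss z)) \<longlonglongrightarrow> ?k 0 * of_real (gauss z)"
      by (intro always_eventually allI tendsto_intros k_cont)
    show "AE z in lborel. cmod (?k (e m *\<^sub>R z) * of_real (gauss z)) \<le> (LINT x|lborel. B * cmod (g x)) * gauss z" for m
      by (intro always_eventually allI) (simp only: norm_mult norm_of_real abs_of_nonneg[OF gauss_nonneg], intro mult_right_mono k_bound gauss_nonneg)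
  qed (auto intro!: integrable_mult_right integrable_gauss)
  then have "?A \<longlonglongrightarrow> (2 * pi) ^ DIM('a) * (?k 0 * of_real (LINT z::'a|lborel. gauss z))"
    unfolding A by (intro tendsto_intros) (simp add: integral_complex_of_real)
  then have lim: "?A \<longlonglongrightarrow> (2 * pi) ^ DIM('a) * ?k 0" by (simp add: integral_gauss)
  let ?N = "\<lambda>m. \<integral>\<^sup>+\<xi>. ennreal ((cmod (fourier g \<xi>))\<^sup>2 * ?E m \<xi>) \<partial>lborel"
  have NA: "?N m = ennreal (Re (?A m))" for m
  proof -
    have b: "cmod (fourier g \<xi>) \<le> (LINT x|lborel. cmod (g x))" for \<xi> by (rule cmod_fourier_le[OF g])
    have iE: "integrable lborel (?E m)"
      using fourier_gauss_dilate(1)[OF e(1)[of m], where 'a='a] by (simp only: complex_of_real_integrable_eq)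
    have i: "integrable lborel (\<lambda>\<xi>. (cmod (fourier g \<xi>))\<^sup>2 * ?E m \<xi>)"
      by (rule Bochner_Integration.integrable_bound[OF integrable_mult_right[OF iE, of "(LINT x|lborel. cmod (g x))\<^sup>2"]])
         (auto intro!: always_eventually mult_right_mono power_mono b)
    have "?A m = of_real (LINT \<xi>|lborel. (cmod (fourier g \<xi>))\<^sup>2 * ?E m \<xi>)"
      by (simp only: of_real_mult[symmetric] integral_complex_of_real)
    then have "Re (?A m) = (LINT \<xi>|lborel. (cmod (fourier g \<xi>))\<^sup>2 * ?E m \<xi>)" by (simp only: Re_complex_of_real)
    then show ?thesis using nn_integral_eq_integral[OF i] by simp
  qed
  have "?N \<longlonglongrightarrow> energy (fourier g)"
  proof (rule nn_integral_LIMSEQ)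
    have "e (Suc m) \<le> e m" for m by (simp add: e_def field_simps)
    then have "?E m \<xi> \<le> ?E (Suc m) \<xi>" for m \<xi>
      using e(1) by (auto intro!: power_mono mult_right_mono simp: less_imp_le)
    then show "incseq (\<lambda>m \<xi>. ennreal ((cmod (fourier g \<xi>))\<^sup>2 * ?E m \<xi>))"
      by (intro incseq_SucI le_funI ennreal_leI mult_left_mono) auto
    show "(\<lambda>m. ennreal ((cmod (fourier g \<xi>))\<^sup>2 * ?E m \<xi>)) \<longlonglongrightarrow> ennreal ((cmod (fourier g \<xi>))\<^sup>2)" for \<xi>
      by (rule tendsto_ennrealI) (auto intro!: tendsto_eq_intros e)
  qed measurable
  moreover have "?N \<longlonglongrightarrow> ennreal (Re ((2 * pi) ^ DIM('a) * ?k 0))"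
    unfolding NA by (intro tendsto_ennrealI tendsto_Re lim)
  ultimately have "energy (fourier g) = ennreal (Re ((2 * pi) ^ DIM('a) * ?k 0))"
    by (rule LIMSEQ_unique)
  also have "?k 0 = of_real (LINT x|lborel. (cmod (g x))\<^sup>2)"
    by (simp add: autocorrelation_def complex_norm_square[symmetric] integral_complex_of_real del: of_real_power)
  also have "ennreal (Re (complex_of_real ((2 * pi) ^ DIM('a)) * complex_of_real (LINT x|lborel. (cmod (g x))\<^sup>2)))
      = ennreal ((2 * pi) ^ DIM('a) * (LINT x|lborel. (cmod (g x))\<^sup>2))"
    unfolding of_real_mult[symmetric] Re_complex_of_real ..
  also have "\<dots> = ennreal ((2 * pi) ^ DIM('a)) * energy g"
  proof -
    have "integrable lborel (\<lambda>x. (cmod (g x))\<^sup>2)"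
      by (rule Bochner_Integration.integrable_bound[OF g2])
         (auto intro!: always_eventually mult_right_mono B order_trans[OF _ abs_ge_self] simp: power2_eq_square)
    then show ?thesis by (simp add: nn_integral_eq_integral ennreal_mult)
  qed
  finally show ?thesis .
qed

section \<open>Radial functions and the Laplacian\<close>

lemma fourier_laplacian:
  fixes f :: "'a::euclidean_space \<Rightarrow> complex"
  assumes D1: "\<And>x. (f has_derivative f' x) (at x)"
    and D2: "\<And>x b. b \<in> Basis \<Longrightarrow> ((\<lambda>x. f' x b) has_derivative f'' b x) (at x)"
    and cont: "\<And>b. b \<in> Basis \<Longrightarrow> continuous_on UNIV (\<lambda>x. f'' b x b)"
    and supp: "\<And>x. norm x > R \<Longrightarrow> f x = 0" "\<And>x b. norm x > R \<Longrightarrow> f' x b = 0"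
      "\<And>x b. norm x > R \<Longrightarrow> f'' b x b = 0"
  shows "fourier (\<lambda>x. \<Sum>b\<in>Basis. f'' b x b) \<xi> = - of_real ((norm \<xi>)\<^sup>2) * fourier f \<xi>"
proof -
  have cont1: "continuous_on UNIV (\<lambda>x. f' x b)" if "b \<in> Basis" for b
    using D2[OF that] by (meson continuous_at_imp_continuous_on has_derivative_continuous)
  have "fourier (\<lambda>x. f'' b x b) \<xi> = - of_real ((b \<bullet> \<xi>)\<^sup>2) * fourier f \<xi>" if b: "b \<in> Basis" for b
  proof -
    have "fourier (\<lambda>x. f'' b x b) \<xi> = \<i> * of_real (b \<bullet> \<xi>) * fourier (\<lambda>x. f' x b) \<xi>"
      by (rule fourier_directional_derivative[where R = R, OF D2[OF b] cont[OF b]]) (simp_all add: supp)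
    also have "fourier (\<lambda>x. f' x b) \<xi> = \<i> * of_real (b \<bullet> \<xi>) * fourier f \<xi>"
      by (rule fourier_directional_derivative[where R = R, OF D1 cont1[OF b]]) (simp_all add: supp)
    finally show ?thesis
      by (simp add: power2_eq_square mult.assoc[symmetric]) (simp add: mult.assoc mult.left_commute)
  qed
  then have "(\<Sum>b\<in>Basis. fourier (\<lambda>x. f'' b x b) \<xi>) = (\<Sum>b\<in>Basis. - of_real ((b \<bullet> \<xi>)\<^sup>2) * fourier f \<xi>)"
    by simp
  also have "\<dots> = - of_real (\<Sum>b\<in>Basis. (b \<bullet> \<xi>)\<^sup>2) * fourier f \<xi>"
    by (simp add: sum_distrib_right sum_negf)
  also have "(\<Sum>b\<in>Basis. (b \<bullet> \<xi>)\<^sup>2) = (norm \<xi>)\<^sup>2"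
    by (simp add: norm_eq_sqrt_inner euclidean_inner[of \<xi> \<xi>] power2_eq_square sum_nonneg inner_commute)
  finally show ?thesis
    by (subst fourier_sum) (auto intro!: integrable_continuous_compact_support[OF cont] supp)
qed

lemma has_derivative_norm_inner:
  fixes x :: "'a::euclidean_space"
  assumes "x \<noteq> 0"
  shows "(norm has_derivative (\<lambda>v. (x \<bullet> v) / norm x)) (at x)"
  using has_derivative_norm[of x] assms by (simp add: sgn_div_norm inner_commute divide_inverse mult.commute)

lemma has_derivative_radial:
  fixes g :: "real \<Rightarrow> complex" and x :: "'a::euclidean_space"
  assumes "x \<noteq> 0" "(g has_vector_derivative g') (at (norm x))"
  shows "((\<lambda>x. g (norm x)) has_derivative (\<lambda>v. ((x \<bullet> v) / norm x) *\<^sub>R g')) (at x)"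
  using has_derivative_compose[OF has_derivative_norm_inner[OF assms(1)] assms(2)[unfolded has_vector_derivative_def]] .

text \<open>
  In polar form the Laplacian of \<open>g \<circ> norm\<close> is \<open>g'' + (n - 1) / r * g'\<close>. The support away from the origin makes the
  composite twice differentiable there as well.
\<close>

lemma fourier_radial_laplacian:
  fixes g g1 g2 :: "real \<Rightarrow> complex" and \<xi> :: "'a::euclidean_space"
  assumes g1: "\<And>r. r > 0 \<Longrightarrow> (g has_vector_derivative g1 r) (at r)"
    and g2: "\<And>r. r > 0 \<Longrightarrow> (g1 has_vector_derivative g2 r) (at r)"
    and cont: "continuous_on {0<..} g2"
    and \<alpha>: "\<alpha> > 0" and supp: "\<And>r. r < \<alpha> \<or> r > \<beta> \<Longrightarrow> g r = 0 \<and> g1 r = 0 \<and> g2 r = 0"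
  shows "fourier (\<lambda>x::'a. g2 (norm x) + of_real ((real DIM('a) - 1) / norm x) * g1 (norm x)) \<xi>
    = - of_real ((norm \<xi>)\<^sup>2) * fourier (\<lambda>x. g (norm x)) \<xi>"
proof -
  let ?f' = "\<lambda>x v::'a. ((x \<bullet> v) / norm x) *\<^sub>R g1 (norm x)"
  let ?f'' = "\<lambda>b x v::'a. ((v \<bullet> b) / norm x - (x \<bullet> b) * (x \<bullet> v) / norm x ^ 3) *\<^sub>R g1 (norm x)
      + ((x \<bullet> b) * (x \<bullet> v) / norm x ^ 2) *\<^sub>R g2 (norm x)"
  have ball: "(h has_derivative (\<lambda>v. 0)) (at x)"
    if "norm x < \<alpha>" "\<And>y. norm y < \<alpha> \<Longrightarrow> h y = 0" for h :: "'a \<Rightarrow> complex" and x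
    by (rule has_derivative_transform_within_open[of "\<lambda>_. 0" _ _ _ "ball 0 \<alpha>"]) (use that in auto)
  have "fourier (\<lambda>x. \<Sum>b\<in>Basis. ?f'' b x b) \<xi> = - of_real ((norm \<xi>)\<^sup>2) * fourier (\<lambda>x. g (norm x)) \<xi>"
  proof (rule fourier_laplacian[where R = "\<beta>" and f' = ?f' and f'' = ?f''])
    fix x b :: 'a
    show "((\<lambda>x. g (norm x)) has_derivative ?f' x) (at x)"
    proof (cases "x = 0")
      case True
      then show ?thesis using ball[of x "\<lambda>x. g (norm x)"] \<alpha> supp by simp
    qed (rule has_derivative_radial, simp, rule g1, simp)
    show "((\<lambda>x. ?f' x b) has_derivative ?f'' b x) (at x)"
    proof (cases "x = 0")
      case True
      then show ?thesis using ball[of x "\<lambda>x. ?f' x b"] \<alpha> supp by simp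
    next
      case False
      have n: "((\<lambda>x. (x \<bullet> b) / norm x) has_derivative (\<lambda>v. (v \<bullet> b) / norm x - (x \<bullet> b) * (x \<bullet> v) / norm x ^ 3)) (at x)"
      proof (rule has_derivative_eq_rhs)
        show "((\<lambda>x. (x \<bullet> b) / norm x) has_derivative
          (\<lambda>v. ((v \<bullet> b) * norm x - (x \<bullet> b) * ((x \<bullet> v) / norm x)) / (norm x * norm x))) (at x)"
          by (rule has_derivative_divide'[OF _ has_derivative_norm_inner[OF False]])
             (use False in \<open>auto intro!: derivative_eq_intros\<close>)
      qed (use False in \<open>auto simp: fun_eq_iff field_simps power3_eq_cube\<close>)
      show ?thesis
        by (rule has_derivative_eq_rhs[OF has_derivative_scaleR[OF n has_derivative_radial[OF False g2]]])
           (use False in \<open>simp_all add: fun_eq_iff power2_eq_square add.commute\<close>)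
    qed
    show "continuous_on UNIV (\<lambda>x. ?f'' b x b)"
    proof -
      have "continuous_on {0<..} g1"
        using g2 by (meson continuous_at_imp_continuous_on greaterThan_iff has_vector_derivative_continuous)
      then have c1: "continuous_on (- {0::'a}) (\<lambda>x. g1 (norm x))"
        by (rule continuous_on_compose2) (auto intro!: continuous_intros)
      have c2: "continuous_on (- {0::'a}) (\<lambda>x. g2 (norm x))"
        by (rule continuous_on_compose2[OF cont]) (auto intro!: continuous_intros)
      have "continuous_on (- {0}) (\<lambda>x. ?f'' b x b)"
        by (intro continuous_intros c1 c2) simp_all
      moreover have "continuous_on (ball 0 \<alpha>) (\<lambda>x. ?f'' b x b)"
        by (rule continuous_on_eq[where f = "\<lambda>_. 0"]) (use supp in auto)
      ultimately have "continuous_on (- {0} \<union> ball 0 \<alpha>) (\<lambda>x. ?f'' b x b)"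
        by (intro continuous_on_open_Un) auto
      moreover have "- {0} \<union> ball 0 \<alpha> = (UNIV :: 'a set)" using \<alpha> by auto
      ultimately show ?thesis by simp
    qed
    show "g (norm x) = 0" "?f' x b = 0" "?f'' b x b = 0" if "norm x > \<beta>"
      using that supp by simp_all
  qed
  moreover have "(\<Sum>b\<in>Basis. ?f'' b x b) = g2 (norm x) + of_real ((real DIM('a) - 1) / norm x) * g1 (norm x)" for x
  proof (cases "x = 0")
    case True
    then show ?thesis using supp[of 0] \<alpha> by simp
  next
    case False
    have s: "(\<Sum>b\<in>Basis. (x \<bullet> b) * (x \<bullet> b)) = (norm x)\<^sup>2"
      by (simp add: norm_eq_sqrt_inner euclidean_inner[of x x] sum_nonneg)
    have "(\<Sum>b\<in>Basis. ?f'' b x b)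
      = (\<Sum>b\<in>Basis. 1 / norm x - (x \<bullet> b) * (x \<bullet> b) / norm x ^ 3) *\<^sub>R g1 (norm x)
        + (\<Sum>b\<in>Basis. (x \<bullet> b) * (x \<bullet> b) / norm x ^ 2) *\<^sub>R g2 (norm x)"
      by (simp add: sum.distrib scaleR_sum_left inner_Basis)
    also have "(\<Sum>b\<in>Basis. 1 / norm x - (x \<bullet> b) * (x \<bullet> b) / norm x ^ 3) = (real DIM('a) - 1) / norm x"
      using False by (simp add: sum_subtractf sum_divide_distrib[symmetric] s diff_divide_distrib power2_eq_square power3_eq_cube)
    also have "(\<Sum>b\<in>Basis. (x \<bullet> b) * (x \<bullet> b) / norm x ^ 2) = 1"
      using False by (simp add: sum_divide_distrib[symmetric] s)
    finally show ?thesis by (simp add: scaleR_conv_of_real)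
  qed
  ultimately show ?thesis by (simp only:)
qed

text \<open>
  A radial carrier wave of frequency 1 with amplitude \<open>F\<close>.
\<close>

definition wave :: "(real \<Rightarrow> complex) \<Rightarrow> 'a::euclidean_space \<Rightarrow> complex" where
  "wave F x = exp (- (\<i> * of_real (norm x))) * F (norm x)"

text \<open>
  The operator \<open>- \<Delta> - 1\<close> in dimension \<open>n\<close> seen by the amplitude of a carrier wave; \<open>F1\<close> and \<open>F2\<close> stand for the first
  two derivatives of \<open>F\<close>.
\<close>

definition wave_op :: "real \<Rightarrow> (real \<Rightarrow> complex) \<Rightarrow> (real \<Rightarrow> complex) \<Rightarrow> (real \<Rightarrow> complex) \<Rightarrow> real \<Rightarrow> complex" where
  "wave_op n F F1 F2 r = - F2 r + 2 * \<i> * F1 r - of_real ((n - 1) / r) * F1 r + \<i> * of_real ((n - 1) / r) * F r"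

lemma wave_continuous:
  assumes "continuous_on {0<..} F" "\<alpha> > 0" "\<And>r. r < \<alpha> \<Longrightarrow> F r = 0"
  shows "continuous_on UNIV (wave F :: 'a::euclidean_space \<Rightarrow> complex)"
proof -
  have "continuous_on (- {0}) (wave F :: 'a \<Rightarrow> complex)"
    unfolding wave_def[abs_def]
    by (intro continuous_intros continuous_on_compose2[OF assms(1)]) auto
  moreover have "continuous_on (ball 0 \<alpha>) (wave F :: 'a \<Rightarrow> complex)"
    by (rule continuous_on_eq[where f = "\<lambda>_. 0"]) (use assms(3) in \<open>auto simp: wave_def\<close>)
  ultimately have "continuous_on (- {0} \<union> ball 0 \<alpha>) (wave F :: 'a \<Rightarrow> complex)"
    by (intro continuous_on_open_Un) auto
  moreover have "- {0} \<union> ball 0 \<alpha> = (UNIV :: 'a set)" using assms(2) by auto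
  ultimately show ?thesis by simp
qed

lemma fourier_wave_op:
  fixes \<xi> :: "'a::euclidean_space"
  assumes F1: "\<And>r. r > 0 \<Longrightarrow> (F has_vector_derivative F1 r) (at r)"
    and F2: "\<And>r. r > 0 \<Longrightarrow> (F1 has_vector_derivative F2 r) (at r)"
    and cont: "continuous_on {0<..} F2"
    and \<alpha>: "\<alpha> > 0" and supp: "\<And>r. r < \<alpha> \<or> r > \<beta> \<Longrightarrow> F r = 0 \<and> F1 r = 0 \<and> F2 r = 0"
  shows "of_real ((norm \<xi>)\<^sup>2 - 1) * fourier (wave F) \<xi> = fourier (wave (wave_op (real DIM('a)) F F1 F2)) \<xi>"
proof -
  let ?e = "\<lambda>r::real. exp (- (\<i> * of_real r))"
  let ?g = "\<lambda>r. ?e r * F r" and ?g1 = "\<lambda>r. ?e r * (F1 r - \<i> * F r)"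
    and ?g2 = "\<lambda>r. ?e r * (F2 r - 2 * \<i> * F1 r - F r)"
  let ?L = "\<lambda>x::'a. ?g2 (norm x) + of_real ((real DIM('a) - 1) / norm x) * ?g1 (norm x)"
  have De: "(?e has_vector_derivative (- \<i> * ?e r)) (at r)" for r
  proof -
    have "((\<lambda>z. exp (- (\<i> * z))) has_field_derivative (exp (- (\<i> * of_real r)) * (- \<i>))) (at (of_real r))"
      by (auto intro!: derivative_eq_intros)
    moreover have "((\<lambda>t::real. complex_of_real t) has_vector_derivative of_real 1) (at r)"
      by (intro has_vector_derivative_of_real DERIV_ident)
    ultimately show ?thesis
      using field_vector_diff_chain_at[of complex_of_real "of_real 1" r "\<lambda>z. exp (- (\<i> * z))" "exp (- (\<i> * of_real r)) * (- \<i>)"] by (simp add: o_def mult.commute[of _ "\<i>"])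
  qed
  have contF: "continuous_on {0<..} F" "continuous_on {0<..} F1"
    using F1 F2 by (meson continuous_at_imp_continuous_on greaterThan_iff has_vector_derivative_continuous)+
  have L: "fourier ?L \<xi> = - of_real ((norm \<xi>)\<^sup>2) * fourier (\<lambda>x. ?g (norm x)) \<xi>"
  proof (rule fourier_radial_laplacian[where \<alpha> = \<alpha> and \<beta> = \<beta>])
    show "(?g has_vector_derivative ?g1 r) (at r)" if "r > 0" for r
      using has_vector_derivative_mult[OF De F1[OF that]] by (simp add: algebra_simps)
    show "(?g1 has_vector_derivative ?g2 r) (at r)" if "r > 0" for r
    proof -
      have "((\<lambda>r. F1 r - \<i> * F r) has_vector_derivative (F2 r - \<i> * F1 r)) (at r)"
        by (intro has_vector_derivative_diff has_vector_derivative_mult_right F1 F2 that)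
      from has_vector_derivative_mult[OF De this] show ?thesis by (simp add: algebra_simps)
    qed
    show "continuous_on {0<..} ?g2" by (intro continuous_intros cont contF)
  qed (use \<alpha> supp in auto)
  have iw: "integrable lborel (wave F :: 'a \<Rightarrow> complex)"
    by (rule integrable_continuous_compact_support[where R = \<beta>, OF wave_continuous[OF contF(1) \<alpha>]])
       (use supp in \<open>auto simp: wave_def\<close>)
  have iop: "integrable lborel (wave (wave_op (real DIM('a)) F F1 F2) :: 'a \<Rightarrow> complex)"
  proof (rule integrable_continuous_compact_support[where R = \<beta>, OF wave_continuous[OF _ \<alpha>]])
    show "continuous_on {0<..} (wave_op (real DIM('a)) F F1 F2)"
      unfolding wave_op_def[abs_def] by (intro continuous_intros cont contF) auto
  qed (use supp in \<open>auto simp: wave_def wave_op_def\<close>)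
  have eq: "?L x = - 1 * wave (wave_op (real DIM('a)) F F1 F2) x + - 1 * wave F x" for x
  proof -
    have "E * (c - 2 * \<i> * b - d) + q * (E * (b - \<i> * d)) = - 1 * (E * (- c + 2 * \<i> * b - q * b + \<i> * q * d)) + - 1 * (E * d)"
      for E b c d q :: complex by (simp add: algebra_simps)
    then show ?thesis unfolding wave_def wave_op_def .
  qed
  have "fourier ?L \<xi> = - 1 * fourier (wave (wave_op (real DIM('a)) F F1 F2)) \<xi> + - 1 * fourier (wave F) \<xi>"
    unfolding eq fourier_cmult[symmetric]
    by (intro fourier_add integrable_mult_right iop iw)
  moreover have "(\<lambda>x::'a. ?g (norm x)) = wave F" by (auto simp: wave_def)
  ultimately show ?thesis using L by (simp add: algebra_simps)
qed

section \<open>Symbols and packets\<close>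

text \<open>
  Half-thickness \<open>1/\<mu>\<close> and radius \<open>\<rho>\<close> of a shell, with \<open>\<rho>\<close> comparable to \<open>1/\<mu>\<^sup>2\<close>. The factor 3 keeps the whole shell in the
  region \<open>r > 1/\<mu>\<^sup>2\<close>, where \<open>1/r\<close> is bounded by \<open>\<mu>\<^sup>2\<close>.
\<close>

definition adm :: "real \<Rightarrow> real \<Rightarrow> real \<Rightarrow> bool" where
  "adm A \<mu> \<rho> \<longleftrightarrow> 0 < \<mu> \<and> \<mu> \<le> 1 \<and> 3 / \<mu>\<^sup>2 \<le> \<rho> \<and> \<rho> \<le> A / \<mu>\<^sup>2"

definition rderiv :: "(real \<Rightarrow> real \<Rightarrow> real \<Rightarrow> complex) \<Rightarrow> real \<Rightarrow> real \<Rightarrow> real \<Rightarrow> complex" where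
  "rderiv F \<mu> \<rho> r = vector_derivative (F \<mu> \<rho>) (at r)"

text \<open>
  An amplitude is a family of functions of \<open>r\<close>, indexed by \<open>\<mu>\<close> and \<open>\<rho>\<close>. All constants are uniform in the admissible
  parameters; this uniformity is what makes the later estimates usable as \<open>\<mu>\<close> tends to 0.
\<close>

definition of_size :: "real \<Rightarrow> nat \<Rightarrow> (real \<Rightarrow> real \<Rightarrow> real \<Rightarrow> complex) \<Rightarrow> bool" where
  "of_size A k F \<longleftrightarrow> (\<exists>C\<ge>0. \<forall>\<mu> \<rho> r. adm A \<mu> \<rho> \<longrightarrow> r > 1 / \<mu>\<^sup>2 \<longrightarrow> cmod (F \<mu> \<rho> r) \<le> C * \<mu> ^ k)"

text \<open>
  Symbols of order \<open>k\<close> with \<open>j\<close> controlled derivatives: every differentiation in \<open>r\<close> gains one factor \<open>\<mu>\<close>. Recursion on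
  \<open>j\<close> lets products be handled by the product rule for a single derivative.
\<close>

primrec symb :: "real \<Rightarrow> nat \<Rightarrow> nat \<Rightarrow> (real \<Rightarrow> real \<Rightarrow> real \<Rightarrow> complex) \<Rightarrow> bool" where
  "symb A 0 k F \<longleftrightarrow> of_size A k F"
| "symb A (Suc j) k F \<longleftrightarrow> of_size A k F
     \<and> (\<forall>\<mu> \<rho> r. adm A \<mu> \<rho> \<longrightarrow> r > 1 / \<mu>\<^sup>2 \<longrightarrow> F \<mu> \<rho> differentiable (at r))
     \<and> symb A j (Suc k) (rderiv F)"

lemma symb_cong_imp:
  assumes "\<And>\<mu> \<rho> r. adm A \<mu> \<rho> \<Longrightarrow> r > 1 / \<mu>\<^sup>2 \<Longrightarrow> F \<mu> \<rho> r = G \<mu> \<rho> r" "symb A j k G"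
  shows "symb A j k F"
  using assms
proof (induction j arbitrary: k F G)
  case 0
  then show ?case by (auto simp: of_size_def)
next
  case (Suc j)
  have D: "(F \<mu> \<rho> has_vector_derivative rderiv G \<mu> \<rho> r) (at r)" if "adm A \<mu> \<rho>" "r > 1 / \<mu>\<^sup>2" for \<mu> \<rho> r
  proof -
    have "(G \<mu> \<rho> has_vector_derivative rderiv G \<mu> \<rho> r) (at r)"
      using Suc.prems(2) that by (simp add: rderiv_def vector_derivative_works)
    then show ?thesis
      by (rule has_vector_derivative_transform_within_open[of _ _ _ "{1 / \<mu>\<^sup>2<..}"]) (use that Suc.prems(1) in auto)
  qed
  have "symb A j (Suc k) (rderiv F)"
  proof (rule Suc.IH)
    show "symb A j (Suc k) (rderiv G)" using Suc.prems(2) by simp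
    show "rderiv F \<mu> \<rho> r = rderiv G \<mu> \<rho> r" if "adm A \<mu> \<rho>" "r > 1 / \<mu>\<^sup>2" for \<mu> \<rho> r
      using vector_derivative_at[OF D[OF that]] by (simp add: rderiv_def)
  qed
  moreover have "of_size A k F" using Suc.prems by (auto simp: of_size_def)
  ultimately show ?case using D by (auto simp: differentiable_def has_vector_derivative_def)
qed

lemma symb_SucI:
  assumes "of_size A k F"
    and D: "\<And>\<mu> \<rho> r. adm A \<mu> \<rho> \<Longrightarrow> r > 1 / \<mu>\<^sup>2 \<Longrightarrow> (F \<mu> \<rho> has_vector_derivative F' \<mu> \<rho> r) (at r)"
    and "symb A j (Suc k) F'"
  shows "symb A (Suc j) k F"
proof -
  have "symb A j (Suc k) (rderiv F)"
    by (rule symb_cong_imp[OF _ assms(3)]) (auto simp: rderiv_def intro!: vector_derivative_at D)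
  then show ?thesis using assms(1) D by (auto simp: differentiable_def has_vector_derivative_def)
qed

lemma symb_of_size: "symb A j k F \<Longrightarrow> of_size A k F"
  by (cases j) auto

lemma symb_decr: "symb A (Suc j) k F \<Longrightarrow> symb A j k F"
  by (induction j arbitrary: k F) auto

lemma symb_has_vector_derivative:
  assumes "symb A (Suc j) k F" "adm A \<mu> \<rho>" "r > 1 / \<mu>\<^sup>2"
  shows "(F \<mu> \<rho> has_vector_derivative rderiv F \<mu> \<rho> r) (at r)"
  using assms by (simp add: rderiv_def vector_derivative_works)

lemma of_size_weaken: "of_size A (Suc k) F \<Longrightarrow> of_size A k F"
  unfolding of_size_def
proof (elim exE conjE)
  fix C assume C: "0 \<le> C" "\<forall>\<mu> \<rho> r. adm A \<mu> \<rho> \<longrightarrow> r > 1 / \<mu>\<^sup>2 \<longrightarrow> cmod (F \<mu> \<rho> r) \<le> C * \<mu> ^ Suc k"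
  have "cmod (F \<mu> \<rho> r) \<le> C * \<mu> ^ k" if "adm A \<mu> \<rho>" "r > 1 / \<mu>\<^sup>2" for \<mu> \<rho> r
  proof -
    have "C * \<mu> ^ Suc k \<le> C * \<mu> ^ k"
      using C(1) that(1) by (intro mult_left_mono power_decreasing) (auto simp: adm_def)
    then show ?thesis using C(2) that by (meson order_trans)
  qed
  then show "\<exists>C\<ge>0. \<forall>\<mu> \<rho> r. adm A \<mu> \<rho> \<longrightarrow> r > 1 / \<mu>\<^sup>2 \<longrightarrow> cmod (F \<mu> \<rho> r) \<le> C * \<mu> ^ k"
    using C(1) by blast
qed

lemma symb_weaken: "symb A j (Suc k) F \<Longrightarrow> symb A j k F"
  by (induction j arbitrary: k F) (auto intro: of_size_weaken)

lemma of_size_add: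
  assumes "of_size A k F" "of_size A k G"
  shows "of_size A k (\<lambda>\<mu> \<rho> r. F \<mu> \<rho> r + G \<mu> \<rho> r)"
proof -
  obtain C where C: "0 \<le> C" "\<And>\<mu> \<rho> r. adm A \<mu> \<rho> \<Longrightarrow> r > 1 / \<mu>\<^sup>2 \<Longrightarrow> cmod (F \<mu> \<rho> r) \<le> C * \<mu> ^ k"
    using assms(1) by (auto simp: of_size_def)
  obtain C' where C': "0 \<le> C'" "\<And>\<mu> \<rho> r. adm A \<mu> \<rho> \<Longrightarrow> r > 1 / \<mu>\<^sup>2 \<Longrightarrow> cmod (G \<mu> \<rho> r) \<le> C' * \<mu> ^ k"
    using assms(2) by (auto simp: of_size_def)
  show ?thesis
    unfolding of_size_def
    by (intro exI[of _ "C + C'"]) (use C C' in \<open>auto simp: distrib_right intro!: norm_triangle_mono\<close>)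
qed

lemma of_size_mult:
  assumes "of_size A k F" "of_size A l G"
  shows "of_size A (k + l) (\<lambda>\<mu> \<rho> r. F \<mu> \<rho> r * G \<mu> \<rho> r)"
proof -
  obtain C where C: "0 \<le> C" "\<And>\<mu> \<rho> r. adm A \<mu> \<rho> \<Longrightarrow> r > 1 / \<mu>\<^sup>2 \<Longrightarrow> cmod (F \<mu> \<rho> r) \<le> C * \<mu> ^ k"
    using assms(1) by (auto simp: of_size_def)
  obtain C' where C': "0 \<le> C'" "\<And>\<mu> \<rho> r. adm A \<mu> \<rho> \<Longrightarrow> r > 1 / \<mu>\<^sup>2 \<Longrightarrow> cmod (G \<mu> \<rho> r) \<le> C' * \<mu> ^ l"
    using assms(2) by (auto simp: of_size_def)
  have "cmod (F \<mu> \<rho> r * G \<mu> \<rho> r) \<le> C * C' * \<mu> ^ (k + l)" if "adm A \<mu> \<rho>" "r > 1 / \<mu>\<^sup>2" for \<mu> \<rho> r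
  proof -
    have "cmod (F \<mu> \<rho> r * G \<mu> \<rho> r) \<le> (C * \<mu> ^ k) * (C' * \<mu> ^ l)"
      unfolding norm_mult using C C' that by (intro mult_mono) (auto simp: adm_def)
    then show ?thesis by (simp add: power_add ac_simps)
  qed
  then show ?thesis
    unfolding of_size_def using C(1) C'(1) by (intro exI[of _ "C * C'"]) auto
qed

lemma symb_add: "symb A j k F \<Longrightarrow> symb A j k G \<Longrightarrow> symb A j k (\<lambda>\<mu> \<rho> r. F \<mu> \<rho> r + G \<mu> \<rho> r)"
proof (induction j arbitrary: k F G)
  case 0
  then show ?case by (simp add: of_size_add)
next
  case (Suc j)
  show ?case
  proof (rule symb_SucI)
    show "of_size A k (\<lambda>\<mu> \<rho> r. F \<mu> \<rho> r + G \<mu> \<rho> r)"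
      using Suc.prems by (intro of_size_add symb_of_size)
    show "((\<lambda>r. F \<mu> \<rho> r + G \<mu> \<rho> r) has_vector_derivative (rderiv F \<mu> \<rho> r + rderiv G \<mu> \<rho> r)) (at r)"
      if "adm A \<mu> \<rho>" "r > 1 / \<mu>\<^sup>2" for \<mu> \<rho> r
      by (intro has_vector_derivative_add symb_has_vector_derivative[OF Suc.prems(1) that] symb_has_vector_derivative[OF Suc.prems(2) that])
    show "symb A j (Suc k) (\<lambda>\<mu> \<rho> r. rderiv F \<mu> \<rho> r + rderiv G \<mu> \<rho> r)"
      using Suc.prems by (intro Suc.IH) simp_all
  qed
qed

lemma symb_mult: "symb A j k F \<Longrightarrow> symb A j l G \<Longrightarrow> symb A j (k + l) (\<lambda>\<mu> \<rho> r. F \<mu> \<rho> r * G \<mu> \<rho> r)"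
proof (induction j arbitrary: k l F G)
  case 0
  then show ?case by (simp add: of_size_mult)
next
  case (Suc j)
  show ?case
  proof (rule symb_SucI)
    show "of_size A (k + l) (\<lambda>\<mu> \<rho> r. F \<mu> \<rho> r * G \<mu> \<rho> r)"
      using Suc.prems by (intro of_size_mult symb_of_size)
    show "((\<lambda>r. F \<mu> \<rho> r * G \<mu> \<rho> r) has_vector_derivative (F \<mu> \<rho> r * rderiv G \<mu> \<rho> r + rderiv F \<mu> \<rho> r * G \<mu> \<rho> r)) (at r)"
      if "adm A \<mu> \<rho>" "r > 1 / \<mu>\<^sup>2" for \<mu> \<rho> r
      by (intro has_vector_derivative_mult symb_has_vector_derivative[OF Suc.prems(1) that] symb_has_vector_derivative[OF Suc.prems(2) that])
    have "symb A j (k + Suc l) (\<lambda>\<mu> \<rho> r. F \<mu> \<rho> r * rderiv G \<mu> \<rho> r)"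
      using Suc.prems by (intro Suc.IH) (auto intro: symb_decr)
    moreover have "symb A j (Suc k + l) (\<lambda>\<mu> \<rho> r. rderiv F \<mu> \<rho> r * G \<mu> \<rho> r)"
      using Suc.prems by (intro Suc.IH) (auto intro: symb_decr)
    ultimately show "symb A j (Suc (k + l)) (\<lambda>\<mu> \<rho> r. F \<mu> \<rho> r * rderiv G \<mu> \<rho> r + rderiv F \<mu> \<rho> r * G \<mu> \<rho> r)"
      by (intro symb_add) simp_all
  qed
qed

text \<open>
  For \<open>r > 1/\<mu>\<^sup>2\<close> a factor \<open>1/r\<close> is worth two factors \<open>\<mu>\<close>. Differentiation creates one more factor \<open>1/r\<close> while the
  required order rises only by one.
\<close>

lemma symb_inverse_power:
  "k \<le> 2 * m \<Longrightarrow> symb A j k (\<lambda>\<mu> \<rho> r. c * of_real (inverse r) ^ m)"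
proof (induction j arbitrary: k c m)
  have size: "of_size A k (\<lambda>\<mu> \<rho> r. c * of_real (inverse r) ^ m)" if k: "k \<le> 2 * m" for k m c
  proof -
    have "cmod (c * of_real (inverse r) ^ m) \<le> cmod c * \<mu> ^ k" if "adm A \<mu> \<rho>" "r > 1 / \<mu>\<^sup>2" for \<mu> \<rho> r
    proof -
      have \<mu>: "0 < \<mu>" "\<mu> \<le> 1" using that by (auto simp: adm_def)
      have r: "r > 0" using that(2) \<mu>(1) by (meson divide_nonneg_nonneg le_less_trans zero_le_one zero_le_power2)
      have "inverse r \<le> \<mu>\<^sup>2" using that(2) \<mu> r by (simp add: field_simps)
      then have "inverse r ^ m \<le> (\<mu>\<^sup>2) ^ m" using r by (intro power_mono) auto
      also have "\<dots> = \<mu> ^ (2 * m)" by (simp add: power_mult)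
      also have "\<dots> \<le> \<mu> ^ k" using k \<mu> by (intro power_decreasing) auto
      finally show ?thesis using r by (simp add: norm_mult norm_power norm_inverse mult_left_mono)
    qed
    then show ?thesis unfolding of_size_def by (intro exI[of _ "cmod c"]) auto
  qed
  {
    case 0
    then show ?case using size by simp
  next
    case (Suc j)
    show ?case
    proof (rule symb_SucI)
      show "of_size A k (\<lambda>\<mu> \<rho> r. c * of_real (inverse r) ^ m)" by (rule size[OF Suc.prems])
      show "symb A j (Suc k) (\<lambda>\<mu> \<rho> r. (- c * of_nat m) * of_real (inverse r) ^ (Suc m))"
        using Suc.prems by (intro Suc.IH) simp
      fix \<mu> \<rho> r :: real assume *: "adm A \<mu> \<rho>" "r > 1 / \<mu>\<^sup>2"
      then have r: "r > 0" by (meson divide_nonneg_nonneg le_less_trans zero_le_one zero_le_power2)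
      have "((\<lambda>r. inverse r ^ m) has_real_derivative (- real m * inverse r ^ Suc m)) (at r)"
      proof (cases m)
        case (Suc i)
        show ?thesis
          by (rule DERIV_cong[OF DERIV_power[OF DERIV_inverse]]) (use r Suc in \<open>auto simp: power_add numeral_2_eq_2 algebra_simps\<close>)
      qed simp
      from has_vector_derivative_mult_right[OF has_vector_derivative_of_real[OF this], of c]
      show "((\<lambda>r. c * of_real (inverse r) ^ m) has_vector_derivative (- c * of_nat m) * of_real (inverse r) ^ (Suc m)) (at r)"
        by (simp add: mult.assoc)
    qed
  }
qed

lemma symb_const: "symb A j 0 (\<lambda>\<mu> \<rho> r. c)"
  using symb_inverse_power[of 0 0 A j c] by simp

lemma symb_cmult: "symb A j k F \<Longrightarrow> symb A j k (\<lambda>\<mu> \<rho> r. c * F \<mu> \<rho> r)"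
  using symb_mult[OF symb_const, of A j k F c] by simp

lemma symb_over_r: "symb A j 2 (\<lambda>\<mu> \<rho> r. of_real (c / r))"
  using symb_inverse_power[of 2 1 A j "of_real c"] by (simp add: divide_inverse)

lemma symb_bump: "symb A j k (\<lambda>\<mu> \<rho> r. of_real (\<mu> ^ k * bump i (\<mu> * (r - \<rho>))))"
proof (induction j arbitrary: k i)
  have size: "of_size A k (\<lambda>\<mu> \<rho> r. of_real (\<mu> ^ k * bump i (\<mu> * (r - \<rho>))))" for k i
  proof -
    obtain C where "C \<ge> 0" "\<And>u. \<bar>bump i u\<bar> \<le> C" using bump_bounded by blast
    then show ?thesis
      unfolding of_size_def
      by (intro exI[of _ C]) (auto simp: adm_def norm_mult norm_power abs_mult mult.commute[of C] intro!: mult_left_mono)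
  qed
  {
    case 0
    then show ?case using size by simp
  next
    case (Suc j)
    show ?case
    proof (rule symb_SucI[OF size _ Suc])
      fix \<mu> \<rho> r :: real
      have "((\<lambda>r. \<mu> ^ k * bump i (\<mu> * (r - \<rho>))) has_real_derivative (\<mu> ^ Suc k * bump (Suc i) (\<mu> * (r - \<rho>)))) (at r)"
        by (rule derivative_eq_intros DERIV_chain2[OF bump_has_derivative] refl)+ simp
      then show "((\<lambda>r. complex_of_real (\<mu> ^ k * bump i (\<mu> * (r - \<rho>)))) has_vector_derivative
          of_real (\<mu> ^ Suc k * bump (Suc i) (\<mu> * (r - \<rho>)))) (at r)"
        by (rule has_vector_derivative_of_real)
    qed
  }
qed

text \<open>
  Symbols with all derivatives controlled that live in the shell of half-width \<open>1/\<mu>\<close> around radius \<open>\<rho>\<close>.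
\<close>

definition packet :: "real \<Rightarrow> nat \<Rightarrow> (real \<Rightarrow> real \<Rightarrow> real \<Rightarrow> complex) \<Rightarrow> bool" where
  "packet A k F \<longleftrightarrow> (\<forall>j. symb A j k F) \<and> (\<forall>\<mu> \<rho> r. adm A \<mu> \<rho> \<longrightarrow> \<bar>r - \<rho>\<bar> > 1 / \<mu> \<longrightarrow> F \<mu> \<rho> r = 0)"

lemma adm_support:
  assumes "adm A \<mu> \<rho>" "\<bar>r - \<rho>\<bar> \<le> 1 / \<mu>"
  shows "r > 1 / \<mu>\<^sup>2" "r \<le> (A + 1) / \<mu>\<^sup>2"
proof -
  have \<mu>: "0 < \<mu>" "\<mu> \<le> 1" "3 / \<mu>\<^sup>2 \<le> \<rho>" "\<rho> \<le> A / \<mu>\<^sup>2" using assms(1) by (auto simp: adm_def)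
  have "1 / \<mu> \<le> 1 / \<mu>\<^sup>2" using \<mu> by (simp add: field_simps power2_eq_square)
  moreover have "1 / \<mu>\<^sup>2 > 0" using \<mu> by simp
  moreover have "3 / \<mu>\<^sup>2 = 3 * (1 / \<mu>\<^sup>2)" "(A + 1) / \<mu>\<^sup>2 = A / \<mu>\<^sup>2 + 1 / \<mu>\<^sup>2" by (simp_all add: add_divide_distrib)
  ultimately show "r > 1 / \<mu>\<^sup>2" "r \<le> (A + 1) / \<mu>\<^sup>2" using assms(2) \<mu>(3,4) by linarith+
qed

lemma packet_has_vector_derivative:
  assumes F: "packet A k F" and adm: "adm A \<mu> \<rho>"
  shows "(F \<mu> \<rho> has_vector_derivative rderiv F \<mu> \<rho> r) (at r)"
proof (cases "\<bar>r - \<rho>\<bar> > 1 / \<mu>")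
  case True
  have "open {r. \<bar>r - \<rho>\<bar> > 1 / \<mu>}" by (intro open_Collect_less continuous_intros)
  then have "(F \<mu> \<rho> has_vector_derivative 0) (at r)"
    using has_vector_derivative_transform_within_open[OF has_vector_derivative_const, of "{r. \<bar>r - \<rho>\<bar> > 1 / \<mu>}" r 0 "F \<mu> \<rho>"]
      True F adm by (auto simp: packet_def)
  then show ?thesis by (simp add: rderiv_def vector_derivative_at)
next
  case False
  then have "r > 1 / \<mu>\<^sup>2" using adm_support(1)[OF adm] by simp
  then show ?thesis using F adm symb_has_vector_derivative[of A 0] unfolding packet_def by blast
qed

lemma packet_rderiv:
  assumes F: "packet A k F" shows "packet A (Suc k) (rderiv F)"
proof -
  have "rderiv F \<mu> \<rho> r = 0" if adm: "adm A \<mu> \<rho>" and r: "\<bar>r - \<rho>\<bar> > 1 / \<mu>" for \<mu> \<rho> r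
  proof -
    have "open {r. \<bar>r - \<rho>\<bar> > 1 / \<mu>}" by (intro open_Collect_less continuous_intros)
    then have "(F \<mu> \<rho> has_vector_derivative 0) (at r)"
      using has_vector_derivative_transform_within_open[OF has_vector_derivative_const, of "{r. \<bar>r - \<rho>\<bar> > 1 / \<mu>}" r 0 "F \<mu> \<rho>"]
        r F adm by (auto simp: packet_def)
    then show ?thesis by (simp add: rderiv_def vector_derivative_at)
  qed
  moreover have "symb A j (Suc k) (rderiv F)" for j
    using F unfolding packet_def by (metis symb.simps(2))
  ultimately show ?thesis by (auto simp: packet_def)
qed

lemma packet_weaken: "packet A (Suc k) F \<Longrightarrow> packet A k F"
  by (auto simp: packet_def intro: symb_weaken)

lemma packet_add: "packet A k F \<Longrightarrow> packet A k G \<Longrightarrow> packet A k (\<lambda>\<mu> \<rho> r. F \<mu> \<rho> r + G \<mu> \<rho> r)"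
  by (auto simp: packet_def intro: symb_add)

lemma packet_mult: "\<forall>j. symb A j l G \<Longrightarrow> packet A k F \<Longrightarrow> packet A (l + k) (\<lambda>\<mu> \<rho> r. G \<mu> \<rho> r * F \<mu> \<rho> r)"
  by (auto simp: packet_def intro: symb_mult)

lemma packet_cmult: "packet A k F \<Longrightarrow> packet A k (\<lambda>\<mu> \<rho> r. c * F \<mu> \<rho> r)"
  by (auto simp: packet_def intro: symb_cmult)

lemma packet_over_r: "packet A k F \<Longrightarrow> packet A (Suc (Suc k)) (\<lambda>\<mu> \<rho> r. of_real (c / r) * F \<mu> \<rho> r)"
  using packet_mult[of A 2 "\<lambda>\<mu> \<rho> r. of_real (c / r)" k F] symb_over_r by simp

definition packet_op :: "real \<Rightarrow> (real \<Rightarrow> real \<Rightarrow> real \<Rightarrow> complex) \<Rightarrow> real \<Rightarrow> real \<Rightarrow> real \<Rightarrow> complex" where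
  "packet_op n F \<mu> \<rho> = wave_op n (F \<mu> \<rho>) (rderiv F \<mu> \<rho>) (rderiv (rderiv F) \<mu> \<rho>)"

text \<open>
  What remains of \<open>- \<Delta> - 1\<close> after the transport term \<open>2 * \<i> * \<partial>\<^sub>r\<close> is removed. Only second derivatives and terms with a
  factor \<open>1/r\<close> are left, so the order rises by two instead of one.
\<close>

definition packet_rest :: "real \<Rightarrow> (real \<Rightarrow> real \<Rightarrow> real \<Rightarrow> complex) \<Rightarrow> real \<Rightarrow> real \<Rightarrow> real \<Rightarrow> complex" where
  "packet_rest n F \<mu> \<rho> r = packet_op n F \<mu> \<rho> r - 2 * \<i> * rderiv F \<mu> \<rho> r"

lemma packet_rest:
  assumes F: "packet A k F" shows "packet A (Suc (Suc k)) (packet_rest n F)"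
proof -
  note F1 = packet_rderiv[OF F]
  have "packet A (Suc (Suc k)) (\<lambda>\<mu> \<rho> r. (- 1 * rderiv (rderiv F) \<mu> \<rho> r + - 1 * (of_real ((n - 1) / r) * rderiv F \<mu> \<rho> r))
      + \<i> * (of_real ((n - 1) / r) * F \<mu> \<rho> r))"
    by (intro packet_add packet_cmult packet_rderiv[OF F1] packet_weaken[OF packet_over_r[OF F1]] packet_over_r[OF F])
  also have "(\<lambda>\<mu> \<rho> r. (- 1 * rderiv (rderiv F) \<mu> \<rho> r + - 1 * (of_real ((n - 1) / r) * rderiv F \<mu> \<rho> r))
      + \<i> * (of_real ((n - 1) / r) * F \<mu> \<rho> r)) = packet_rest n F"
    by (intro ext) (simp add: packet_rest_def packet_op_def wave_op_def mult.assoc)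
  finally show ?thesis .
qed

lemma packet_op:
  assumes F: "packet A k F" shows "packet A (Suc k) (packet_op n F)"
proof -
  have "packet A (Suc k) (\<lambda>\<mu> \<rho> r. packet_rest n F \<mu> \<rho> r + 2 * \<i> * rderiv F \<mu> \<rho> r)"
    by (intro packet_add packet_cmult packet_rderiv[OF F] packet_weaken[OF packet_rest[OF F]])
  then show ?thesis by (simp add: packet_rest_def)
qed

lemma packet_op_power: "packet A k F \<Longrightarrow> packet A (m + k) ((packet_op n ^^ m) F)"
  by (induction m) (auto intro: packet_op)

lemma packet_bump: "packet A 0 (\<lambda>\<mu> \<rho> r. of_real (bump 0 (\<mu> * (r - \<rho>))))"
  unfolding packet_def
proof (intro conjI allI impI)
  show "symb A j 0 (\<lambda>\<mu> \<rho> r. of_real (bump 0 (\<mu> * (r - \<rho>))))" for j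
    using symb_bump[of A j 0 0] by simp
  fix \<mu> \<rho> r assume "adm A \<mu> \<rho>" "1 / \<mu> < \<bar>r - \<rho>\<bar>"
  then have "\<bar>\<mu> * (r - \<rho>)\<bar> \<ge> 1" by (simp add: adm_def abs_mult pos_divide_less_eq mult.commute)
  then show "complex_of_real (bump 0 (\<mu> * (r - \<rho>))) = 0" by (simp add: bump_zero)
qed

lemma packet_continuous:
  assumes F: "packet A k F" and adm: "adm A \<mu> \<rho>"
  shows "continuous_on S (F \<mu> \<rho>)"
  using packet_has_vector_derivative[OF F adm]
  by (meson continuous_at_imp_continuous_on has_vector_derivative_continuous)

lemma packet_zero:
  assumes F: "packet A k F" and adm: "adm A \<mu> \<rho>" and r: "r < 1 / \<mu>\<^sup>2 \<or> r > (A + 1) / \<mu>\<^sup>2"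
  shows "F \<mu> \<rho> r = 0"
  using adm_support[OF adm, of r] F adm r unfolding packet_def by (metis not_less less_imp_not_less)

lemma adm_pos: "adm A \<mu> \<rho> \<Longrightarrow> 1 / \<mu>\<^sup>2 > 0" by (simp add: adm_def)

lemma packet_wave:
  assumes F: "packet A k F" and adm: "adm A \<mu> \<rho>"
  shows "continuous_on UNIV (wave (F \<mu> \<rho>) :: 'a::euclidean_space \<Rightarrow> complex)"
    and "\<And>x::'a. norm x > (A + 1) / \<mu>\<^sup>2 \<Longrightarrow> wave (F \<mu> \<rho>) x = 0"
    and "integrable lborel (wave (F \<mu> \<rho>) :: 'a \<Rightarrow> complex)"
proof -
  show c: "continuous_on UNIV (wave (F \<mu> \<rho>) :: 'a::euclidean_space \<Rightarrow> complex)"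
    by (rule wave_continuous[OF packet_continuous[OF F adm] adm_pos[OF adm]]) (rule packet_zero[OF F adm], simp)
  show z: "\<And>x::'a. norm x > (A + 1) / \<mu>\<^sup>2 \<Longrightarrow> wave (F \<mu> \<rho>) x = 0"
    unfolding wave_def using packet_zero[OF F adm] by simp
  show "integrable lborel (wave (F \<mu> \<rho>) :: 'a \<Rightarrow> complex)"
    by (rule integrable_continuous_compact_support[OF c z])
qed

lemma fourier_packet_op:
  fixes \<xi> :: "'a::euclidean_space"
  assumes F: "packet A k F" and adm: "adm A \<mu> \<rho>"
  shows "of_real ((norm \<xi>)\<^sup>2 - 1) * fourier (wave (F \<mu> \<rho>)) \<xi> = fourier (wave (packet_op (real DIM('a)) F \<mu> \<rho>)) \<xi>"
proof -
  note F1 = packet_rderiv[OF F] and F2 = packet_rderiv[OF packet_rderiv[OF F]]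
  show ?thesis
    unfolding packet_op_def
    by (rule fourier_wave_op[OF packet_has_vector_derivative[OF F adm] packet_has_vector_derivative[OF F1 adm]
          packet_continuous[OF F2 adm] adm_pos[OF adm], where \<beta> = "(A + 1) / \<mu>\<^sup>2"])
       (auto intro!: packet_zero[OF F adm] packet_zero[OF F1 adm] packet_zero[OF F2 adm])
qed

text \<open>
  The Fourier transform of a packet concentrates near the unit sphere, at distance of order \<open>\<mu>\<close>: each factor
  \<open>(norm \<xi>)\<^sup>2 - 1\<close> yields again a packet, of order one higher.
\<close>

lemma fourier_packet_op_power:
  fixes \<xi> :: "'a::euclidean_space"
  assumes F: "packet A k F" and adm: "adm A \<mu> \<rho>"
  shows "of_real ((norm \<xi>)\<^sup>2 - 1) ^ m * fourier (wave (F \<mu> \<rho>)) \<xi>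
    = fourier (wave ((packet_op (real DIM('a)) ^^ m) F \<mu> \<rho>)) \<xi>"
proof (induction m)
  case (Suc m)
  then show ?case
    using fourier_packet_op[OF packet_op_power[OF F, of m "real DIM('a)"] adm, of \<xi>] by (simp add: mult.assoc)
qed simp

section \<open>Energy of packets\<close>

lemma power_diff_le:
  fixes x y :: real
  assumes "0 \<le> x" "x \<le> y"
  shows "y ^ n - x ^ n \<le> real n * y ^ (n - 1) * (y - x)"
proof -
  have "(\<Sum>i<n. x ^ (n - Suc i) * y ^ i) \<le> (\<Sum>i<n. y ^ (n - 1))"
  proof (rule sum_mono)
    fix i assume i: "i \<in> {..<n}"
    have "x ^ (n - Suc i) * y ^ i \<le> y ^ (n - Suc i) * y ^ i"
      using assms by (intro mult_right_mono power_mono) auto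
    also have "\<dots> = y ^ (n - 1)" using i by (simp add: power_add[symmetric])
    finally show "x ^ (n - Suc i) * y ^ i \<le> y ^ (n - 1)" .
  qed
  then have "(y - x) * (\<Sum>i<n. x ^ (n - Suc i) * y ^ i) \<le> (y - x) * (real n * y ^ (n - 1))"
    using assms by (intro mult_left_mono) auto
  then show ?thesis by (simp add: power_diff_sumr2 ac_simps)
qed

lemma power_diff_ge:
  fixes x y :: real
  assumes "0 \<le> x" "x \<le> y" "n \<ge> 1"
  shows "x ^ (n - 1) * (y - x) \<le> y ^ n - x ^ n"
proof -
  have "x ^ (n - 1) * (y - x) \<le> y ^ (n - 1) * y - x ^ (n - 1) * x"
    using mult_right_mono[OF power_mono[OF assms(2,1), of "n - 1"], of y] assms by (simp add: algebra_simps)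
  then show ?thesis using assms(3) by (simp add: power_Suc2[symmetric] del: power_Suc)
qed

lemma emeasure_shell:
  assumes "0 \<le> x" "x \<le> y"
  shows "emeasure lborel (cball 0 y - ball 0 x :: 'a::euclidean_space set)
    = ennreal (unit_ball_vol (real DIM('a)) * (y ^ DIM('a) - x ^ DIM('a)))"
proof -
  have "emeasure lborel (cball 0 y - ball 0 x :: 'a set)
      = emeasure lborel (cball (0::'a) y) - emeasure lborel (ball (0::'a) x)"
    using assms by (intro emeasure_Diff) (auto simp: emeasure_ball)
  also have "\<dots> = ennreal (unit_ball_vol (real DIM('a)) * (y ^ DIM('a) - x ^ DIM('a)))"
    using assms by (simp add: emeasure_ball emeasure_cball ennreal_minus right_diff_distrib)
  finally show ?thesis .
qed

text \<open>
  Up to constants the volume of a shell of thickness \<open>1/\<mu>\<close> and radius \<open>1/\<mu>\<^sup>2\<close> in dimension \<open>n\<close>, namely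
  \<open>(1/\<mu>\<^sup>2) ^ (n - 1) * (1/\<mu>)\<close>.
\<close>

definition shell_size :: "nat \<Rightarrow> real \<Rightarrow> real" where
  "shell_size n \<mu> = \<mu> * (1 / \<mu>\<^sup>2) ^ n"

lemma shell_size_pos: "\<mu> > 0 \<Longrightarrow> shell_size n \<mu> > 0"
  by (simp add: shell_size_def)

lemma shell_size_eq:
  assumes "\<mu> > 0" "n \<ge> 1" shows "(1 / \<mu>\<^sup>2) ^ (n - 1) * (1 / \<mu>) = shell_size n \<mu>"
proof -
  obtain m where "n = Suc m" using assms(2) by (cases n) auto
  then show ?thesis using assms(1) by (simp add: shell_size_def power2_eq_square field_simps)
qed

lemma wave_packet_L2_upper:
  assumes F: "packet A k F" and A: "A \<ge> 0"
  shows "\<exists>C\<ge>0. \<forall>\<mu> \<rho>. adm A \<mu> \<rho> \<longrightarrow>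
    energy (wave (F \<mu> \<rho>) :: 'a::euclidean_space \<Rightarrow> complex)
      \<le> ennreal (C * (\<mu> ^ (2 * k) * shell_size DIM('a) \<mu>))"
proof -
  obtain C where C: "0 \<le> C" "\<And>\<mu> \<rho> r. adm A \<mu> \<rho> \<Longrightarrow> r > 1 / \<mu>\<^sup>2 \<Longrightarrow> cmod (F \<mu> \<rho> r) \<le> C * \<mu> ^ k"
    using F symb_of_size unfolding packet_def of_size_def by blast
  let ?n = "DIM('a)" and ?w = "unit_ball_vol (real DIM('a))"
  have w: "?w \<ge> 0" by simp
  have n: "?n \<ge> 1" by (simp add: Suc_leI)
  define K where "K = C\<^sup>2 * (?w * (real ?n * (A + 1) ^ (?n - 1) * 2))"
  have "energy (wave (F \<mu> \<rho>) :: 'a \<Rightarrow> complex)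
      \<le> ennreal (K * (\<mu> ^ (2 * k) * shell_size ?n \<mu>))" if adm: "adm A \<mu> \<rho>" for \<mu> \<rho>
  proof -
    have \<mu>: "0 < \<mu>" "\<mu> \<le> 1" using adm by (auto simp: adm_def)
    let ?x = "\<rho> - 1 / \<mu>" and ?y = "\<rho> + 1 / \<mu>"
    have x: "?x > 1 / \<mu>\<^sup>2" "?y \<le> (A + 1) / \<mu>\<^sup>2"
      using adm_support[OF adm, of ?x] adm_support[OF adm, of ?y] \<mu> by auto
    have x0: "0 \<le> ?x" using x(1) adm_pos[OF adm] by linarith
    have xy: "?x \<le> ?y" using \<mu> by simp
    have y0: "0 \<le> ?y" using x0 xy by linarith
    have "(cmod (wave (F \<mu> \<rho>) x))\<^sup>2 \<le> (C * \<mu> ^ k)\<^sup>2 * indicator (cball 0 ?y - ball 0 ?x) x" for x :: 'a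
    proof (cases "x \<in> cball 0 ?y - ball 0 ?x")
      case True
      then have "\<bar>norm x - \<rho>\<bar> \<le> 1 / \<mu>" by (auto simp: abs_le_iff algebra_simps)
      then have "cmod (F \<mu> \<rho> (norm x)) \<le> C * \<mu> ^ k" using C(2)[OF adm adm_support(1)[OF adm]] by simp
      then show ?thesis using True by (simp add: wave_def norm_mult power_mono)
    next
      case False
      then have "\<bar>norm x - \<rho>\<bar> > 1 / \<mu>" by auto
      then show ?thesis using False F adm by (simp add: wave_def packet_def)
    qed
    then have "ennreal ((cmod (wave (F \<mu> \<rho>) x))\<^sup>2) \<le> ennreal ((C * \<mu> ^ k)\<^sup>2) * indicator (cball 0 ?y - ball 0 ?x) x" for x :: 'a
      by (metis (no_types, lifting) ennreal_indicator ennreal_leI ennreal_mult indicator_pos_le zero_le_power2)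
    then have "energy (wave (F \<mu> \<rho>) :: 'a \<Rightarrow> complex)
        \<le> (\<integral>\<^sup>+x. ennreal ((C * \<mu> ^ k)\<^sup>2) * indicator (cball 0 ?y - ball 0 ?x) (x::'a) \<partial>lborel)"
      by (rule nn_integral_mono)
    also have "\<dots> = ennreal ((C * \<mu> ^ k)\<^sup>2) * ennreal (?w * (?y ^ ?n - ?x ^ ?n))"
      by (subst nn_integral_cmult_indicator) (auto simp: emeasure_shell[OF x0 xy])
    also have "\<dots> = ennreal ((C * \<mu> ^ k)\<^sup>2 * (?w * (?y ^ ?n - ?x ^ ?n)))"
      using x0 xy by (intro ennreal_mult[symmetric]) (auto intro!: mult_nonneg_nonneg power_mono)
    also have "\<dots> \<le> ennreal (K * (\<mu> ^ (2 * k) * shell_size ?n \<mu>))"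
    proof (rule ennreal_leI)
      have "?y ^ ?n - ?x ^ ?n \<le> real ?n * ?y ^ (?n - 1) * (2 * (1 / \<mu>))"
        using power_diff_le[OF x0 xy, of ?n] by (simp add: algebra_simps)
      also have "\<dots> \<le> real ?n * ((A + 1) / \<mu>\<^sup>2) ^ (?n - 1) * (2 * (1 / \<mu>))"
        using y0 x(2) \<mu> by (intro mult_left_mono mult_right_mono power_mono) auto
      also have "\<dots> = real ?n * (A + 1) ^ (?n - 1) * 2 * ((1 / \<mu>\<^sup>2) ^ (?n - 1) * (1 / \<mu>))"
        by (simp add: power_divide)
      also have "\<dots> = real ?n * (A + 1) ^ (?n - 1) * 2 * shell_size ?n \<mu>"
        unfolding shell_size_eq[OF \<mu>(1) n] ..
      finally have "(C * \<mu> ^ k)\<^sup>2 * (?w * (?y ^ ?n - ?x ^ ?n)) \<le> (C * \<mu> ^ k)\<^sup>2 * (?w * (real ?n * (A + 1) ^ (?n - 1) * 2 * shell_size ?n \<mu>))"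
        by (intro mult_left_mono) auto
      also have "\<dots> = K * (\<mu> ^ (2 * k) * shell_size ?n \<mu>)"
        by (simp add: K_def power_mult_distrib power_mult[symmetric] ac_simps)
      finally show "(C * \<mu> ^ k)\<^sup>2 * (?w * (?y ^ ?n - ?x ^ ?n)) \<le> K * (\<mu> ^ (2 * k) * shell_size ?n \<mu>)" .
    qed
    finally show ?thesis .
  qed
  moreover have "K \<ge> 0" using A by (auto simp: K_def intro!: mult_nonneg_nonneg)
  ultimately show ?thesis by blast
qed

lemma fourier_packet_L2_upper:
  assumes F: "packet A k F" and A: "A \<ge> 0"
  shows "\<exists>C\<ge>0. \<forall>\<mu> \<rho>. adm A \<mu> \<rho> \<longrightarrow>
    energy (\<lambda>\<xi>. of_real ((norm \<xi>)\<^sup>2 - 1) ^ m * fourier (wave (F \<mu> \<rho>)) (\<xi>::'a::euclidean_space))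
      \<le> ennreal (C * (\<mu> ^ (2 * (m + k)) * shell_size DIM('a) \<mu>))"
proof -
  let ?G = "(packet_op (real DIM('a)) ^^ m) F"
  have G: "packet A (m + k) ?G" by (rule packet_op_power[OF F])
  obtain C where C: "C \<ge> 0" "\<And>\<mu> \<rho>. adm A \<mu> \<rho> \<Longrightarrow>
    energy (wave (?G \<mu> \<rho>) :: 'a \<Rightarrow> complex) \<le> ennreal (C * (\<mu> ^ (2 * (m + k)) * shell_size DIM('a) \<mu>))"
    using wave_packet_L2_upper[OF G A, where 'a = 'a] by blast
  show ?thesis
  proof (intro exI[of _ "(2 * pi) ^ DIM('a) * C"] conjI allI impI)
    fix \<mu> \<rho> assume adm: "adm A \<mu> \<rho>"
    then have S: "shell_size DIM('a) \<mu> > 0" by (simp add: adm_def shell_size_pos)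
    have "energy (\<lambda>\<xi>. of_real ((norm \<xi>)\<^sup>2 - 1) ^ m * fourier (wave (F \<mu> \<rho>)) (\<xi>::'a))
      = ennreal ((2 * pi) ^ DIM('a)) * energy (wave (?G \<mu> \<rho>) :: 'a \<Rightarrow> complex)"
      unfolding fourier_packet_op_power[OF F adm]
      by (rule plancherel[OF packet_wave(1,2)[OF G adm]])
    also have "\<dots> \<le> ennreal ((2 * pi) ^ DIM('a)) * ennreal (C * (\<mu> ^ (2 * (m + k)) * shell_size DIM('a) \<mu>))"
      by (intro mult_left_mono C adm) simp
    also have "\<dots> = ennreal ((2 * pi) ^ DIM('a) * C * (\<mu> ^ (2 * (m + k)) * shell_size DIM('a) \<mu>))"
      using C(1) S adm by (subst ennreal_mult[symmetric]) (auto simp: adm_def mult.assoc)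
    finally show "energy (\<lambda>\<xi>. of_real ((norm \<xi>)\<^sup>2 - 1) ^ m * fourier (wave (F \<mu> \<rho>)) (\<xi>::'a))
      \<le> ennreal ((2 * pi) ^ DIM('a) * C * (\<mu> ^ (2 * (m + k)) * shell_size DIM('a) \<mu>))" .
  qed (use C(1) in simp)
qed

definition bump_packet :: "real \<Rightarrow> real \<Rightarrow> real \<Rightarrow> complex" where
  "bump_packet \<mu> \<rho> r = of_real (bump 0 (\<mu> * (r - \<rho>)))"

lemma packet_bump_packet: "packet A 0 bump_packet"
  unfolding bump_packet_def[abs_def] by (rule packet_bump)

text \<open>
  The bump is bounded below on the inner half of its support, and the corresponding half of the shell has volume
  comparable to \<open>shell_size\<close>.
\<close>

lemma bump_packet_L2_lower:
  "\<exists>c>0. \<forall>A \<mu> \<rho>. adm A \<mu> \<rho> \<longrightarrow>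
     ennreal (c * shell_size DIM('a) \<mu>)
       \<le> energy (wave (bump_packet \<mu> \<rho>) :: 'a::euclidean_space \<Rightarrow> complex)"
proof -
  let ?n = "DIM('a)" and ?w = "unit_ball_vol (real DIM('a))"
  have n: "?n \<ge> 1" by (simp add: Suc_leI)
  let ?m = "exp (- 4 / 3) :: real"
  have "ennreal (?m\<^sup>2 * ?w * shell_size ?n \<mu>) \<le> energy (wave (bump_packet \<mu> \<rho>) :: 'a \<Rightarrow> complex)"
    if adm: "adm A \<mu> \<rho>" for A \<mu> \<rho>
  proof -
    have \<mu>: "0 < \<mu>" "\<mu> \<le> 1" using adm by (auto simp: adm_def)
    let ?x = "\<rho> - 1 / (2 * \<mu>)" and ?y = "\<rho> + 1 / (2 * \<mu>)"
    have x: "?x > 1 / \<mu>\<^sup>2"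
      by (rule adm_support(1)[OF adm]) (use \<mu> in \<open>simp add: field_simps\<close>)
    have x0: "0 \<le> ?x" using x(1) adm_pos[OF adm] by linarith
    have xy: "?x \<le> ?y" using \<mu> by simp
    have "?m\<^sup>2 * indicator (cball 0 ?y - ball 0 ?x) x \<le> (cmod (wave (bump_packet \<mu> \<rho>) x))\<^sup>2" for x :: 'a
    proof (cases "x \<in> cball 0 ?y - ball 0 ?x")
      case True
      then have "\<bar>norm x - \<rho>\<bar> \<le> 1 / (2 * \<mu>)" by (auto simp: abs_le_iff algebra_simps)
      then have "\<mu> * \<bar>norm x - \<rho>\<bar> \<le> \<mu> * (1 / (2 * \<mu>))" using \<mu> by (intro mult_left_mono) auto
      then have "\<bar>\<mu> * (norm x - \<rho>)\<bar> \<le> 1 / 2" using \<mu> by (simp add: abs_mult)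
      then have "?m \<le> bump 0 (\<mu> * (norm x - \<rho>))" by (rule bump_lower)
      then have "?m\<^sup>2 \<le> (bump 0 (\<mu> * (norm x - \<rho>)))\<^sup>2" by (intro power_mono) auto
      then show ?thesis using True by (simp add: wave_def bump_packet_def norm_mult)
    qed simp
    then have le: "ennreal (?m\<^sup>2) * indicator (cball 0 ?y - ball 0 ?x) x \<le> ennreal ((cmod (wave (bump_packet \<mu> \<rho>) x))\<^sup>2)" for x :: 'a
      by (metis (no_types, lifting) ennreal_indicator ennreal_leI ennreal_mult indicator_pos_le zero_le_power2)
    have "shell_size ?n \<mu> = (1 / \<mu>\<^sup>2) ^ (?n - 1) * (1 / \<mu>)"
      by (rule shell_size_eq[OF \<mu>(1) n, symmetric])
    also have "\<dots> \<le> ?x ^ (?n - 1) * (1 / \<mu>)"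
      using x \<mu> by (intro mult_right_mono power_mono) auto
    also have "\<dots> = ?x ^ (?n - 1) * (?y - ?x)" using \<mu> by (simp add: field_simps)
    also have "\<dots> \<le> ?y ^ ?n - ?x ^ ?n" by (rule power_diff_ge[OF x0 xy n])
    finally have "ennreal (?m\<^sup>2 * ?w * shell_size ?n \<mu>) \<le> ennreal (?m\<^sup>2 * ?w * (?y ^ ?n - ?x ^ ?n))"
      by (intro ennreal_leI mult_left_mono) auto
    also have "\<dots> = ennreal (?m\<^sup>2) * ennreal (?w * (?y ^ ?n - ?x ^ ?n))"
      using x0 xy by (subst ennreal_mult[symmetric]) (auto intro!: mult_nonneg_nonneg power_mono simp: mult.assoc)
    also have "\<dots> = (\<integral>\<^sup>+x. ennreal (?m\<^sup>2) * indicator (cball 0 ?y - ball 0 ?x) (x::'a) \<partial>lborel)"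
      by (subst nn_integral_cmult_indicator) (auto simp: emeasure_shell[OF x0 xy])
    also have "\<dots> \<le> energy (wave (bump_packet \<mu> \<rho>) :: 'a \<Rightarrow> complex)"
      by (intro nn_integral_mono le)
    finally show ?thesis .
  qed
  moreover have "?m\<^sup>2 * ?w > 0" by simp
  ultimately show ?thesis by blast
qed

text \<open>
  Each coordinate is bounded by the norm, so \<open>\<Prod>b\<in>Basis. 1 + (x \<bullet> b)\<^sup>2 \<le> (1 + (norm x)\<^sup>2) ^ DIM('a)\<close>, which reduces the claim to one
  dimension.
\<close>

lemma integrable_inverse_poly:
  "integrable lborel (\<lambda>x::'a::euclidean_space. 1 / (1 + (norm x)\<^sup>2) ^ DIM('a))"
proof (rule integrableI_bounded)
  have le: "1 / (1 + (norm x)\<^sup>2) ^ DIM('a) \<le> (\<Prod>b\<in>Basis. inverse (1 + (x \<bullet> b)\<^sup>2))" for x :: 'a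
  proof -
    have "(\<Prod>b\<in>Basis. 1 + (x \<bullet> b)\<^sup>2) \<le> (\<Prod>b\<in>(Basis::'a set). 1 + (norm x)\<^sup>2)"
      by (intro prod_mono) (auto simp: Basis_le_norm abs_le_square_iff[symmetric])
    then have "inverse ((1 + (norm x)\<^sup>2) ^ DIM('a)) \<le> inverse (\<Prod>b\<in>Basis. 1 + (x \<bullet> b)\<^sup>2)"
      by (intro le_imp_inverse_le prod_pos) (auto intro: add_pos_nonneg)
    then show ?thesis by (simp add: divide_inverse prod_inversef[symmetric] o_def)
  qed
  have fin: "(\<integral>\<^sup>+t. ennreal (inverse (1 + t\<^sup>2)) \<partial>lborel) < \<infinity>"
    using integrable_inverse_1_plus_square
    by (simp add: set_integrable_def integrable_iff_bounded einterval_eq_UNIV)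
  have "(\<integral>\<^sup>+ x. ennreal (norm (1 / (1 + (norm (x::'a))\<^sup>2) ^ DIM('a))) \<partial>lborel)
      \<le> (\<integral>\<^sup>+ x. (\<Prod>b\<in>Basis. ennreal (inverse (1 + ((x::'a) \<bullet> b)\<^sup>2))) \<partial>lborel)"
    by (intro nn_integral_mono) (simp add: prod_ennreal, rule ennreal_leI, rule le)
  also have "\<dots> = (\<Prod>b\<in>(Basis::'a set). (\<integral>\<^sup>+t. ennreal (inverse (1 + t\<^sup>2)) \<partial>lborel))"
    by (rule nn_integral_lborel_prod) auto
  also have "\<dots> < \<infinity>"
    using fin by (simp add: power_less_top_ennreal)
  finally show "(\<integral>\<^sup>+ x. ennreal (norm (1 / (1 + (norm (x::'a))\<^sup>2) ^ DIM('a))) \<partial>lborel) < \<infinity>" .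
qed measurable

lemma add_power_le:
  fixes x y :: real assumes "0 \<le> x" "0 \<le> y"
  shows "(x + y) ^ m \<le> 2 ^ m * (x ^ m + y ^ m)"
proof -
  have "(x + y) ^ m \<le> (2 * max x y) ^ m" using assms by (intro power_mono) auto
  also have "\<dots> = 2 ^ m * (max x y) ^ m" by (simp add: power_mult_distrib)
  also have "(max x y) ^ m \<le> x ^ m + y ^ m" using assms by (simp add: max_def)
  finally show ?thesis by simp
qed

text \<open>
  The decay in \<open>\<xi>\<close> comes from writing \<open>((norm \<xi>)\<^sup>2 - 1) ^ DIM('a)\<close> times the transform as the transform of another
  packet, hence as a bounded function.
\<close>

lemma integrable_fourier_packet:
  assumes F: "packet A k F" and adm: "adm A \<mu> \<rho>"
  shows "integrable lborel (fourier (wave (F \<mu> \<rho>)) :: 'a::euclidean_space \<Rightarrow> complex)"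
proof -
  let ?n = "DIM('a)" and ?f = "fourier (wave (F \<mu> \<rho>)) :: 'a \<Rightarrow> complex"
  let ?g = "fourier (wave ((packet_op (real DIM('a)) ^^ DIM('a)) F \<mu> \<rho>)) :: 'a \<Rightarrow> complex"
  obtain B where B: "\<And>\<xi>. cmod (?f \<xi>) \<le> B"
    using cmod_fourier_le[OF packet_wave(3)[OF F adm]] by blast
  obtain B' where B': "\<And>\<xi>. cmod (?g \<xi>) \<le> B'"
    using cmod_fourier_le[OF packet_wave(3)[OF packet_op_power[OF F] adm]] by blast
  have le: "cmod (?f \<xi>) \<le> 2 ^ ?n * (2 ^ ?n * B + B') * (1 / (1 + (norm \<xi>)\<^sup>2) ^ ?n)" for \<xi>
  proof -
    let ?w = "(norm \<xi>)\<^sup>2 - 1"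
    have "(1 + (norm \<xi>)\<^sup>2) ^ ?n \<le> (2 + \<bar>?w\<bar>) ^ ?n" by (intro power_mono) auto
    also have "\<dots> \<le> 2 ^ ?n * (2 ^ ?n + \<bar>?w\<bar> ^ ?n)" by (rule add_power_le) auto
    finally have "(1 + (norm \<xi>)\<^sup>2) ^ ?n * cmod (?f \<xi>) \<le> 2 ^ ?n * (2 ^ ?n + \<bar>?w\<bar> ^ ?n) * cmod (?f \<xi>)"
      by (rule mult_right_mono) simp
    also have "\<dots> = 2 ^ ?n * (2 ^ ?n * cmod (?f \<xi>) + cmod (of_real ?w ^ ?n * ?f \<xi>))"
      by (simp add: norm_mult norm_power algebra_simps del: of_real_diff of_real_power)
    also have "\<dots> \<le> 2 ^ ?n * (2 ^ ?n * B + B')"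
      unfolding fourier_packet_op_power[OF F adm] by (intro mult_left_mono add_mono B B') auto
    finally show ?thesis by (simp add: field_simps add_pos_nonneg)
  qed
  have [measurable]: "wave (F \<mu> \<rho>) \<in> borel_measurable (borel :: 'a measure)"
    using packet_wave(1)[OF F adm] by (rule borel_measurable_continuous_onI)
  show ?thesis
    by (rule Bochner_Integration.integrable_bound[OF integrable_mult_right[OF integrable_inverse_poly, of "2 ^ ?n * (2 ^ ?n * B + B')"]])
       (measurable, auto intro!: always_eventually order_trans[OF le abs_ge_self] simp only: real_norm_def)
qed

section \<open>The symbol near the unit sphere\<close>

lemma powr_taylor_near_1:
  fixes \<alpha> :: real
  shows "\<exists>K\<ge>0. \<forall>q. \<bar>q - 1\<bar> \<le> 1 / 2 \<longrightarrow> \<bar>q powr \<alpha> - 1 - \<alpha> * (q - 1)\<bar> \<le> K * (q - 1)\<^sup>2"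
proof -
  have "compact ((\<lambda>q::real. q powr (\<alpha> - 2)) ` {1/2..3/2})"
    by (intro compact_continuous_image continuous_intros) auto
  then have "bounded ((\<lambda>q::real. q powr (\<alpha> - 2)) ` {1/2..3/2})"
    by (rule compact_imp_bounded)
  then obtain B where B: "\<And>q. q \<in> {1/2..3/2} \<Longrightarrow> \<bar>q powr (\<alpha> - 2)\<bar> \<le> B"
    unfolding bounded_iff real_norm_def by blast
  define K where "K = \<bar>\<alpha> * (\<alpha> - 1)\<bar> * B / 2"
  have K0: "K \<ge> 0" using B[of 1] by (simp add: K_def)
  define diff where "diff m q = (if m = 0 then q powr \<alpha> else if m = 1 then \<alpha> * q powr (\<alpha> - 1) else \<alpha> * ((\<alpha> - 1) * q powr (\<alpha> - 2)))" for m :: nat and q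
  have "\<bar>q powr \<alpha> - 1 - \<alpha> * (q - 1)\<bar> \<le> K * (q - 1)\<^sup>2" if q: "\<bar>q - 1\<bar> \<le> 1 / 2" for q
  proof (cases "q = 1")
    case False
    have q': "1/2 \<le> q" "q \<le> 3/2" using q abs_ge_minus_self[of "q - 1"] abs_ge_self[of "q - 1"] by linarith+
    have "\<exists>t. (if q < 1 then q < t \<and> t < 1 else 1 < t \<and> t < q) \<and>
        q powr \<alpha> = (\<Sum>m<2. diff m 1 / fact m * (q - 1) ^ m) + diff 2 t / fact 2 * (q - 1) ^ 2"
    proof (rule Taylor[where a = "1/2" and b = "3/2"])
      show "diff 0 = (\<lambda>q. q powr \<alpha>)" by (simp add: diff_def fun_eq_iff)
      show "\<forall>m t. m < 2 \<and> 1/2 \<le> t \<and> t \<le> 3/2 \<longrightarrow> (diff m has_real_derivative diff (Suc m) t) (at t)"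
      proof (intro allI impI)
        fix m :: nat and t :: real assume *: "m < 2 \<and> 1/2 \<le> t \<and> t \<le> 3/2"
        then have "m = 0 \<or> m = 1" by auto
        then show "(diff m has_real_derivative diff (Suc m) t) (at t)"
        proof
          assume "m = 0"
          moreover have "((\<lambda>q. q powr \<alpha>) has_real_derivative \<alpha> * t powr (\<alpha> - 1)) (at t)"
            using * by (intro has_real_derivative_powr) auto
          ultimately show ?thesis by (simp add: diff_def[abs_def])
        next
          assume "m = 1"
          moreover have "((\<lambda>q. \<alpha> * q powr (\<alpha> - 1)) has_real_derivative \<alpha> * ((\<alpha> - 1) * t powr (\<alpha> - 1 - 1))) (at t)"
            using * by (intro DERIV_cmult has_real_derivative_powr) auto
          ultimately show ?thesis by (simp add: diff_def[abs_def])
        qed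
      qed
    qed (use q' False in auto)
    then obtain t where t: "if q < 1 then q < t \<and> t < 1 else 1 < t \<and> t < q"
      and eq: "q powr \<alpha> = (\<Sum>m<2. diff m 1 / fact m * (q - 1) ^ m) + diff 2 t / fact 2 * (q - 1) ^ 2"
      by blast
    have "t \<in> {1/2..3/2}" using t q' by (auto split: if_splits)
    from B[OF this] have "\<bar>\<alpha> * (\<alpha> - 1)\<bar> * \<bar>t powr (\<alpha> - 2)\<bar> / 2 * (q - 1)\<^sup>2 \<le> K * (q - 1)\<^sup>2"
      unfolding K_def by (intro mult_right_mono divide_right_mono mult_left_mono) auto
    moreover have eq': "q powr \<alpha> - 1 - \<alpha> * (q - 1) = \<alpha> * (\<alpha> - 1) * t powr (\<alpha> - 2) / 2 * (q - 1)\<^sup>2"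
      unfolding eq by (simp add: diff_def numeral_2_eq_2)
    have "\<bar>q powr \<alpha> - 1 - \<alpha> * (q - 1)\<bar> = \<bar>\<alpha> * (\<alpha> - 1)\<bar> * \<bar>t powr (\<alpha> - 2)\<bar> / 2 * (q - 1)\<^sup>2"
      unfolding eq' by (simp add: abs_mult)
    ultimately show ?thesis by linarith
  qed simp
  then show ?thesis using K0 by blast
qed

text \<open>
  Viewed as a function of \<open>t\<^sup>2\<close>, \<open>t powr a\<close> agrees with its linearisation at 1 up to a quadratic error. Far from 1 the
  quadratic term is too small when \<open>a > 4\<close>, and a sufficiently high power takes over.
\<close>

lemma powr_taylor_global:
  fixes a :: real assumes "a > 0"
  shows "\<exists>C\<ge>0. \<exists>m\<ge>2. \<forall>t\<ge>0. \<bar>t powr a - 1 - a / 2 * (t\<^sup>2 - 1)\<bar> \<le> C * (\<bar>t\<^sup>2 - 1\<bar> ^ 2 + \<bar>t\<^sup>2 - 1\<bar> ^ m)"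
proof -
  define \<alpha> where "\<alpha> = a / 2"
  have \<alpha>: "\<alpha> > 0" using assms by (simp add: \<alpha>_def)
  obtain K where K: "K \<ge> 0" "\<And>q. \<bar>q - 1\<bar> \<le> 1 / 2 \<Longrightarrow> \<bar>q powr \<alpha> - 1 - \<alpha> * (q - 1)\<bar> \<le> K * (q - 1)\<^sup>2"
    using powr_taylor_near_1[of \<alpha>] by blast
  define m where "m = max 2 (nat \<lceil>\<alpha>\<rceil>)"
  have m: "m \<ge> 2" "real m \<ge> \<alpha>" unfolding m_def by linarith+
  define C where "C = max K ((2 + \<alpha>) * 3 ^ m)"
  have C: "C \<ge> 0" "C \<ge> K" "C \<ge> (2 + \<alpha>) * 3 ^ m" using K(1) by (auto simp: C_def)
  have main: "\<bar>q powr \<alpha> - 1 - \<alpha> * (q - 1)\<bar> \<le> C * (\<bar>q - 1\<bar> ^ 2 + \<bar>q - 1\<bar> ^ m)" if q: "q \<ge> 0" for q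
  proof (cases "\<bar>q - 1\<bar> \<le> 1 / 2")
    case True
    have "K * (q - 1)\<^sup>2 \<le> C * (\<bar>q - 1\<bar> ^ 2 + \<bar>q - 1\<bar> ^ m)"
      using C K by (intro mult_mono) auto
    then show ?thesis using K(2)[OF True] by linarith
  next
    case False
    define w where "w = \<bar>q - 1\<bar>"
    have w: "w > 1 / 2" using False by (simp add: w_def)
    have pw: "3 * w \<le> (3 * w) ^ m" using w m by (intro self_le_power) auto
    have "q \<le> 3 * w" using False by (auto simp: w_def abs_if split: if_splits)
    then have "q powr \<alpha> \<le> (3 * w) powr \<alpha>" using q \<alpha> by (intro powr_mono2) auto
    also have "\<dots> \<le> (3 * w) powr (real m)" using w m by (intro powr_mono) auto
    also have "\<dots> = (3 * w) ^ m" using w by (simp add: powr_realpow)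
    finally have 1: "q powr \<alpha> \<le> (3 * w) ^ m" .
    have 2: "1 \<le> (3 * w) ^ m" using pw w by linarith
    have 3: "\<alpha> * w \<le> \<alpha> * (3 * w) ^ m" using pw w \<alpha> by (intro mult_left_mono) auto
    have "\<bar>\<alpha> * (q - 1)\<bar> = \<alpha> * w" using \<alpha> by (simp add: w_def abs_mult)
    then have "\<bar>q powr \<alpha> - 1 - \<alpha> * (q - 1)\<bar> \<le> q powr \<alpha> + 1 + \<alpha> * w"
      using powr_ge_zero[of q \<alpha>] by linarith
    also have "\<dots> \<le> (2 + \<alpha>) * (3 * w) ^ m" using 1 2 3 by (simp add: algebra_simps)
    also have "\<dots> = (2 + \<alpha>) * 3 ^ m * w ^ m" by (simp add: power_mult_distrib)
    also have "\<dots> \<le> C * (w ^ 2 + w ^ m)" using C w \<alpha> by (intro mult_mono) auto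
    finally show ?thesis by (simp add: w_def)
  qed
  have "\<bar>t powr a - 1 - a / 2 * (t\<^sup>2 - 1)\<bar> \<le> C * (\<bar>t\<^sup>2 - 1\<bar> ^ 2 + \<bar>t\<^sup>2 - 1\<bar> ^ m)" if t: "t \<ge> 0" for t
  proof -
    have "t powr a = t\<^sup>2 powr \<alpha>"
    proof (cases "t = 0")
      case False
      then have "t\<^sup>2 powr \<alpha> = (t powr 2) powr \<alpha>" using t by simp
      then show ?thesis by (simp add: powr_powr \<alpha>_def)
    qed simp
    then show ?thesis using main[of "t\<^sup>2"] by (simp add: \<alpha>_def)
  qed
  then show ?thesis using C(1) m(1) by blast
qed

text \<open>
  The part of \<open>norm \<xi> powr a\<close> that the affine function of \<open>(norm \<xi>)\<^sup>2\<close> tangent to it on the unit sphere does not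
  capture.
\<close>

definition symbol_error :: "real \<Rightarrow> 'a::euclidean_space \<Rightarrow> real" where
  "symbol_error a \<xi> = norm \<xi> powr a - 1 - a / 2 * ((norm \<xi>)\<^sup>2 - 1)"

text \<open>
  The failure of the transported packet to solve the evolution equation, on the Fourier side. The first term collects
  the second derivatives and curvature terms of the Laplacian, the second the nonlinearity of the symbol.
\<close>

definition residual :: "real \<Rightarrow> real \<Rightarrow> real \<Rightarrow> 'a::euclidean_space \<Rightarrow> complex" where
  "residual a \<mu> \<rho> \<xi> =
     - \<i> * (of_real (a / 2) * fourier (wave (packet_rest (real DIM('a)) bump_packet \<mu> \<rho>)) \<xi>
            + of_real (symbol_error a \<xi>) * fourier (wave (bump_packet \<mu> \<rho>)) \<xi>)"

lemma nn_integral_lincomb2: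
  fixes f g :: "'a \<Rightarrow> ennreal"
  assumes "f \<in> borel_measurable M" "g \<in> borel_measurable M"
  shows "(\<integral>\<^sup>+x. c * f x + d * g x \<partial>M) = c * (\<integral>\<^sup>+x. f x \<partial>M) + d * (\<integral>\<^sup>+x. g x \<partial>M)"
  using assms by (simp add: nn_integral_add nn_integral_cmult)

lemma nn_integral_lincomb3:
  fixes f g h :: "'a \<Rightarrow> ennreal"
  assumes "f \<in> borel_measurable M" "g \<in> borel_measurable M" "h \<in> borel_measurable M"
  shows "(\<integral>\<^sup>+x. c * f x + d * g x + e * h x \<partial>M)
    = c * (\<integral>\<^sup>+x. f x \<partial>M) + d * (\<integral>\<^sup>+x. g x \<partial>M) + e * (\<integral>\<^sup>+x. h x \<partial>M)"
  using assms by (simp add: nn_integral_add nn_integral_cmult)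

lemma square_sum3_le:
  fixes x y z u v :: real
  assumes "0 \<le> x" "x \<le> u * y + v * (z + t)"
  shows "x\<^sup>2 \<le> 3 * u\<^sup>2 * y\<^sup>2 + 3 * v\<^sup>2 * z\<^sup>2 + 3 * v\<^sup>2 * t\<^sup>2"
proof -
  have "x\<^sup>2 \<le> (u * y + v * (z + t))\<^sup>2" using assms by (intro power_mono) auto
  also have "\<dots> \<le> 3 * (u * y)\<^sup>2 + 3 * (v * z)\<^sup>2 + 3 * (v * t)\<^sup>2"
  proof -
    have "(p + q + r)\<^sup>2 + ((p - q)\<^sup>2 + (p - r)\<^sup>2 + (q - r)\<^sup>2) = 3 * p\<^sup>2 + 3 * q\<^sup>2 + 3 * r\<^sup>2" for p q r :: real
      by (simp add: power2_eq_square algebra_simps)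
    then have "(p + q + r)\<^sup>2 \<le> 3 * p\<^sup>2 + 3 * q\<^sup>2 + 3 * r\<^sup>2" for p q r :: real
      using zero_le_power2[of "p - q"] zero_le_power2[of "p - r"] zero_le_power2[of "q - r"]
      by (metis add_increasing2 add_nonneg_nonneg order_refl)
    moreover have "u * y + v * (z + t) = u * y + v * z + v * t" by (simp add: distrib_left)
    ultimately show ?thesis by (simp only:)
  qed
  finally show ?thesis by (simp add: power_mult_distrib)
qed

lemma packet_wave_measurable:
  assumes "packet A k F" "adm A \<mu> \<rho>"
  shows "wave (F \<mu> \<rho>) \<in> borel_measurable (borel :: 'a::euclidean_space measure)"
  using packet_wave(1)[OF assms] by (rule borel_measurable_continuous_onI)

text \<open>
  Each of the three contributions is of order at least two in \<open>\<mu>\<close>: \<open>packet_rest\<close> by construction, and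
  \<open>symbol_error\<close> because it is at least quadratic in \<open>(norm \<xi>)\<^sup>2 - 1\<close>.
\<close>

lemma residual_L2:
  assumes a: "a > 0" and A: "A \<ge> 0"
  shows "\<exists>C\<ge>0. \<forall>\<mu> \<rho>. adm A \<mu> \<rho> \<longrightarrow>
    energy (residual a \<mu> \<rho> :: 'a::euclidean_space \<Rightarrow> complex)
      \<le> ennreal (C * (\<mu> ^ 4 * shell_size DIM('a) \<mu>))"
proof -
  let ?n = "real DIM('a)"
  note P = packet_bump_packet[of A] and Q = packet_rest[OF packet_bump_packet[of A], of ?n]
  obtain C m where C: "C \<ge> 0" and m: "m \<ge> 2"
    and E: "\<And>t::real. t \<ge> 0 \<Longrightarrow> \<bar>t powr a - 1 - a / 2 * (t\<^sup>2 - 1)\<bar> \<le> C * (\<bar>t\<^sup>2 - 1\<bar> ^ 2 + \<bar>t\<^sup>2 - 1\<bar> ^ m)"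
    using powr_taylor_global[OF a] by metis
  let ?N = "\<lambda>k G \<mu> \<rho>. \<integral>\<^sup>+\<xi>. ennreal ((cmod (of_real ((norm \<xi>)\<^sup>2 - 1) ^ k * fourier (wave (G \<mu> \<rho>)) (\<xi>::'a)))\<^sup>2) \<partial>lborel"
  obtain C0 where C0: "C0 \<ge> 0" "\<And>\<mu> \<rho>. adm A \<mu> \<rho> \<Longrightarrow> ?N 0 (packet_rest ?n bump_packet) \<mu> \<rho> \<le> ennreal (C0 * (\<mu> ^ (2 * (0 + Suc (Suc 0))) * shell_size DIM('a) \<mu>))"
    using fourier_packet_L2_upper[OF Q A, of 0, where 'a = 'a] by blast
  obtain C2 where C2: "C2 \<ge> 0" "\<And>\<mu> \<rho>. adm A \<mu> \<rho> \<Longrightarrow> ?N 2 bump_packet \<mu> \<rho> \<le> ennreal (C2 * (\<mu> ^ (2 * (2 + 0)) * shell_size DIM('a) \<mu>))"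
    using fourier_packet_L2_upper[OF P A, of 2, where 'a = 'a] by blast
  obtain Cm where Cm: "Cm \<ge> 0" "\<And>\<mu> \<rho>. adm A \<mu> \<rho> \<Longrightarrow> ?N m bump_packet \<mu> \<rho> \<le> ennreal (Cm * (\<mu> ^ (2 * (m + 0)) * shell_size DIM('a) \<mu>))"
    using fourier_packet_L2_upper[OF P A, of m, where 'a = 'a] by blast
  define K where "K = 3 * (a / 2)\<^sup>2 * C0 + 3 * C\<^sup>2 * C2 + 3 * C\<^sup>2 * Cm"
  have "energy (residual a \<mu> \<rho> :: 'a \<Rightarrow> complex) \<le> ennreal (K * (\<mu> ^ 4 * shell_size DIM('a) \<mu>))"
    if adm: "adm A \<mu> \<rho>" for \<mu> \<rho>
  proof -
    have \<mu>: "0 < \<mu>" "\<mu> \<le> 1" using adm by (auto simp: adm_def)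
    let ?S = "\<mu> ^ 4 * shell_size DIM('a) \<mu>"
    have S: "?S > 0" using \<mu> shell_size_pos by simp
    note [measurable] = packet_wave_measurable[OF P adm] packet_wave_measurable[OF Q adm]
    let ?R = "\<lambda>\<xi>::'a. cmod (of_real ((norm \<xi>)\<^sup>2 - 1) ^ 0 * fourier (wave (packet_rest ?n bump_packet \<mu> \<rho>)) \<xi>)"
    let ?F = "\<lambda>k. \<lambda>\<xi>::'a. cmod (of_real ((norm \<xi>)\<^sup>2 - 1) ^ k * fourier (wave (bump_packet \<mu> \<rho>)) \<xi>)"
    have le: "(cmod (residual a \<mu> \<rho> \<xi>))\<^sup>2 \<le> 3 * (a / 2)\<^sup>2 * (?R \<xi>)\<^sup>2 + 3 * C\<^sup>2 * (?F 2 \<xi>)\<^sup>2 + 3 * C\<^sup>2 * (?F m \<xi>)\<^sup>2" for \<xi> :: 'a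
    proof (rule square_sum3_le)
      have "cmod (residual a \<mu> \<rho> \<xi>) = cmod (of_real (a / 2) * fourier (wave (packet_rest ?n bump_packet \<mu> \<rho>)) \<xi>
          + of_real (symbol_error a \<xi>) * fourier (wave (bump_packet \<mu> \<rho>)) \<xi>)"
        unfolding residual_def by (subst norm_mult) (simp only: norm_minus_cancel norm_ii mult_1_left)
      also have "\<dots> \<le> cmod (of_real (a / 2) * fourier (wave (packet_rest ?n bump_packet \<mu> \<rho>)) \<xi>)
          + cmod (of_real (symbol_error a \<xi>) * fourier (wave (bump_packet \<mu> \<rho>)) \<xi>)"
        by (rule norm_triangle_ineq)
      also have "cmod (of_real (symbol_error a \<xi>) * fourier (wave (bump_packet \<mu> \<rho>)) \<xi>)
          \<le> C * (\<bar>(norm \<xi>)\<^sup>2 - 1\<bar> ^ 2 + \<bar>(norm \<xi>)\<^sup>2 - 1\<bar> ^ m) * cmod (fourier (wave (bump_packet \<mu> \<rho>)) \<xi>)"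
        unfolding norm_mult norm_of_real symbol_error_def by (intro mult_right_mono E) auto
      also have "\<dots> = C * (?F 2 \<xi> + ?F m \<xi>)"
        by (simp only: norm_mult norm_power norm_of_real) (simp add: algebra_simps)
      also have "cmod (of_real (a / 2) * fourier (wave (packet_rest ?n bump_packet \<mu> \<rho>)) \<xi>) = a / 2 * ?R \<xi>"
        using a by (simp add: norm_mult)
      finally show "cmod (residual a \<mu> \<rho> \<xi>) \<le> a / 2 * ?R \<xi> + C * (?F 2 \<xi> + ?F m \<xi>)" by simp
    qed simp
    have "energy (residual a \<mu> \<rho> :: 'a \<Rightarrow> complex)
      \<le> (\<integral>\<^sup>+\<xi>. ennreal (3 * (a / 2)\<^sup>2) * ennreal ((?R \<xi>)\<^sup>2) + ennreal (3 * C\<^sup>2) * ennreal ((?F 2 \<xi>)\<^sup>2) + ennreal (3 * C\<^sup>2) * ennreal ((?F m \<xi>)\<^sup>2) \<partial>lborel)"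
      by (intro nn_integral_mono) (simp only: ennreal_mult[symmetric] ennreal_plus[symmetric] zero_le_power2 zero_le_mult_iff zero_le_numeral add_nonneg_nonneg simp_thms, rule ennreal_leI, rule le)
    also have "\<dots> = ennreal (3 * (a / 2)\<^sup>2) * (\<integral>\<^sup>+\<xi>. ennreal ((?R \<xi>)\<^sup>2) \<partial>lborel) + ennreal (3 * C\<^sup>2) * (\<integral>\<^sup>+\<xi>. ennreal ((?F 2 \<xi>)\<^sup>2) \<partial>lborel)
        + ennreal (3 * C\<^sup>2) * (\<integral>\<^sup>+\<xi>. ennreal ((?F m \<xi>)\<^sup>2) \<partial>lborel)"
      by (rule nn_integral_lincomb3; measurable)
    also have "\<dots> \<le> ennreal (3 * (a / 2)\<^sup>2) * ennreal (C0 * ?S) + ennreal (3 * C\<^sup>2) * ennreal (C2 * ?S) + ennreal (3 * C\<^sup>2) * ennreal (Cm * ?S)"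
    proof (intro add_mono mult_left_mono)
      show "(\<integral>\<^sup>+\<xi>. ennreal ((?R \<xi>)\<^sup>2) \<partial>lborel) \<le> ennreal (C0 * ?S)" using C0(2)[OF adm] by (simp add: numeral_eq_Suc)
      show "(\<integral>\<^sup>+\<xi>. ennreal ((?F 2 \<xi>)\<^sup>2) \<partial>lborel) \<le> ennreal (C2 * ?S)" using C2(2)[OF adm] by simp
      have "\<mu> ^ (2 * (m + 0)) \<le> \<mu> ^ 4" using \<mu> m by (intro power_decreasing) auto
      then have "Cm * (\<mu> ^ (2 * (m + 0)) * shell_size DIM('a) \<mu>) \<le> Cm * ?S"
        using Cm(1) \<mu> shell_size_pos[of \<mu> "DIM('a)"] by (intro mult_left_mono mult_right_mono) auto
      then show "(\<integral>\<^sup>+\<xi>. ennreal ((?F m \<xi>)\<^sup>2) \<partial>lborel) \<le> ennreal (Cm * ?S)"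
        using Cm(2)[OF adm] ennreal_leI order_trans by blast
    qed auto
    also have "\<dots> = ennreal (K * ?S)"
    proof -
      have X: "ennreal p * ennreal (c * ?S) = ennreal (p * c * ?S)" if "p \<ge> 0" "c \<ge> 0" for p c
        using that S by (subst ennreal_mult[symmetric]) (auto simp: mult.assoc)
      have "ennreal (3 * (a / 2)\<^sup>2) * ennreal (C0 * ?S) + ennreal (3 * C\<^sup>2) * ennreal (C2 * ?S) + ennreal (3 * C\<^sup>2) * ennreal (Cm * ?S)
        = ennreal (3 * (a / 2)\<^sup>2 * C0 * ?S) + ennreal (3 * C\<^sup>2 * C2 * ?S) + ennreal (3 * C\<^sup>2 * Cm * ?S)"
        using C0(1) C2(1) Cm(1) by (simp only: X zero_le_power2 zero_le_numeral mult_nonneg_nonneg)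
      also have "\<dots> = ennreal (3 * (a / 2)\<^sup>2 * C0 * ?S + 3 * C\<^sup>2 * C2 * ?S + 3 * C\<^sup>2 * Cm * ?S)"
      proof -
        have "ennreal x + ennreal y + ennreal z = ennreal (x + y + z)" if "x \<ge> 0" "y \<ge> 0" "z \<ge> 0" for x y z
          using that by simp
        then show ?thesis
          using C0(1) C2(1) Cm(1) S by (simp only: mult_nonneg_nonneg zero_le_power2 zero_le_numeral less_imp_le)
      qed
      finally show ?thesis by (simp only: K_def distrib_right)
    qed
    finally show ?thesis .
  qed
  moreover have "K \<ge> 0" unfolding K_def using C0(1) C2(1) Cm(1) by auto
  ultimately show ?thesis by blast
qed

text \<open>
  At frequency 1 every Sobolev norm is controlled by the size of the shell, since \<open>(1 + (norm \<xi>)\<^sup>2) powr s\<close> is dominated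
  by a constant plus a power of \<open>\<bar>(norm \<xi>)\<^sup>2 - 1\<bar>\<close>.
\<close>

lemma sobolev_packet_upper:
  assumes s: "s \<ge> 0" and A: "A \<ge> 0"
  shows "\<exists>C\<ge>0. \<forall>\<mu> \<rho>. adm A \<mu> \<rho> \<longrightarrow>
    (\<integral>\<^sup>+\<xi>. ennreal ((1 + (norm \<xi>)\<^sup>2) powr s * (cmod (fourier (wave (bump_packet \<mu> \<rho>)) (\<xi>::'a::euclidean_space)))\<^sup>2) \<partial>lborel)
      \<le> ennreal (C * shell_size DIM('a) \<mu>)"
proof -
  define M where "M = nat \<lceil>s\<rceil>"
  have M: "s \<le> real (2 * M)" using s unfolding M_def by linarith
  note P = packet_bump_packet[of A]
  let ?N = "\<lambda>k \<mu> \<rho>. \<integral>\<^sup>+\<xi>. ennreal ((cmod (of_real ((norm \<xi>)\<^sup>2 - 1) ^ k * fourier (wave (bump_packet \<mu> \<rho>)) (\<xi>::'a)))\<^sup>2) \<partial>lborel"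
  obtain C0 where C0: "C0 \<ge> 0" "\<And>\<mu> \<rho>. adm A \<mu> \<rho> \<Longrightarrow> ?N 0 \<mu> \<rho> \<le> ennreal (C0 * (\<mu> ^ (2 * (0 + 0)) * shell_size DIM('a) \<mu>))"
    using fourier_packet_L2_upper[OF P A, of 0, where 'a = 'a] by blast
  obtain CM where CM: "CM \<ge> 0" "\<And>\<mu> \<rho>. adm A \<mu> \<rho> \<Longrightarrow> ?N M \<mu> \<rho> \<le> ennreal (CM * (\<mu> ^ (2 * (M + 0)) * shell_size DIM('a) \<mu>))"
    using fourier_packet_L2_upper[OF P A, of M, where 'a = 'a] by blast
  let ?c = "(2::real) ^ (2 * M)"
  define K where "K = ?c * ?c * C0 + ?c * CM"
  have "(\<integral>\<^sup>+\<xi>. ennreal ((1 + (norm \<xi>)\<^sup>2) powr s * (cmod (fourier (wave (bump_packet \<mu> \<rho>)) (\<xi>::'a)))\<^sup>2) \<partial>lborel)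
      \<le> ennreal (K * shell_size DIM('a) \<mu>)" if adm: "adm A \<mu> \<rho>" for \<mu> \<rho>
  proof -
    have \<mu>: "0 < \<mu>" "\<mu> \<le> 1" using adm by (auto simp: adm_def)
    let ?S = "shell_size DIM('a) \<mu>"
    have S: "?S > 0" using \<mu> shell_size_pos by simp
    note [measurable] = packet_wave_measurable[OF P adm]
    let ?F = "\<lambda>k. \<lambda>\<xi>::'a. cmod (of_real ((norm \<xi>)\<^sup>2 - 1) ^ k * fourier (wave (bump_packet \<mu> \<rho>)) \<xi>)"
    have le: "(1 + (norm \<xi>)\<^sup>2) powr s * (cmod (fourier (wave (bump_packet \<mu> \<rho>)) \<xi>))\<^sup>2
        \<le> ?c * ?c * (?F 0 \<xi>)\<^sup>2 + ?c * (?F M \<xi>)\<^sup>2" for \<xi> :: 'a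
    proof -
      let ?w = "(norm \<xi>)\<^sup>2 - 1"
      have "(1 + (norm \<xi>)\<^sup>2) powr s \<le> (1 + (norm \<xi>)\<^sup>2) powr (real (2 * M))"
        using M by (intro powr_mono) auto
      also have "\<dots> = (1 + (norm \<xi>)\<^sup>2) ^ (2 * M)" by (rule powr_realpow) (auto intro: add_pos_nonneg)
      also have "\<dots> \<le> (2 + \<bar>?w\<bar>) ^ (2 * M)" by (intro power_mono) auto
      also have "\<dots> \<le> ?c * (?c + \<bar>?w\<bar> ^ (2 * M))" by (rule add_power_le) auto
      finally have "(1 + (norm \<xi>)\<^sup>2) powr s * (cmod (fourier (wave (bump_packet \<mu> \<rho>)) \<xi>))\<^sup>2
          \<le> ?c * (?c + \<bar>?w\<bar> ^ (2 * M)) * (cmod (fourier (wave (bump_packet \<mu> \<rho>)) \<xi>))\<^sup>2"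
        by (rule mult_right_mono) simp
      also have "\<dots> = ?c * ?c * (?F 0 \<xi>)\<^sup>2 + ?c * (?F M \<xi>)\<^sup>2"
        by (simp only: norm_mult norm_power norm_of_real power_mult_distrib power_even_eq) (simp add: algebra_simps)
      finally show ?thesis .
    qed
    have "(\<integral>\<^sup>+\<xi>. ennreal ((1 + (norm \<xi>)\<^sup>2) powr s * (cmod (fourier (wave (bump_packet \<mu> \<rho>)) (\<xi>::'a)))\<^sup>2) \<partial>lborel)
      \<le> (\<integral>\<^sup>+\<xi>. ennreal (?c * ?c) * ennreal ((?F 0 \<xi>)\<^sup>2) + ennreal ?c * ennreal ((?F M \<xi>)\<^sup>2) \<partial>lborel)"
    proof (rule nn_integral_mono)
      fix \<xi> :: 'a
      have "ennreal (?c * ?c) * ennreal ((?F 0 \<xi>)\<^sup>2) + ennreal ?c * ennreal ((?F M \<xi>)\<^sup>2) = ennreal (?c * ?c * (?F 0 \<xi>)\<^sup>2 + ?c * (?F M \<xi>)\<^sup>2)"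
        by (subst (1 2) ennreal_mult[symmetric]) (auto intro!: ennreal_plus[symmetric])
      then show "ennreal ((1 + (norm \<xi>)\<^sup>2) powr s * (cmod (fourier (wave (bump_packet \<mu> \<rho>)) \<xi>))\<^sup>2) \<le> ennreal (?c * ?c) * ennreal ((?F 0 \<xi>)\<^sup>2) + ennreal ?c * ennreal ((?F M \<xi>)\<^sup>2)"
        using ennreal_leI[OF le[of \<xi>]] by simp
    qed
    also have "\<dots> = ennreal (?c * ?c) * (\<integral>\<^sup>+\<xi>. ennreal ((?F 0 \<xi>)\<^sup>2) \<partial>lborel) + ennreal ?c * (\<integral>\<^sup>+\<xi>. ennreal ((?F M \<xi>)\<^sup>2) \<partial>lborel)"
      by (rule nn_integral_lincomb2; measurable)
    also have "\<dots> \<le> ennreal (?c * ?c) * ennreal (C0 * ?S) + ennreal ?c * ennreal (CM * ?S)"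
    proof (intro add_mono mult_left_mono)
      show "(\<integral>\<^sup>+\<xi>. ennreal ((?F 0 \<xi>)\<^sup>2) \<partial>lborel) \<le> ennreal (C0 * ?S)" using C0(2)[OF adm] by simp
      have "CM * (\<mu> ^ (2 * (M + 0)) * ?S) \<le> CM * (1 * ?S)"
        using CM(1) \<mu> S by (intro mult_left_mono mult_right_mono power_le_one) auto
      then show "(\<integral>\<^sup>+\<xi>. ennreal ((?F M \<xi>)\<^sup>2) \<partial>lborel) \<le> ennreal (CM * ?S)"
        using CM(2)[OF adm] ennreal_leI order_trans by fastforce
    qed auto
    also have "\<dots> = ennreal (K * ?S)"
      using C0(1) CM(1) S unfolding K_def
      by (simp add: ennreal_mult[symmetric] ennreal_plus[symmetric] algebra_simps del: ennreal_plus)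
    finally show ?thesis .
  qed
  moreover have "K \<ge> 0" unfolding K_def using C0(1) CM(1) by auto
  ultimately show ?thesis by blast
qed

section \<open>Propagation of a packet\<close>

lemma bump_continuous: "continuous_on S (bump j)"
  using bump_has_derivative by (meson DERIV_isCont continuous_at_imp_continuous_on)

lemma bump_measurable [measurable]: "bump j \<in> borel_measurable borel"
  by (intro borel_measurable_continuous_onI bump_continuous)

lemma rderiv_bump_packet: "rderiv bump_packet \<mu> \<rho> r = of_real (\<mu> * bump 1 (\<mu> * (r - \<rho>)))"
proof -
  have g: "((\<lambda>r. \<mu> * (r - \<rho>)) has_real_derivative \<mu>) (at r)"
    by (auto intro!: derivative_eq_intros)
  have "((\<lambda>r. bump 0 (\<mu> * (r - \<rho>))) has_real_derivative (\<mu> * bump 1 (\<mu> * (r - \<rho>)))) (at r)"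
    using DERIV_chain2[OF bump_has_derivative g, of 0] by (simp add: mult.commute)
  then have "(bump_packet \<mu> \<rho> has_vector_derivative of_real (\<mu> * bump 1 (\<mu> * (r - \<rho>)))) (at r)"
    unfolding bump_packet_def[abs_def] by (rule has_vector_derivative_of_real)
  then show ?thesis by (simp add: rderiv_def vector_derivative_at)
qed

text \<open>
  Up to a unimodular factor, the time derivative of \<open>interaction\<close> below: the first term comes from the phase, the second
  from the motion of the bump with speed \<open>a\<close>.
\<close>

definition drift :: "real \<Rightarrow> real \<Rightarrow> real \<Rightarrow> 'a::euclidean_space \<Rightarrow> complex" where
  "drift a \<mu> \<rho> \<xi> = \<i> * of_real (1 - norm \<xi> powr a) * fourier (wave (bump_packet \<mu> \<rho>)) \<xi>
     - of_real a * fourier (wave (rderiv bump_packet \<mu> \<rho>)) \<xi>"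

text \<open>
  The two large terms cancel. The linear part \<open>- (a / 2) * ((norm \<xi>)\<^sup>2 - 1)\<close> of \<open>1 - norm \<xi> powr a\<close> acts on the packet
  through the transport term \<open>2 * \<i> * \<partial>\<^sub>r\<close> and gives \<open>a * \<partial>\<^sub>r\<close>, exactly the motion of the bump.
\<close>

lemma drift_eq_residual:
  fixes \<xi> :: "'a::euclidean_space"
  assumes adm: "adm A \<mu> \<rho>"
  shows "drift a \<mu> \<rho> \<xi> = residual a \<mu> \<rho> \<xi>"
proof -
  let ?n = "real DIM('a)"
  note P = packet_bump_packet[of A] and R = packet_rest[OF packet_bump_packet[of A], of ?n]
    and D = packet_rderiv[OF packet_bump_packet[of A]]
  let ?F = "fourier (wave (bump_packet \<mu> \<rho>)) \<xi>" and ?D = "fourier (wave (rderiv bump_packet \<mu> \<rho>)) \<xi>"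
    and ?R = "fourier (wave (packet_rest ?n bump_packet \<mu> \<rho>)) \<xi>"
  have "wave (packet_op ?n bump_packet \<mu> \<rho>) x = wave (packet_rest ?n bump_packet \<mu> \<rho>) x + 2 * \<i> * wave (rderiv bump_packet \<mu> \<rho>) x" for x :: 'a
    by (simp add: wave_def packet_rest_def algebra_simps)
  then have "fourier (wave (packet_op ?n bump_packet \<mu> \<rho>)) \<xi> = fourier (\<lambda>x. wave (packet_rest ?n bump_packet \<mu> \<rho>) x + 2 * \<i> * wave (rderiv bump_packet \<mu> \<rho>) x) \<xi>"
    by presburger
  also have "\<dots> = ?R + 2 * \<i> * ?D"
    by (subst fourier_add) (auto intro!: packet_wave(3)[OF R adm] integrable_mult_right packet_wave(3)[OF D adm] simp: fourier_cmult)
  finally have w: "of_real ((norm \<xi>)\<^sup>2 - 1) * ?F = ?R + 2 * \<i> * ?D"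
    using fourier_packet_op[OF P adm, of \<xi>] by simp
  have "1 - norm \<xi> powr a = - (a / 2) * ((norm \<xi>)\<^sup>2 - 1) - symbol_error a \<xi>"
    by (simp add: symbol_error_def algebra_simps)
  then have "drift a \<mu> \<rho> \<xi> = \<i> * (- of_real (a / 2) * (of_real ((norm \<xi>)\<^sup>2 - 1) * ?F) - of_real (symbol_error a \<xi>) * ?F) - of_real a * ?D"
    unfolding drift_def by (simp only: of_real_diff of_real_mult of_real_minus) (simp add: algebra_simps)
  also have "\<dots> = residual a \<mu> \<rho> \<xi>"
    unfolding w residual_def by (simp add: algebra_simps)
  finally show ?thesis .
qed

text \<open>
  The transported packet in the interaction picture, with the free evolution undone and the phase \<open>exp (\<i> * \<sigma>)\<close> of
  frequency 1 restored. It would be constant in \<open>\<sigma>\<close> if the transported packet were an exact solution.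
\<close>

definition interaction :: "real \<Rightarrow> real \<Rightarrow> real \<Rightarrow> real \<Rightarrow> 'a::euclidean_space \<Rightarrow> complex" where
  "interaction a \<mu> \<rho> \<sigma> \<xi> = exp (\<i> * of_real (\<sigma> * (1 - norm \<xi> powr a))) * fourier (wave (bump_packet \<mu> (\<rho> + a * \<sigma>))) \<xi>"

text \<open>
  For each point \<open>y\<close> of space the fundamental theorem of calculus applies in \<open>\<sigma>\<close>; Fubini's theorem then exchanges the
  integrals over \<open>y\<close> and \<open>\<sigma>\<close>.
\<close>

lemma interaction_duhamel:
  fixes \<xi> :: "'a::euclidean_space"
  assumes adm: "\<And>\<sigma>. \<sigma> \<in> {0..\<tau>} \<Longrightarrow> adm A \<mu> (\<rho> + a * \<sigma>)" and \<tau>: "\<tau> \<ge> 0"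
  shows "interaction a \<mu> \<rho> \<tau> \<xi> - fourier (wave (bump_packet \<mu> \<rho>)) \<xi>
    = (LINT \<sigma>|lborel. indicator {0..\<tau>} \<sigma> *\<^sub>R (exp (\<i> * of_real (\<sigma> * (1 - norm \<xi> powr a))) * drift a \<mu> (\<rho> + a * \<sigma>) \<xi>))"
proof -
  define \<kappa> where "\<kappa> = 1 - norm \<xi> powr a"
  note P = packet_bump_packet[of A] and D = packet_rderiv[OF packet_bump_packet[of A]]
  let ?e = "\<lambda>y::'a. exp (- (\<i> * complex_of_real (y \<bullet> \<xi>)))"
  let ?h = "\<lambda>\<sigma>. wave (bump_packet \<mu> (\<rho> + a * \<sigma>)) :: 'a \<Rightarrow> complex"
  let ?h' = "\<lambda>\<sigma>. wave (rderiv bump_packet \<mu> (\<rho> + a * \<sigma>)) :: 'a \<Rightarrow> complex"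
  let ?E = "\<lambda>\<sigma>. exp (\<i> * complex_of_real (\<sigma> * \<kappa>))"
  let ?g = "\<lambda>\<sigma> y. ?E \<sigma> * (?e y * (\<i> * of_real \<kappa> * ?h \<sigma> y - of_real a * ?h' \<sigma> y))"
  have adm0: "adm A \<mu> \<rho>" using adm[of 0] \<tau> by simp
  have dE: "(?E has_vector_derivative (\<i> * of_real \<kappa> * ?E \<sigma>)) (at \<sigma>)" for \<sigma>
  proof -
    have "((\<lambda>\<sigma>. \<i> * complex_of_real (\<sigma> * \<kappa>)) has_vector_derivative (\<i> * of_real \<kappa>)) (at \<sigma>)"
      by (intro has_vector_derivative_mult_right has_vector_derivative_of_real) (auto intro!: derivative_eq_intros)
    from field_vector_diff_chain_at[OF this DERIV_exp] show ?thesis by (simp add: o_def)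
  qed
  have dh: "((\<lambda>\<sigma>. ?h \<sigma> y) has_vector_derivative (- of_real a * ?h' \<sigma> y)) (at \<sigma>)" for \<sigma> y
  proof -
    have g: "((\<lambda>\<sigma>. \<mu> * (norm y - (\<rho> + a * \<sigma>))) has_real_derivative (- \<mu> * a)) (at \<sigma>)"
      by (auto intro!: derivative_eq_intros)
    have "((\<lambda>\<sigma>. bump 0 (\<mu> * (norm y - (\<rho> + a * \<sigma>)))) has_real_derivative (bump 1 (\<mu> * (norm y - (\<rho> + a * \<sigma>))) * (- \<mu> * a))) (at \<sigma>)"
      using DERIV_chain2[OF bump_has_derivative g, of 0] by simp
    from has_vector_derivative_mult_right[OF has_vector_derivative_of_real[OF this], of "exp (- (\<i> * of_real (norm y)))"]
    show ?thesis by (simp add: wave_def bump_packet_def rderiv_bump_packet algebra_simps)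
  qed
  have dg: "((\<lambda>\<sigma>. ?E \<sigma> * (?e y * ?h \<sigma> y)) has_vector_derivative ?g \<sigma> y) (at \<sigma>)" for \<sigma> y
  proof -
    have eq: "?g \<sigma> y = ?E \<sigma> * (?e y * (- of_real a * ?h' \<sigma> y)) + (\<i> * of_real \<kappa> * ?E \<sigma>) * (?e y * ?h \<sigma> y)"
      by (simp add: algebra_simps)
    show ?thesis unfolding eq by (rule has_vector_derivative_mult[OF dE has_vector_derivative_mult_right[OF dh]])
  qed
  have ch: "continuous_on S (\<lambda>p. ?h (fst p) (snd p))" "continuous_on S (\<lambda>p. ?h' (fst p) (snd p))" for S
    unfolding wave_def bump_packet_def rderiv_bump_packet
    by (intro continuous_intros continuous_on_compose2[OF bump_continuous[of UNIV]] subset_UNIV)+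
  have cg: "continuous_on S (\<lambda>p. ?g (fst p) (snd p))" for S
    by (intro continuous_intros ch)
  have FTC: "(LINT \<sigma>|lborel. indicator {0..\<tau>} \<sigma> *\<^sub>R ?g \<sigma> y) = ?E \<tau> * (?e y * ?h \<tau> y) - ?e y * ?h 0 y" for y
  proof -
    have "(LINT \<sigma>|lborel. indicator {0..\<tau>} \<sigma> *\<^sub>R ?g \<sigma> y) = ?E \<tau> * (?e y * ?h \<tau> y) - ?E 0 * (?e y * ?h 0 y)"
    proof (rule integral_FTC_atLeastAtMost[OF \<tau>])
      show "((\<lambda>\<sigma>. ?E \<sigma> * (?e y * ?h \<sigma> y)) has_vector_derivative ?g \<sigma> y) (at \<sigma> within {0..\<tau>})" for \<sigma>
        by (rule has_vector_derivative_at_within[OF dg])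
      show "continuous_on {0..\<tau>} (\<lambda>\<sigma>. ?g \<sigma> y)"
      proof -
        have "continuous_on {0..\<tau>} (\<lambda>\<sigma>. ?g (fst (\<sigma>, y)) (snd (\<sigma>, y)))"
          by (rule continuous_on_compose2[OF cg[of UNIV], where f = "\<lambda>\<sigma>. (\<sigma>, y)"]) (auto intro!: continuous_on_Pair continuous_on_id continuous_on_const)
        then show ?thesis by (simp only: fst_conv snd_conv)
      qed
    qed
    then show ?thesis by simp
  qed
  have int2: "integrable (lborel \<Otimes>\<^sub>M lborel) (case_prod (\<lambda>\<sigma> y. indicator {0..\<tau>} \<sigma> *\<^sub>R ?g \<sigma> y))"
  proof -
    let ?K = "{0..\<tau>} \<times> cball (0::'a) ((A + 1) / \<mu>\<^sup>2)"
    have "integrable lborel (\<lambda>p. indicator ?K p *\<^sub>R ?g (fst p) (snd p))"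
      by (intro borel_integrable_compact cg compact_Times) auto
    also have "(\<lambda>p. indicator ?K p *\<^sub>R ?g (fst p) (snd p)) = case_prod (\<lambda>\<sigma> y. indicator {0..\<tau>} \<sigma> *\<^sub>R ?g \<sigma> y)"
    proof (rule ext, clarify)
      fix \<sigma> :: real and y :: 'a
      show "indicator ?K (\<sigma>, y) *\<^sub>R ?g (fst (\<sigma>, y)) (snd (\<sigma>, y)) = indicator {0..\<tau>} \<sigma> *\<^sub>R ?g \<sigma> y"
      proof (cases "\<sigma> \<in> {0..\<tau>} \<and> norm y > (A + 1) / \<mu>\<^sup>2")
        case True
        then have "?h \<sigma> y = 0" "?h' \<sigma> y = 0"
          using packet_wave(2)[OF P adm] packet_wave(2)[OF D adm] by blast+
        then show ?thesis by simp
      qed (auto simp: indicator_def)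
    qed
    finally show ?thesis by (simp add: lborel_prod)
  qed
  have inner: "(LINT y|lborel. ?g \<sigma> y) = ?E \<sigma> * drift a \<mu> (\<rho> + a * \<sigma>) \<xi>" if \<sigma>: "\<sigma> \<in> {0..\<tau>}" for \<sigma>
  proof -
    have "(LINT y|lborel. ?e y * (\<i> * of_real \<kappa> * ?h \<sigma> y - of_real a * ?h' \<sigma> y))
        = (LINT y|lborel. \<i> * of_real \<kappa> * (?e y * ?h \<sigma> y) - of_real a * (?e y * ?h' \<sigma> y))"
      by (simp add: algebra_simps)
    also have "\<dots> = \<i> * of_real \<kappa> * fourier (?h \<sigma>) \<xi> - of_real a * fourier (?h' \<sigma>) \<xi>"
      unfolding fourier_def
      by (subst Bochner_Integration.integral_diff)
         (intro integrable_mult_right integrable_fourier_integrand packet_wave(3)[OF P adm[OF \<sigma>]] packet_wave(3)[OF D adm[OF \<sigma>]] | simp only: integral_mult_right_zero)+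
    also have "\<dots> = drift a \<mu> (\<rho> + a * \<sigma>) \<xi>" by (simp add: drift_def \<kappa>_def)
    finally show ?thesis by (simp only: integral_mult_right_zero)
  qed
  have i1: "integrable lborel (\<lambda>y. ?e y * ?h \<tau> y)" and i0: "integrable lborel (\<lambda>y. ?e y * ?h 0 y)"
    using adm[of \<tau>] adm0 \<tau> by (auto intro!: integrable_fourier_integrand packet_wave(3)[OF P])
  have "interaction a \<mu> \<rho> \<tau> \<xi> - fourier (wave (bump_packet \<mu> \<rho>)) \<xi>
      = (LINT y|lborel. ?E \<tau> * (?e y * ?h \<tau> y) - ?e y * ?h 0 y)"
    by (subst Bochner_Integration.integral_diff)
       (use i1 i0 in \<open>simp_all add: interaction_def fourier_def \<kappa>_def\<close>)
  also have "\<dots> = (LINT y|lborel. (LINT \<sigma>|lborel. indicator {0..\<tau>} \<sigma> *\<^sub>R ?g \<sigma> y))"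
    by (simp only: FTC)
  also have "\<dots> = (LINT \<sigma>|lborel. (LINT y|lborel. indicator {0..\<tau>} \<sigma> *\<^sub>R ?g \<sigma> y))"
    by (rule lborel_pair.Fubini_integral[OF int2])
  also have "\<dots> = (LINT \<sigma>|lborel. indicator {0..\<tau>} \<sigma> *\<^sub>R (?E \<sigma> * drift a \<mu> (\<rho> + a * \<sigma>) \<xi>))"
  proof (rule Bochner_Integration.integral_cong[OF refl])
    fix \<sigma> :: real
    show "(LINT y|lborel. indicator {0..\<tau>} \<sigma> *\<^sub>R ?g \<sigma> y) = indicator {0..\<tau>} \<sigma> *\<^sub>R (?E \<sigma> * drift a \<mu> (\<rho> + a * \<sigma>) \<xi>)"
      by (cases "\<sigma> \<in> {0..\<tau>}") (simp only: inner indicator_simps scaleR_one, simp)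
  qed
  finally show ?thesis by (simp only: \<kappa>_def)
qed

lemma drift_measurable:
  "(\<lambda>p. drift a \<mu> (\<rho> + a * fst p) (snd p :: 'a::euclidean_space)) \<in> borel_measurable (borel \<Otimes>\<^sub>M borel)"
  unfolding drift_def fourier_def wave_def bump_packet_def rderiv_bump_packet by measurable


text \<open>
  Bounds the Duhamel term paired with a fixed function \<open>\<phi>\<close>: exchange the integrals and estimate for every \<open>\<sigma>\<close>.
\<close>

lemma nn_integral_drift_le:
  fixes \<phi> :: "'a::euclidean_space \<Rightarrow> real"
  assumes [measurable]: "\<phi> \<in> borel_measurable borel" and \<phi>: "\<And>\<xi>. \<phi> \<xi> \<ge> 0" and \<tau>: "\<tau> \<ge> 0"
    and N: "(\<integral>\<^sup>+\<xi>. ennreal ((\<phi> \<xi>)\<^sup>2) \<partial>lborel) \<le> ennreal N" "N \<ge> 0"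
    and D: "\<And>\<sigma>. \<sigma> \<in> {0..\<tau>} \<Longrightarrow> energy (drift a \<mu> (\<rho> + a * \<sigma>) :: 'a \<Rightarrow> complex) \<le> ennreal (\<mu> ^ 4 * K)"
    and K: "K \<ge> 0"
    and \<mu>: "\<mu> > 0"
  shows "(\<integral>\<^sup>+\<xi>. (\<integral>\<^sup>+\<sigma>. ennreal (indicator {0..\<tau>} \<sigma> * (\<phi> \<xi> * cmod (drift a \<mu> (\<rho> + a * \<sigma>) \<xi>))) \<partial>lborel) \<partial>lborel)
    \<le> ennreal (\<tau> * (\<mu>\<^sup>2 * (N + K) / 2))"
proof -
  note dm [measurable] = drift_measurable[of a \<mu> \<rho>, where 'a = 'a]
  have m2: "case_prod (\<lambda>\<sigma> \<xi>. ennreal (indicator {0..\<tau>} \<sigma> * (\<phi> \<xi> * cmod (drift a \<mu> (\<rho> + a * \<sigma>) \<xi>)))) \<in> borel_measurable (lborel \<Otimes>\<^sub>M lborel)"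
    unfolding split_beta' by measurable
  have dm': "drift a \<mu> (\<rho> + a * \<sigma>) \<in> borel_measurable (borel :: 'a measure)" for \<sigma>
    using measurable_compose[OF _ dm, of "\<lambda>\<xi>. (\<sigma>, \<xi>)" borel] by simp
  have inner: "(\<integral>\<^sup>+\<xi>. ennreal (\<phi> \<xi> * cmod (drift a \<mu> (\<rho> + a * \<sigma>) \<xi>)) \<partial>lborel) \<le> ennreal (\<mu>\<^sup>2 * (N + K) / 2)"
    if \<sigma>: "\<sigma> \<in> {0..\<tau>}" for \<sigma>
  proof -
    let ?d = "\<lambda>\<xi>::'a. cmod (drift a \<mu> (\<rho> + a * \<sigma>) \<xi>)"
    have dm'': "?d \<in> borel_measurable borel" using measurable_compose[OF dm' borel_measurable_norm] by simp
    \<comment> \<open>the weights balance energies of size 1 and \<open>\<mu> ^ 4\<close>\<close>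
    have young: "\<phi> \<xi> * ?d \<xi> \<le> \<mu>\<^sup>2 / 2 * (\<phi> \<xi>)\<^sup>2 + 1 / (2 * \<mu>\<^sup>2) * (?d \<xi>)\<^sup>2" for \<xi>
    proof -
      have "0 \<le> (\<mu>\<^sup>2 * \<phi> \<xi> - ?d \<xi>)\<^sup>2 / (2 * \<mu>\<^sup>2)" by simp
      also have "\<dots> = \<mu>\<^sup>2 / 2 * (\<phi> \<xi>)\<^sup>2 + 1 / (2 * \<mu>\<^sup>2) * (?d \<xi>)\<^sup>2 - \<phi> \<xi> * ?d \<xi>"
        using \<mu> by (simp add: power2_eq_square field_simps)
      finally show ?thesis by simp
    qed
    have "(\<integral>\<^sup>+\<xi>. ennreal (\<phi> \<xi> * ?d \<xi>) \<partial>lborel) \<le> (\<integral>\<^sup>+\<xi>. ennreal (\<mu>\<^sup>2 / 2) * ennreal ((\<phi> \<xi>)\<^sup>2) + ennreal (1 / (2 * \<mu>\<^sup>2)) * ennreal ((?d \<xi>)\<^sup>2) \<partial>lborel)"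
    proof (rule nn_integral_mono)
      fix \<xi> :: 'a
      have "ennreal (\<mu>\<^sup>2 / 2) * ennreal ((\<phi> \<xi>)\<^sup>2) + ennreal (1 / (2 * \<mu>\<^sup>2)) * ennreal ((?d \<xi>)\<^sup>2) = ennreal (\<mu>\<^sup>2 / 2 * (\<phi> \<xi>)\<^sup>2 + 1 / (2 * \<mu>\<^sup>2) * (?d \<xi>)\<^sup>2)"
        by (subst (1 2) ennreal_mult[symmetric]) (auto intro!: ennreal_plus[symmetric])
      then show "ennreal (\<phi> \<xi> * ?d \<xi>) \<le> ennreal (\<mu>\<^sup>2 / 2) * ennreal ((\<phi> \<xi>)\<^sup>2) + ennreal (1 / (2 * \<mu>\<^sup>2)) * ennreal ((?d \<xi>)\<^sup>2)"
        using ennreal_leI[OF young[of \<xi>]] by simp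
    qed
    also have "\<dots> = ennreal (\<mu>\<^sup>2 / 2) * (\<integral>\<^sup>+\<xi>. ennreal ((\<phi> \<xi>)\<^sup>2) \<partial>lborel) + ennreal (1 / (2 * \<mu>\<^sup>2)) * (\<integral>\<^sup>+\<xi>. ennreal ((?d \<xi>)\<^sup>2) \<partial>lborel)"
    proof (rule nn_integral_lincomb2)
      show "(\<lambda>\<xi>. ennreal ((\<phi> \<xi>)\<^sup>2)) \<in> borel_measurable lborel" by measurable
      show "(\<lambda>\<xi>. ennreal ((?d \<xi>)\<^sup>2)) \<in> borel_measurable lborel"
        using measurable_compose[OF borel_measurable_power[OF dm'', of 2] measurable_ennreal] by simp
    qed
    also have "\<dots> \<le> ennreal (\<mu>\<^sup>2 / 2) * ennreal N + ennreal (1 / (2 * \<mu>\<^sup>2)) * ennreal (\<mu> ^ 4 * K)"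
      by (intro add_mono mult_left_mono N D \<sigma>) auto
    also have "\<dots> = ennreal (\<mu>\<^sup>2 / 2 * N + 1 / (2 * \<mu>\<^sup>2) * (\<mu> ^ 4 * K))"
      using N(2) K by (subst (1 2) ennreal_mult[symmetric]) (auto intro!: ennreal_plus[symmetric])
    also have "\<mu>\<^sup>2 / 2 * N + 1 / (2 * \<mu>\<^sup>2) * (\<mu> ^ 4 * K) = \<mu>\<^sup>2 * (N + K) / 2"
      using \<mu> by (simp add: field_simps power2_eq_square power4_eq_xxxx)
    finally show ?thesis .
  qed
  have "(\<integral>\<^sup>+\<xi>. (\<integral>\<^sup>+\<sigma>. ennreal (indicator {0..\<tau>} \<sigma> * (\<phi> \<xi> * cmod (drift a \<mu> (\<rho> + a * \<sigma>) \<xi>))) \<partial>lborel) \<partial>lborel)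
    = (\<integral>\<^sup>+\<sigma>. (\<integral>\<^sup>+\<xi>. ennreal (indicator {0..\<tau>} \<sigma> * (\<phi> \<xi> * cmod (drift a \<mu> (\<rho> + a * \<sigma>) \<xi>))) \<partial>lborel) \<partial>lborel)"
    by (rule lborel_pair.Fubini'[OF m2])
  also have "\<dots> \<le> (\<integral>\<^sup>+\<sigma>. ennreal (\<mu>\<^sup>2 * (N + K) / 2) * indicator {0..\<tau>} \<sigma> \<partial>lborel)"
  proof (rule nn_integral_mono)
    fix \<sigma> :: real
    show "(\<integral>\<^sup>+\<xi>. ennreal (indicator {0..\<tau>} \<sigma> * (\<phi> \<xi> * cmod (drift a \<mu> (\<rho> + a * \<sigma>) \<xi>))) \<partial>lborel)
      \<le> ennreal (\<mu>\<^sup>2 * (N + K) / 2) * indicator {0..\<tau>} \<sigma>"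
    proof (cases "\<sigma> \<in> {0..\<tau>}")
      case True
      then show ?thesis using inner[OF True] by (simp only: indicator_simps mult_1_left mult_1_right)
    qed simp
  qed
  also have "\<dots> = ennreal (\<tau> * (\<mu>\<^sup>2 * (N + K) / 2))"
    using \<tau> N(2) K by (subst nn_integral_cmult_indicator) (auto simp: ennreal_mult[symmetric] mult.commute)
  finally show ?thesis .
qed

text \<open>
  Exchanging the integrals over \<open>y\<close> and \<open>\<xi>\<close> turns the plane waves \<open>exp (\<i> * (y \<bullet> \<xi>))\<close> into the conjugate of the
  Fourier transform of \<open>h\<close>.
\<close>

lemma fourier_pairing:
  fixes f h :: "'a::euclidean_space \<Rightarrow> complex"
  assumes f: "integrable lborel (fourier f)" and fm: "f \<in> borel_measurable borel" and h: "integrable lborel h"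
  shows "(LINT y|lborel. dispersive a f y t * cnj (h y))
    = (LINT \<xi>|lborel. exp (\<i> * of_real (t * norm \<xi> powr a)) * fourier f \<xi> * cnj (fourier h \<xi>)) / of_real ((2 * pi) ^ DIM('a))"
proof -
  note [measurable] = fm
  have [measurable]: "h \<in> borel_measurable borel" using h by auto
  let ?c = "1 / complex_of_real ((2 * pi) ^ DIM('a))"
  let ?F = "\<lambda>y \<xi>. exp (\<i> * of_real (y \<bullet> \<xi> + t * norm \<xi> powr a)) * fourier f \<xi> * cnj (h y)"
  have int: "integrable (lborel \<Otimes>\<^sub>M lborel) (case_prod ?F)"
    by (rule integrable_pair_bound[where f = "\<lambda>y. cnj (h y)" and h = "fourier f"])
       (use f h in \<open>auto simp: norm_mult mult.commute\<close>)
  have inner: "(LINT y|lborel. ?F y \<xi>) = exp (\<i> * of_real (t * norm \<xi> powr a)) * fourier f \<xi> * cnj (fourier h \<xi>)" for \<xi>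
  proof -
    have e: "exp (\<i> * of_real (y \<bullet> \<xi> + t * norm \<xi> powr a)) = exp (\<i> * of_real (t * norm \<xi> powr a)) * cnj (exp (- (\<i> * of_real (y \<bullet> \<xi>))))" for y
      by (simp add: exp_cnj distrib_left exp_add)
    have "(LINT y|lborel. ?F y \<xi>) = (LINT y|lborel. exp (\<i> * of_real (t * norm \<xi> powr a)) * fourier f \<xi> * cnj (exp (- (\<i> * of_real (y \<bullet> \<xi>))) * h y))"
      unfolding e by (simp add: ac_simps)
    then show ?thesis by (simp only: integral_mult_right_zero Bochner_Integration.integral_cnj fourier_def)
  qed
  have "(LINT y|lborel. dispersive a f y t * cnj (h y)) = (LINT y|lborel. ?c * (LINT \<xi>|lborel. ?F y \<xi>))"
    unfolding dispersive_def mult.assoc[of ?c] integral_mult_left_zero[symmetric] ..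
  also have "\<dots> = ?c * (LINT y|lborel. (LINT \<xi>|lborel. ?F y \<xi>))"
    by (rule integral_mult_right_zero)
  also have "(LINT y|lborel. (LINT \<xi>|lborel. ?F y \<xi>)) = (LINT \<xi>|lborel. (LINT y|lborel. ?F y \<xi>))"
    by (rule lborel_pair.Fubini_integral[OF int, symmetric])
  finally show ?thesis by (simp only: inner) simp
qed

lemma dispersive_borel_measurable:
  fixes f :: "'a::euclidean_space \<Rightarrow> complex"
  assumes [measurable]: "f \<in> borel_measurable borel"
  shows "(\<lambda>y. dispersive a f y t) \<in> borel_measurable borel"
  unfolding dispersive_def by measurable

text \<open>
  Pair the solution with the transported packet \<open>h\<close>. By \<open>fourier_pairing\<close> and \<open>interaction_duhamel\<close> the pairing is, up
  to a constant phase, the energy of the initial packet plus a Duhamel term, which is at most half of it while \<open>\<tau> * \<mu>\<^sup>2\<close> is small. Since \<open>h\<close>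
  vanishes off the shell, the Cauchy-Schwarz inequality bounds the energy of the solution inside the shell from below.
\<close>

lemma packet_mass_at_time:
  fixes a A :: real
  assumes a: "a > 0" and A: "A \<ge> 0"
  obtains c0 c1 :: real where "c0 > 0" "c1 > 0"
    and "\<And>\<mu> \<rho> \<tau>. 0 \<le> \<tau> \<Longrightarrow> \<tau> * \<mu>\<^sup>2 \<le> c0 \<Longrightarrow> (\<And>\<sigma>. \<sigma> \<in> {0..\<tau>} \<Longrightarrow> adm A \<mu> (\<rho> + a * \<sigma>)) \<Longrightarrow>
      ennreal (c1 * shell_size DIM('a) \<mu>)
       \<le> (\<integral>\<^sup>+y. ennreal ((cmod (dispersive a (wave (bump_packet \<mu> \<rho>)) (y::'a::euclidean_space) \<tau>))\<^sup>2)
             * indicator {y. \<bar>norm y - (\<rho> + a * \<tau>)\<bar> \<le> 1 / \<mu>} y \<partial>lborel)"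
proof -
  note P = packet_bump_packet[of A]
  let ?C = "(2 * pi) ^ DIM('a)"
  have C: "?C > 0" by simp
  obtain KR where KR: "KR \<ge> 0" "\<And>\<mu> \<rho>. adm A \<mu> \<rho> \<Longrightarrow> energy (residual a \<mu> \<rho> :: 'a \<Rightarrow> complex)
      \<le> ennreal (KR * (\<mu> ^ 4 * shell_size DIM('a) \<mu>))"
    using residual_L2[OF a A, where 'a = 'a] by blast
  obtain c where c: "c > 0" "\<And>A \<mu> \<rho>. adm A \<mu> \<rho> \<Longrightarrow> ennreal (c * shell_size DIM('a) \<mu>)
       \<le> energy (wave (bump_packet \<mu> \<rho>) :: 'a \<Rightarrow> complex)"
    using bump_packet_L2_lower[where 'a = 'a] by blast
  obtain KU where KU: "KU \<ge> 0" "\<And>\<mu> \<rho>. adm A \<mu> \<rho> \<Longrightarrow> energy (wave (bump_packet \<mu> \<rho>) :: 'a \<Rightarrow> complex)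
      \<le> ennreal (KU * (\<mu> ^ (2 * 0) * shell_size DIM('a) \<mu>))"
    using wave_packet_L2_upper[OF P A, where 'a = 'a] by blast
  \<comment> \<open>makes the Duhamel term at most half of the energy on the Fourier side\<close>
  define c0 where "c0 = 1 / (1 + KR / (?C * c))"
  have c0: "c0 > 0" unfolding c0_def using KR(1) c(1) C by (intro divide_pos_pos add_pos_nonneg) auto
  define c1 where "c1 = (c / 2)\<^sup>2 / (KU + 1)"
  have c1: "c1 > 0" using c(1) KU(1) by (simp add: c1_def)
  have claim: "ennreal (c1 * shell_size DIM('a) \<mu>)
     \<le> (\<integral>\<^sup>+y. ennreal ((cmod (dispersive a (wave (bump_packet \<mu> \<rho>)) (y::'a) \<tau>))\<^sup>2)
           * indicator {y. \<bar>norm y - (\<rho> + a * \<tau>)\<bar> \<le> 1 / \<mu>} y \<partial>lborel)"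
    if \<tau>: "0 \<le> \<tau>" and small: "\<tau> * \<mu>\<^sup>2 \<le> c0" and adm: "\<And>\<sigma>. \<sigma> \<in> {0..\<tau>} \<Longrightarrow> adm A \<mu> (\<rho> + a * \<sigma>)" for \<mu> \<rho> \<tau>
  proof -
    have adm0: "adm A \<mu> \<rho>" and adm1: "adm A \<mu> (\<rho> + a * \<tau>)" using adm[of 0] adm[of \<tau>] \<tau> by auto
    have \<mu>: "0 < \<mu>" "\<mu> \<le> 1" using adm0 by (auto simp: adm_def)
    define V where "V = shell_size DIM('a) \<mu>"
    have V: "V > 0" using \<mu> shell_size_pos by (simp add: V_def)
    let ?f = "wave (bump_packet \<mu> \<rho>) :: 'a \<Rightarrow> complex"
    let ?h = "wave (bump_packet \<mu> (\<rho> + a * \<tau>)) :: 'a \<Rightarrow> complex"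
    have [measurable]: "?f \<in> borel_measurable borel" "?h \<in> borel_measurable borel"
      using packet_wave_measurable[OF P adm0] packet_wave_measurable[OF P adm1] by auto
    let ?d = "\<lambda>\<xi>::'a. interaction a \<mu> \<rho> \<tau> \<xi> - fourier ?f \<xi>"
    have intf: "integrable lborel (fourier ?f)" and inth: "integrable lborel (fourier ?h)"
      by (rule integrable_fourier_packet[OF P adm0], rule integrable_fourier_packet[OF P adm1])
    have hi: "integrable lborel ?h" by (rule packet_wave(3)[OF P adm1])
    obtain B where B: "\<And>\<xi>. cmod (fourier ?f \<xi>) \<le> B"
      using cmod_fourier_le[OF packet_wave(3)[OF P adm0]] by blast
    have im: "interaction a \<mu> \<rho> \<tau> \<in> borel_measurable (borel :: 'a measure)"
      unfolding interaction_def[abs_def] by measurable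
    note [measurable] = im
    have inti: "integrable lborel (interaction a \<mu> \<rho> \<tau> :: 'a \<Rightarrow> complex)"
      by (rule Bochner_Integration.integrable_bound[OF inth]) (auto simp: interaction_def norm_mult)
    have intd: "integrable lborel ?d" using inti intf by auto
    have prod: "integrable lborel (\<lambda>\<xi>. fourier ?f \<xi> * g \<xi>)" if "integrable lborel g" for g
    proof (rule Bochner_Integration.integrable_bound[OF integrable_mult_right[OF that, of "of_real B"]])
      have [measurable]: "g \<in> borel_measurable borel" using that by auto
      show "(\<lambda>\<xi>. fourier ?f \<xi> * g \<xi>) \<in> borel_measurable lborel" by measurable
      show "AE \<xi> in lborel. cmod (fourier ?f \<xi> * g \<xi>) \<le> cmod (of_real B * g \<xi>)"
        using B by (auto intro!: always_eventually mult_right_mono order_trans[OF B abs_ge_self] simp: norm_mult)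
    qed
    define N where "N = (LINT \<xi>|lborel. (cmod (fourier ?f \<xi>))\<^sup>2)"
    have ff: "fourier ?f \<xi> * cnj (fourier ?f \<xi>) = of_real ((cmod (fourier ?f \<xi>))\<^sup>2)" for \<xi>
      by (rule complex_norm_square[symmetric])
    have intN: "integrable lborel (\<lambda>\<xi>. (cmod (fourier ?f \<xi>))\<^sup>2)"
    proof -
      have "integrable lborel (\<lambda>\<xi>. fourier ?f \<xi> * cnj (fourier ?f \<xi>))"
        by (rule prod) (use intf in simp)
      then show ?thesis unfolding ff by (simp only: complex_of_real_integrable_eq)
    qed
    have N0: "N \<ge> 0" unfolding N_def by simp
    have nnN: "energy (fourier ?f) = ennreal N"
      unfolding N_def by (rule nn_integral_eq_integral[OF intN]) auto
    have cN: "?C * c * V \<le> N"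
    proof -
      have "ennreal ?C * ennreal (c * V) \<le> ennreal ?C * energy ?f"
        using c(2)[OF adm0] by (intro mult_left_mono) (auto simp: V_def)
      also have "\<dots> = ennreal N"
        unfolding nnN[symmetric] by (rule plancherel[OF packet_wave(1,2)[OF P adm0], symmetric])
      finally have "ennreal (?C * (c * V)) \<le> ennreal N" using C c(1) V by (subst ennreal_mult) auto
      then show ?thesis using N0 by (simp add: mult.assoc)
    qed
    have delta: "(\<integral>\<^sup>+\<xi>. ennreal (cmod (fourier ?f \<xi>) * cmod (?d \<xi>)) \<partial>lborel) \<le> ennreal (N / 2)"
    proof -
      have dle: "ennreal (cmod (fourier ?f \<xi>) * cmod (?d \<xi>))
          \<le> (\<integral>\<^sup>+\<sigma>. ennreal (indicator {0..\<tau>} \<sigma> * (cmod (fourier ?f \<xi>) * cmod (drift a \<mu> (\<rho> + a * \<sigma>) \<xi>))) \<partial>lborel)" for \<xi>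
      proof -
        let ?i = "\<lambda>\<sigma>. indicator {0..\<tau>} \<sigma> *\<^sub>R (exp (\<i> * of_real (\<sigma> * (1 - norm \<xi> powr a))) * drift a \<mu> (\<rho> + a * \<sigma>) \<xi>)"
        have mm: "(\<lambda>\<sigma>. drift a \<mu> (\<rho> + a * \<sigma>) \<xi>) \<in> borel_measurable borel"
          using measurable_compose[OF _ drift_measurable, of "\<lambda>\<sigma>. (\<sigma>, \<xi>)" borel] by simp
        have duh: "?d \<xi> = (LINT \<sigma>|lborel. ?i \<sigma>)"
          by (rule interaction_duhamel[where A = A]) (use adm \<tau> in auto)
        have "ennreal (cmod (?d \<xi>)) \<le> (\<integral>\<^sup>+\<sigma>. ennreal (cmod (?i \<sigma>)) \<partial>lborel)"
        proof (cases "integrable lborel ?i")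
          case True
          then show ?thesis
            unfolding duh by (rule integral_norm_bound_ennreal)
        next
          case False
          then show ?thesis
            unfolding duh by (simp add: not_integrable_integral_eq)
        qed
        also have "\<dots> = (\<integral>\<^sup>+\<sigma>. ennreal (indicator {0..\<tau>} \<sigma> * cmod (drift a \<mu> (\<rho> + a * \<sigma>) \<xi>)) \<partial>lborel)"
          by (simp add: norm_mult)
        finally have "ennreal (cmod (fourier ?f \<xi>)) * ennreal (cmod (?d \<xi>))
            \<le> ennreal (cmod (fourier ?f \<xi>)) * (\<integral>\<^sup>+\<sigma>. ennreal (indicator {0..\<tau>} \<sigma> * cmod (drift a \<mu> (\<rho> + a * \<sigma>) \<xi>)) \<partial>lborel)"
          by (rule mult_left_mono) simp
        also have "\<dots> = (\<integral>\<^sup>+\<sigma>. ennreal (cmod (fourier ?f \<xi>)) * ennreal (indicator {0..\<tau>} \<sigma> * cmod (drift a \<mu> (\<rho> + a * \<sigma>) \<xi>)) \<partial>lborel)"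
        proof (rule nn_integral_cmult[symmetric])
          show "(\<lambda>\<sigma>. ennreal (indicator {0..\<tau>} \<sigma> * cmod (drift a \<mu> (\<rho> + a * \<sigma>) \<xi>))) \<in> borel_measurable lborel"
            using mm by (simp add: borel_measurable_times borel_measurable_norm)
        qed
        finally show ?thesis by (simp add: ennreal_mult[symmetric] mult.left_commute)
      qed
      have "(\<integral>\<^sup>+\<xi>. ennreal (cmod (fourier ?f \<xi>) * cmod (?d \<xi>)) \<partial>lborel)
        \<le> (\<integral>\<^sup>+\<xi>. (\<integral>\<^sup>+\<sigma>. ennreal (indicator {0..\<tau>} \<sigma> * (cmod (fourier ?f \<xi>) * cmod (drift a \<mu> (\<rho> + a * \<sigma>) \<xi>))) \<partial>lborel) \<partial>lborel)"
        by (rule nn_integral_mono) (rule dle)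
      also have "\<dots> \<le> ennreal (\<tau> * (\<mu>\<^sup>2 * (N + KR * V) / 2))"
      proof (rule nn_integral_drift_le)
        show "energy (drift a \<mu> (\<rho> + a * \<sigma>) :: 'a \<Rightarrow> complex) \<le> ennreal (\<mu> ^ 4 * (KR * V))" if "\<sigma> \<in> {0..\<tau>}" for \<sigma>
          using KR(2)[OF adm[OF that]] unfolding drift_eq_residual[OF adm[OF that]] V_def by (simp add: mult.left_commute)
      qed (use N0 nnN KR(1) V \<mu> \<tau> in auto)
      also have "\<dots> \<le> ennreal (N / 2)"
      proof (rule ennreal_leI)
        have "KR * V = KR / (?C * c) * (?C * c * V)" using C c(1) by simp
        also have "\<dots> \<le> KR / (?C * c) * N" using KR(1) C c(1) by (intro mult_left_mono cN) auto
        finally have "N + KR * V \<le> (1 + KR / (?C * c)) * N" by (simp add: algebra_simps)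
        then have "\<tau> * \<mu>\<^sup>2 * (N + KR * V) \<le> c0 * ((1 + KR / (?C * c)) * N)"
          using small \<tau> c0 N0 KR(1) V by (intro mult_mono) auto
        also have "\<dots> = N"
        proof -
          have "1 + KR / (?C * c) > 0" using KR(1) c(1) C by (intro add_pos_nonneg) auto
          then show ?thesis by (simp add: c0_def)
        qed
        finally show "\<tau> * (\<mu>\<^sup>2 * (N + KR * V) / 2) \<le> N / 2" by (simp add: algebra_simps)
      qed
      finally show ?thesis .
    qed
    let ?P = "LINT y|lborel. dispersive a ?f y \<tau> * cnj (?h y)"
    have Plow: "c * V / 2 \<le> cmod ?P"
    proof -
      have int1: "integrable lborel (\<lambda>\<xi>. fourier ?f \<xi> * cnj (fourier ?f \<xi>))"
        and int2: "integrable lborel (\<lambda>\<xi>. fourier ?f \<xi> * cnj (?d \<xi>))"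
        by (rule prod, use intf in simp, rule prod, rule integrable_cnj[OF intd])
      \<comment> \<open>the phase of the evolution is absorbed into \<open>interaction\<close>, up to a constant phase\<close>
      have ph: "exp (\<i> * of_real (\<tau> * norm \<xi> powr a)) * fourier ?f \<xi> * cnj (fourier ?h \<xi>)
          = exp (\<i> * of_real \<tau>) * (fourier ?f \<xi> * cnj (fourier ?f \<xi>) + fourier ?f \<xi> * cnj (?d \<xi>))" for \<xi>
      proof -
        have "exp (\<i> * of_real \<tau>) * cnj (exp (\<i> * of_real (\<tau> * (1 - norm \<xi> powr a)))) = exp (\<i> * of_real (\<tau> * norm \<xi> powr a))"
          by (simp add: exp_cnj exp_add[symmetric] algebra_simps)
        then have "exp (\<i> * of_real (\<tau> * norm \<xi> powr a)) * cnj (fourier ?h \<xi>) = exp (\<i> * of_real \<tau>) * cnj (interaction a \<mu> \<rho> \<tau> \<xi>)"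
          unfolding interaction_def complex_cnj_mult by (metis mult.assoc)
        then show ?thesis by (simp add: algebra_simps)
      qed
      have "of_real ?C * ?P = (LINT \<xi>|lborel. exp (\<i> * of_real (\<tau> * norm \<xi> powr a)) * fourier ?f \<xi> * cnj (fourier ?h \<xi>))"
        by (subst fourier_pairing[OF intf _ hi]) (use C in auto)
      also have "\<dots> = exp (\<i> * of_real \<tau>) * (of_real N + (LINT \<xi>|lborel. fourier ?f \<xi> * cnj (?d \<xi>)))"
      proof -
        have "(LINT \<xi>|lborel. fourier ?f \<xi> * cnj (fourier ?f \<xi>)) = of_real N"
          unfolding ff N_def integral_complex_of_real ..
        then show ?thesis
          unfolding ph integral_mult_right_zero Bochner_Integration.integral_add[OF int1 int2] by (simp only:)
      qed
      finally have "cmod (of_real ?C * ?P) = cmod (exp (\<i> * of_real \<tau>) * (of_real N + (LINT \<xi>|lborel. fourier ?f \<xi> * cnj (?d \<xi>))))"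
        by (simp only:)
      then have "?C * cmod ?P = cmod (of_real N + (LINT \<xi>|lborel. fourier ?f \<xi> * cnj (?d \<xi>)))"
        unfolding norm_mult cmod_exp_imaginary norm_of_real abs_of_pos[OF C] by (simp only: mult_1_left)
      moreover have "cmod (of_real N + (LINT \<xi>|lborel. fourier ?f \<xi> * cnj (?d \<xi>))) \<ge> N - cmod (LINT \<xi>|lborel. fourier ?f \<xi> * cnj (?d \<xi>))"
        using norm_diff_ineq[of "complex_of_real N" "LINT \<xi>|lborel. fourier ?f \<xi> * cnj (?d \<xi>)"] N0 by simp
      moreover have "cmod (LINT \<xi>|lborel. fourier ?f \<xi> * cnj (?d \<xi>)) \<le> N / 2"
      proof -
        have "ennreal (cmod (LINT \<xi>|lborel. fourier ?f \<xi> * cnj (?d \<xi>))) \<le> (\<integral>\<^sup>+\<xi>. ennreal (cmod (fourier ?f \<xi> * cnj (?d \<xi>))) \<partial>lborel)"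
          by (rule integral_norm_bound_ennreal[OF int2])
        also have "\<dots> = (\<integral>\<^sup>+\<xi>. ennreal (cmod (fourier ?f \<xi>) * cmod (?d \<xi>)) \<partial>lborel)"
          by (simp only: norm_mult complex_mod_cnj)
        also have "\<dots> \<le> ennreal (N / 2)" by (rule delta)
        finally show ?thesis using N0 by simp
      qed
      ultimately have "?C * cmod ?P \<ge> N / 2" by linarith
      moreover have "?C * (c * V / 2) = (?C * c * V) / 2" by (simp only: mult.assoc times_divide_eq_right)
      ultimately have "?C * (c * V / 2) \<le> ?C * cmod ?P" using cN by linarith
      then show ?thesis by (rule mult_left_le_imp_le[OF _ C])
    qed
    let ?I = "indicator {y::'a. \<bar>norm y - (\<rho> + a * \<tau>)\<bar> \<le> 1 / \<mu>} :: 'a \<Rightarrow> ennreal"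
    let ?S = "\<lambda>y. ennreal (cmod (dispersive a ?f y \<tau>)) * ?I y"
    have Sm: "?S \<in> borel_measurable lborel"
      using dispersive_borel_measurable[of ?f a \<tau>] by measurable
    have "ennreal (cmod ?P) \<le> (\<integral>\<^sup>+y. ennreal (cmod (dispersive a ?f y \<tau> * cnj (?h y))) \<partial>lborel)"
    proof (cases "integrable lborel (\<lambda>y. dispersive a ?f y \<tau> * cnj (?h y))")
      case True
      then show ?thesis by (rule integral_norm_bound_ennreal)
    qed (simp add: not_integrable_integral_eq)
    also have "\<dots> = (\<integral>\<^sup>+y. ?S y * ennreal (cmod (?h y)) \<partial>lborel)"
    proof (rule nn_integral_cong)
      fix y :: 'a
      have "?h y = 0" if "\<not> \<bar>norm y - (\<rho> + a * \<tau>)\<bar> \<le> 1 / \<mu>"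
        using P adm1 that by (auto simp: wave_def packet_def)
      then show "ennreal (cmod (dispersive a ?f y \<tau> * cnj (?h y))) = ?S y * ennreal (cmod (?h y))"
        by (cases "\<bar>norm y - (\<rho> + a * \<tau>)\<bar> \<le> 1 / \<mu>") (simp_all add: norm_mult ennreal_mult)
    qed
    finally have "(ennreal (c * V / 2))\<^sup>2 \<le> (\<integral>\<^sup>+y. ?S y * ennreal (cmod (?h y)) \<partial>lborel)\<^sup>2"
      using Plow by (intro power_mono) (meson ennreal_leI order_trans, simp)
    also have "\<dots> \<le> (\<integral>\<^sup>+y. (?S y)\<^sup>2 \<partial>lborel) * (\<integral>\<^sup>+y. (ennreal (cmod (?h y)))\<^sup>2 \<partial>lborel)"
      by (rule Cauchy_Schwarz_nn_integral[OF Sm]) measurable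
    also have "(\<integral>\<^sup>+y. (ennreal (cmod (?h y)))\<^sup>2 \<partial>lborel) = energy ?h"
      by (simp add: ennreal_power)
    also have "(\<integral>\<^sup>+y. (?S y)\<^sup>2 \<partial>lborel) = (\<integral>\<^sup>+y. ennreal ((cmod (dispersive a ?f y \<tau>))\<^sup>2) * ?I y \<partial>lborel)" (is "_ = ?X")
      by (rule nn_integral_cong) (simp add: power_mult_distrib ennreal_power indicator_def)
    also have "?X * energy ?h \<le> ?X * ennreal ((KU + 1) * V)"
    proof (rule mult_left_mono)
      have "ennreal (KU * V) \<le> ennreal ((KU + 1) * V)" using V by (intro ennreal_leI mult_right_mono) auto
      then show "energy ?h \<le> ennreal ((KU + 1) * V)"
        using KU(2)[OF adm1] order_trans unfolding V_def by fastforce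
    qed simp
    finally have main: "(ennreal (c * V / 2))\<^sup>2 \<le> ?X * ennreal ((KU + 1) * V)" .
    show ?thesis
    proof (cases ?X)
      case (real x)
      then have "(c * V / 2)\<^sup>2 \<le> x * ((KU + 1) * V)"
        using main c(1) V KU(1) by (simp add: ennreal_power ennreal_mult[symmetric])
      moreover have "(c * V / 2)\<^sup>2 = ((c / 2)\<^sup>2 * V) * V" by (simp add: power2_eq_square)
      moreover have "x * ((KU + 1) * V) = (x * (KU + 1)) * V" by (simp only: mult.assoc)
      ultimately have "(c / 2)\<^sup>2 * V \<le> x * (KU + 1)"
        using mult_right_le_imp_le[OF _ V] by (simp only:)
      then have "c1 * V \<le> x" using KU(1) by (simp add: c1_def divide_le_eq)
      then show ?thesis unfolding real V_def[symmetric] by (rule ennreal_leI)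
    qed simp
  qed
  show ?thesis by (rule that[OF c0 c1 claim])
qed

section \<open>Dilation and the growth of the maximal function\<close>

lemma deriv_chain_exp: "deriv_chain (\<lambda>j r. c ^ j * exp (c * complex_of_real r)) UNIV"
  unfolding deriv_chain_def
proof (intro allI ballI)
  fix j and r :: real
  have "((\<lambda>r. c * complex_of_real r) has_vector_derivative c * of_real 1) (at r)"
    by (intro has_vector_derivative_mult_right has_vector_derivative_of_real DERIV_ident)
  from field_vector_diff_chain_at[OF this DERIV_exp]
  have "((\<lambda>r. exp (c * complex_of_real r)) has_vector_derivative c * exp (c * complex_of_real r)) (at r)"
    by (simp add: o_def)
  from has_vector_derivative_mult_right[OF this, of "c ^ j"]
  show "((\<lambda>r. c ^ j * exp (c * complex_of_real r)) has_vector_derivative c ^ Suc j * exp (c * complex_of_real r)) (at r)"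
    by (simp add: ac_simps)
qed

lemma deriv_chain_bump: "deriv_chain (\<lambda>j r. complex_of_real (m ^ j * bump j (m * r - b))) UNIV"
  unfolding deriv_chain_def
proof (intro allI ballI)
  fix j and r :: real
  have g: "((\<lambda>r. m * r - b) has_real_derivative m) (at r)" by (auto intro!: derivative_eq_intros)
  have "((\<lambda>r. m ^ j * bump j (m * r - b)) has_real_derivative m ^ j * (bump (Suc j) (m * r - b) * m)) (at r)"
    by (intro DERIV_cmult DERIV_chain2[OF bump_has_derivative g])
  from has_vector_derivative_of_real[OF this]
  show "((\<lambda>r. complex_of_real (m ^ j * bump j (m * r - b))) has_vector_derivative
      complex_of_real (m ^ Suc j * bump (Suc j) (m * r - b))) (at r)"
    by (simp add: ac_simps)
qed

text \<open>
  Away from the origin the function is a composite of smooth functions of one variable with the norm, and near the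
  origin it is zero.
\<close>

lemma dilated_packet_test_function:
  assumes adm: "adm A \<mu> \<rho>" and N: "N > 0"
  defines "f \<equiv> \<lambda>x::'a::euclidean_space. wave (bump_packet \<mu> \<rho>) (N *\<^sub>R x)"
  shows "f \<in> test_functions (UNIV - {0})" "radial f"
proof -
  have \<mu>: "\<mu> > 0" using adm by (simp add: adm_def)
  define r where "r = 1 / \<mu>\<^sup>2 / N"
  define R where "R = (A + 1) / \<mu>\<^sup>2 / N"
  have r: "r > 0" using \<mu> N by (simp add: r_def)
  have zero: "f x = 0" if "norm x < r \<or> norm x > R" for x
  proof -
    have "norm (N *\<^sub>R x) < 1 / \<mu>\<^sup>2 \<or> norm (N *\<^sub>R x) > (A + 1) / \<mu>\<^sup>2"
    proof -
      have "N * r = 1 / \<mu>\<^sup>2" "N * R = (A + 1) / \<mu>\<^sup>2" using N by (simp_all add: r_def R_def)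
      then show ?thesis
        using that N mult_strict_left_mono[of "norm x" r N] mult_strict_left_mono[of R "norm x" N] by auto
    qed
    then show ?thesis
      using packet_zero[OF packet_bump_packet adm] by (simp add: f_def wave_def)
  qed
  have eq: "f x = exp (- (\<i> * of_real N) * of_real (norm x)) * of_real (bump 0 (\<mu> * N * norm x - \<mu> * \<rho>))" for x
    using N by (simp add: f_def wave_def bump_packet_def algebra_simps)
  have "C_k_diff k f" for k
  proof -
    have U: "open (UNIV - {0::'a})" by auto
    have "C_k_on k (UNIV - {0::'a}) (\<lambda>x. exp (- (\<i> * of_real N) * of_real (norm x)))"
      using C_k_on_chain_compose[where k = k and j = 0, OF U deriv_chain_exp[of "- (\<i> * of_real N)"] C_k_on_norm] by simp
    moreover have "C_k_on k (UNIV - {0::'a}) (\<lambda>x. complex_of_real (bump 0 (\<mu> * N * norm x - \<mu> * \<rho>)))"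
      using C_k_on_chain_compose[where k = k and j = 0, OF U deriv_chain_bump[of "\<mu> * N" "\<mu> * \<rho>"] C_k_on_norm] by simp
    ultimately have 1: "C_k_on k (UNIV - {0}) f"
      unfolding eq[abs_def] by (rule bounded_bilinear.C_k_on_prod[OF bounded_bilinear_mult U])
    have "C_k_on k (ball 0 r) (\<lambda>x::'a. 0 :: complex)" by (intro C_k_on_const) auto
    then have 2: "C_k_on k (ball 0 r) f"
      by (subst C_k_on_cong[of _ _ "\<lambda>x. 0"]) (auto intro: zero)
    have "C_k_on k ((UNIV - {0}) \<union> ball 0 r) f" by (rule C_k_on_Un[OF U _ 1 2]) auto
    moreover have "(UNIV - {0}) \<union> ball 0 r = (UNIV :: 'a set)" using r by auto
    ultimately show ?thesis by (simp add: C_k_on_UNIV)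
  qed
  moreover have sub: "supp f \<subseteq> cball 0 R - ball 0 r"
    unfolding supp_def
  proof (rule closure_minimal)
    show "{x. f x \<noteq> 0} \<subseteq> cball 0 R - ball 0 r"
    proof
      fix x assume "x \<in> {x. f x \<noteq> 0}"
      then have "\<not> (norm x < r \<or> norm x > R)" using zero by blast
      then show "x \<in> cball 0 R - ball 0 r" by auto
    qed
  qed auto
  moreover have "compact (supp f)"
    unfolding compact_eq_bounded_closed
    using sub bounded_subset[OF bounded_cball, of "supp f" 0 R] by (auto simp: supp_def)
  ultimately show "f \<in> test_functions (UNIV - {0})"
    using r by (auto simp: test_functions_def smooth_def)
  show "radial f" by (simp add: radial_def eq)
qed

lemma dispersive_dilate:
  fixes g :: "'a::euclidean_space \<Rightarrow> complex"
  assumes [measurable]: "g \<in> borel_measurable borel" and N: "N > 0"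
  shows "dispersive a (\<lambda>x. g (N *\<^sub>R x)) x t = dispersive a g (N *\<^sub>R x) (N powr a * t)"
proof -
  let ?d = "complex_of_real (N ^ DIM('a))"
  have "(LINT \<xi>|lborel. exp (\<i> * of_real (x \<bullet> \<xi> + t * norm \<xi> powr a)) * fourier (\<lambda>x. g (N *\<^sub>R x)) \<xi>)
      = (LINT \<xi>|lborel. exp (\<i> * of_real (x \<bullet> \<xi> + t * norm \<xi> powr a)) * (fourier g (\<xi> /\<^sub>R N) / ?d))"
    by (simp only: fourier_scale[OF assms])
  also have "\<dots> = ?d * (LINT \<eta>|lborel. exp (\<i> * of_real (x \<bullet> (N *\<^sub>R \<eta>) + t * norm (N *\<^sub>R \<eta>) powr a)) * (fourier g ((N *\<^sub>R \<eta>) /\<^sub>R N) / ?d))"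
    by (rule integral_scale[OF _ N]) measurable
  also have "\<dots> = ?d * (LINT \<eta>|lborel. 1 / ?d * (exp (\<i> * of_real ((N *\<^sub>R x) \<bullet> \<eta> + N powr a * t * norm \<eta> powr a)) * fourier g \<eta>))"
    using N by (simp add: powr_mult ac_simps)
  also have "\<dots> = (LINT \<eta>|lborel. exp (\<i> * of_real ((N *\<^sub>R x) \<bullet> \<eta> + N powr a * t * norm \<eta> powr a)) * fourier g \<eta>)"
    using N by (subst integral_mult_right_zero) simp
  finally show ?thesis by (simp only: dispersive_def)
qed

text \<open>
  Since \<open>1 + N\<^sup>2 * r\<^sup>2 \<le> N\<^sup>2 * (1 + r\<^sup>2)\<close>, a dilation by \<open>N \<ge> 1\<close> costs \<open>N powr s'\<close> in the norm besides the change of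
  volume. The larger exponent \<open>s'\<close> is nonnegative, as this step requires.
\<close>

lemma sobolev_dilate_le:
  fixes g :: "'a::euclidean_space \<Rightarrow> complex"
  assumes [measurable]: "g \<in> borel_measurable borel" and N: "N \<ge> 1" and s: "s \<le> s'" "s' \<ge> 0"
  shows "(sobolev_norm s (\<lambda>x. g (N *\<^sub>R x)))\<^sup>2
    \<le> ennreal (N powr (2 * s') / N ^ DIM('a)) * (\<integral>\<^sup>+\<xi>. ennreal ((1 + (norm \<xi>)\<^sup>2) powr s' * (cmod (fourier g \<xi>))\<^sup>2) \<partial>lborel)"
proof -
  have N0: "N > 0" using N by simp
  let ?d = "N ^ DIM('a)"
  have d: "?d > 0" using N0 by simp
  have "(sobolev_norm s (\<lambda>x. g (N *\<^sub>R x)))\<^sup>2 = (\<integral>\<^sup>+\<xi>. ennreal ((1 + (norm \<xi>)\<^sup>2) powr s * (cmod (fourier g (\<xi> /\<^sub>R N) / of_real ?d))\<^sup>2) \<partial>lborel)"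
    unfolding sobolev_norm_def esqrt_power2 by (simp only: fourier_scale[OF assms(1) N0])
  also have "\<dots> = ennreal ?d * (\<integral>\<^sup>+\<eta>. ennreal ((1 + (norm (N *\<^sub>R \<eta>::'a))\<^sup>2) powr s * (cmod (fourier g ((N *\<^sub>R \<eta>) /\<^sub>R N) / of_real ?d))\<^sup>2) \<partial>lborel)"
    by (rule nn_integral_scale[OF _ N0]) measurable
  also have "\<dots> \<le> ennreal ?d * (\<integral>\<^sup>+\<eta>. ennreal (N powr (2 * s') / ?d\<^sup>2) * ennreal ((1 + (norm \<eta>)\<^sup>2) powr s' * (cmod (fourier g \<eta>))\<^sup>2) \<partial>lborel)"
  proof (intro mult_left_mono nn_integral_mono)
    fix \<eta> :: 'a
    have "(1 + (norm (N *\<^sub>R \<eta>))\<^sup>2) powr s \<le> (1 + (norm (N *\<^sub>R \<eta>))\<^sup>2) powr s'"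
      using s by (intro powr_mono) auto
    also have "\<dots> \<le> (N\<^sup>2 * (1 + (norm \<eta>)\<^sup>2)) powr s'"
      using s N by (intro powr_mono2) (auto simp: power_mult_distrib algebra_simps)
    also have "\<dots> = (N\<^sup>2) powr s' * (1 + (norm \<eta>)\<^sup>2) powr s'"
      by (rule powr_mult)
    also have "(N\<^sup>2) powr s' = N powr (2 * s')"
      using N0 powr_powr[of N 2 s'] by simp
    finally have "(1 + (norm (N *\<^sub>R \<eta>))\<^sup>2) powr s * (cmod (fourier g \<eta>) / ?d)\<^sup>2
        \<le> N powr (2 * s') * (1 + (norm \<eta>)\<^sup>2) powr s' * (cmod (fourier g \<eta>) / ?d)\<^sup>2"
      by (rule mult_right_mono) simp
    also have "\<dots> = N powr (2 * s') / ?d\<^sup>2 * ((1 + (norm \<eta>)\<^sup>2) powr s' * (cmod (fourier g \<eta>))\<^sup>2)"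
      by (simp add: power_divide)
    finally have "ennreal ((1 + (norm (N *\<^sub>R \<eta>))\<^sup>2) powr s * (cmod (fourier g \<eta>) / ?d)\<^sup>2)
        \<le> ennreal (N powr (2 * s') / ?d\<^sup>2) * ennreal ((1 + (norm \<eta>)\<^sup>2) powr s' * (cmod (fourier g \<eta>))\<^sup>2)"
      by (subst ennreal_mult[symmetric]) (auto intro!: ennreal_leI)
    moreover have "cmod (fourier g ((N *\<^sub>R \<eta>) /\<^sub>R N) / of_real ?d) = cmod (fourier g \<eta>) / ?d"
      using N0 by (simp add: norm_divide norm_power)
    ultimately show "ennreal ((1 + (norm (N *\<^sub>R \<eta>))\<^sup>2) powr s * (cmod (fourier g ((N *\<^sub>R \<eta>) /\<^sub>R N) / of_real ?d))\<^sup>2)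
      \<le> ennreal (N powr (2 * s') / ?d\<^sup>2) * ennreal ((1 + (norm \<eta>)\<^sup>2) powr s' * (cmod (fourier g \<eta>))\<^sup>2)"
      by simp
  qed simp
  also have "\<dots> = ennreal ?d * (ennreal (N powr (2 * s') / ?d\<^sup>2) * (\<integral>\<^sup>+\<eta>. ennreal ((1 + (norm (\<eta>::'a))\<^sup>2) powr s' * (cmod (fourier g \<eta>))\<^sup>2) \<partial>lborel))"
    by (subst nn_integral_cmult) auto
  also have "\<dots> = ennreal (N powr (2 * s') / ?d) * (\<integral>\<^sup>+\<eta>. ennreal ((1 + (norm (\<eta>::'a))\<^sup>2) powr s' * (cmod (fourier g \<eta>))\<^sup>2) \<partial>lborel)"
  proof -
    have "ennreal ?d * ennreal (N powr (2 * s') / ?d\<^sup>2) = ennreal (N powr (2 * s') / ?d)"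
      using d by (subst ennreal_mult[symmetric]) (auto simp: power2_eq_square)
    then show ?thesis by (simp only: mult.assoc[symmetric])
  qed
  finally show ?thesis .
qed

text \<open>
  At any point only one of the disjoint sets can contribute, so a sum over different times is still dominated by the
  supremum over time. This is the gain of the maximal function over a single time.
\<close>

lemma sum_disjoint_le_SUP:
  fixes F :: "'b \<Rightarrow> ennreal"
  assumes fin: "finite I" and t: "\<And>i. i \<in> I \<Longrightarrow> t i \<in> T" and disj: "\<And>i j. i \<in> I \<Longrightarrow> j \<in> I \<Longrightarrow> i \<noteq> j \<Longrightarrow> B i \<inter> B j = {}"
  shows "(\<Sum>i\<in>I. F (t i) * indicator (B i) y) \<le> (SUP u\<in>T. F u)"
proof (cases "\<exists>i\<in>I. y \<in> B i")
  case True
  then obtain i where i: "i \<in> I" "y \<in> B i" by blast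
  have "(\<Sum>j\<in>I. F (t j) * indicator (B j) y) = (\<Sum>j\<in>I. if j = i then F (t i) else 0)"
    by (rule sum.cong) (use i disj in \<open>auto simp: indicator_def\<close>)
  also have "\<dots> = F (t i)" using fin i by simp
  also have "\<dots> \<le> (SUP u\<in>T. F u)" by (rule SUP_upper[OF t[OF i(1)]])
  finally show ?thesis .
next
  case False
  then have "(\<Sum>i\<in>I. F (t i) * indicator (B i) y) = 0" by (intro sum.neutral) (auto simp: indicator_def)
  then show ?thesis by simp
qed

text \<open>
  The dilation by \<open>N\<close> turns \<open>\<bar>t\<bar> < 1\<close> into \<open>\<bar>\<tau>\<bar> < c0 / \<mu>\<^sup>2\<close>, the time for which \<open>packet_mass_at_time\<close> is valid. In
  this time the packet travels a distance of order \<open>1/\<mu>\<^sup>2\<close> through about \<open>1/\<mu>\<close> disjoint shells, each of which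
  contributes a multiple of \<open>shell_size\<close>.
\<close>

lemma maximal_function_lower:
  fixes a :: real
  assumes a: "a > 0"
  obtains c0 c :: real where "c0 > 0" "c0 \<le> 1" "c > 0"
    and "\<And>\<mu> N. 0 < \<mu> \<Longrightarrow> \<mu> \<le> 1 \<Longrightarrow> 0 < N \<Longrightarrow> N powr a = c0 / \<mu>\<^sup>2 \<Longrightarrow>
     ennreal (c / \<mu> * shell_size DIM('a) \<mu> / N ^ DIM('a))
     \<le> (\<integral>\<^sup>+ x. (SUP t\<in>{t. \<bar>t\<bar> < 1}. ennreal ((cmod (dispersive a (\<lambda>x::'a::euclidean_space. wave (bump_packet \<mu> (3 / \<mu>\<^sup>2)) (N *\<^sub>R x)) x t))\<^sup>2)) \<partial>lborel)"
proof -
  define A where "A = 3 + a"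
  have A: "A \<ge> 0" using a by (simp add: A_def)
  show ?thesis
  proof (rule packet_mass_at_time[OF a A, where 'a = 'a])
    fix d0 c1 :: real
    assume d0: "d0 > 0" and c1: "c1 > 0"
      and mass: "\<And>\<mu> \<rho> \<tau>. 0 \<le> \<tau> \<Longrightarrow> \<tau> * \<mu>\<^sup>2 \<le> d0 \<Longrightarrow> (\<And>\<sigma>. \<sigma> \<in> {0..\<tau>} \<Longrightarrow> adm A \<mu> (\<rho> + a * \<sigma>)) \<Longrightarrow>
        ennreal (c1 * shell_size DIM('a) \<mu>)
       \<le> (\<integral>\<^sup>+y. ennreal ((cmod (dispersive a (wave (bump_packet \<mu> \<rho>)) (y::'a) \<tau>))\<^sup>2)
             * indicator {y. \<bar>norm y - (\<rho> + a * \<tau>)\<bar> \<le> 1 / \<mu>} y \<partial>lborel)"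
    define c0 where "c0 = min d0 1"
    have c0: "c0 > 0" "c0 \<le> 1" "c0 \<le> d0" using d0 by (auto simp: c0_def)
    define c where "c = a * c0 / 3 * c1"
    have c: "c > 0" using a c0 c1 by (simp add: c_def)
    have claim: "ennreal (c / \<mu> * shell_size DIM('a) \<mu> / N ^ DIM('a))
       \<le> (\<integral>\<^sup>+ x. (SUP t\<in>{t. \<bar>t\<bar> < 1}. ennreal ((cmod (dispersive a (\<lambda>x::'a. wave (bump_packet \<mu> (3 / \<mu>\<^sup>2)) (N *\<^sub>R x)) x t))\<^sup>2)) \<partial>lborel)"
      if \<mu>: "0 < \<mu>" "\<mu> \<le> 1" and N: "0 < N" and Na: "N powr a = c0 / \<mu>\<^sup>2" for \<mu> N
    proof -
      let ?d = "N ^ DIM('a)"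
      have d: "?d > 0" using N by simp
      define V where "V = shell_size DIM('a) \<mu>"
      have V: "V > 0" using \<mu> shell_size_pos by (simp add: V_def)
      define \<rho> where "\<rho> = 3 / \<mu>\<^sup>2"
      \<comment> \<open>the number of times \<open>\<tau> j\<close> below \<open>c0 / \<mu>\<^sup>2\<close>; the radii at consecutive times differ by \<open>3/\<mu>\<close>,
         more than the full width \<open>2/\<mu>\<close> of a closed shell\<close>
      define J where "J = nat \<lceil>a * c0 / (3 * \<mu>)\<rceil>"
      define \<tau> where "\<tau> j = 3 * real j / (a * \<mu>)" for j :: nat
      have \<tau>: "0 \<le> \<tau> j" "\<tau> j < c0 / \<mu>\<^sup>2" if "j < J" for j
      proof -
        show "0 \<le> \<tau> j" using a \<mu> by (simp add: \<tau>_def)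
        have "real j < a * c0 / (3 * \<mu>)" using that unfolding J_def by linarith
        then show "\<tau> j < c0 / \<mu>\<^sup>2" using a \<mu> by (simp add: \<tau>_def field_simps power2_eq_square)
      qed
      have adm: "adm A \<mu> (\<rho> + a * \<sigma>)" if "j < J" "\<sigma> \<in> {0..\<tau> j}" for j \<sigma>
      proof -
        have "c0 / \<mu>\<^sup>2 \<le> 1 / \<mu>\<^sup>2" using c0 by (intro divide_right_mono) auto
        then have "0 \<le> \<sigma>" "\<sigma> \<le> 1 / \<mu>\<^sup>2" using that \<tau>(2)[OF that(1)] by auto
        then have "0 \<le> a * \<sigma>" "a * \<sigma> \<le> a * (1 / \<mu>\<^sup>2)"
          using a mult_left_mono[of \<sigma> "1 / \<mu>\<^sup>2" a] by simp_all
        moreover have "A / \<mu>\<^sup>2 = 3 / \<mu>\<^sup>2 + a * (1 / \<mu>\<^sup>2)" by (simp add: A_def add_divide_distrib)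
        ultimately show ?thesis using \<mu> by (simp add: adm_def \<rho>_def)
      qed
      have adm0: "adm A \<mu> \<rho>"
      proof -
        have "3 / \<mu>\<^sup>2 \<le> A / \<mu>\<^sup>2" using a by (intro divide_right_mono) (auto simp: A_def)
        then show ?thesis using \<mu> by (simp add: adm_def \<rho>_def)
      qed
      let ?g = "wave (bump_packet \<mu> \<rho>) :: 'a \<Rightarrow> complex"
      have gm: "?g \<in> borel_measurable borel" by (rule packet_wave_measurable[OF packet_bump_packet adm0])
      let ?B = "\<lambda>j. {y::'a. \<bar>norm y - (\<rho> + a * \<tau> j)\<bar> \<le> 1 / \<mu>}"
      let ?u = "\<lambda>j y. ennreal ((cmod (dispersive a ?g y (\<tau> j)))\<^sup>2) * indicator (?B j) y"
      have um: "?u j \<in> borel_measurable borel" for j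
      proof -
        note [measurable] = dispersive_borel_measurable[OF gm, of a "\<tau> j"]
        show ?thesis by measurable
      qed
      have disj: "?B i \<inter> ?B j = {}" if "i \<noteq> j" for i j
      proof -
        have center: "a * \<tau> i = 3 / \<mu> * real i" for i using a \<mu> by (simp add: \<tau>_def)
        have "\<bar>real i - real j\<bar> \<ge> 1" using that by linarith
        then have "3 / \<mu> * 1 \<le> 3 / \<mu> * \<bar>real i - real j\<bar>" using \<mu> by (intro mult_left_mono) auto
        also have "\<dots> = \<bar>3 / \<mu> * (real i - real j)\<bar>"
          unfolding abs_mult using \<mu> by (simp only: abs_of_pos[OF divide_pos_pos[OF zero_less_numeral]])
        also have "3 / \<mu> * (real i - real j) = a * \<tau> i - a * \<tau> j" unfolding center by (rule right_diff_distrib)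
        finally have far: "\<bar>a * \<tau> i - a * \<tau> j\<bar> \<ge> 3 / \<mu>" by simp
        have False if "\<bar>norm y - (\<rho> + a * \<tau> i)\<bar> \<le> 1 / \<mu>" "\<bar>norm y - (\<rho> + a * \<tau> j)\<bar> \<le> 1 / \<mu>" for y :: 'a
        proof -
          have "\<bar>a * \<tau> i - a * \<tau> j\<bar> \<le> \<bar>norm y - (\<rho> + a * \<tau> i)\<bar> + \<bar>norm y - (\<rho> + a * \<tau> j)\<bar>" by linarith
          then have "3 / \<mu> \<le> 2 / \<mu>" using far that by linarith
          then show False using \<mu> by (simp add: divide_le_cancel)
        qed
        then show ?thesis by blast
      qed
      have low: "(\<Sum>j<J. ?u j (N *\<^sub>R x)) \<le> (SUP t\<in>{t. \<bar>t\<bar> < 1}. ennreal ((cmod (dispersive a (\<lambda>x. ?g (N *\<^sub>R x)) x t))\<^sup>2))" for x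
      proof -
        have "(\<Sum>j<J. ennreal ((cmod (dispersive a (\<lambda>x. ?g (N *\<^sub>R x)) x (\<tau> j / N powr a)))\<^sup>2) * indicator (?B j) (N *\<^sub>R x))
            \<le> (SUP t\<in>{t. \<bar>t\<bar> < 1}. ennreal ((cmod (dispersive a (\<lambda>x. ?g (N *\<^sub>R x)) x t))\<^sup>2))"
        proof (rule sum_disjoint_le_SUP)
          show "\<tau> j / N powr a \<in> {t. \<bar>t\<bar> < 1}" if "j \<in> {..<J}" for j
            using \<tau>[of j] that N by (simp add: Na[symmetric])
        qed (use disj in auto)
        moreover have "dispersive a (\<lambda>x. ?g (N *\<^sub>R x)) x (\<tau> j / N powr a) = dispersive a ?g (N *\<^sub>R x) (\<tau> j)" for j
          using N by (simp add: dispersive_dilate[OF gm N])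
        ultimately show ?thesis by simp
      qed
      have mj: "ennreal (c1 * V / ?d) \<le> (\<integral>\<^sup>+x. ?u j (N *\<^sub>R x) \<partial>lborel)" if j: "j < J" for j
      proof -
        have "\<tau> j * \<mu>\<^sup>2 \<le> c0 / \<mu>\<^sup>2 * \<mu>\<^sup>2" using \<tau>(2)[OF j] by (intro mult_right_mono) auto
        then have small: "\<tau> j * \<mu>\<^sup>2 \<le> d0" using \<mu> c0 by simp
        have "ennreal (c1 * V) \<le> (\<integral>\<^sup>+y. ?u j y \<partial>lborel)"
          unfolding V_def by (rule mass[OF \<tau>(1)[OF j] small adm[OF j]])
        also have "\<dots> = ennreal ?d * (\<integral>\<^sup>+x. ?u j (N *\<^sub>R x) \<partial>lborel)"
          by (rule nn_integral_scale[OF um N])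
        finally have "ennreal (1 / ?d) * ennreal (c1 * V) \<le> ennreal (1 / ?d) * (ennreal ?d * (\<integral>\<^sup>+x. ?u j (N *\<^sub>R x) \<partial>lborel))"
          by (rule mult_left_mono) simp
        moreover have "ennreal (1 / ?d) * ennreal (c1 * V) = ennreal (c1 * V / ?d)"
          using d c1 V by (subst ennreal_mult[symmetric]) auto
        moreover have "ennreal (1 / ?d) * ennreal ?d = 1"
          using N by (subst ennreal_mult[symmetric]) auto
        ultimately show ?thesis by (simp only: mult.assoc[symmetric] mult_1_left)
      qed
      have "c / \<mu> * V / ?d = a * c0 / (3 * \<mu>) * (c1 * V / ?d)" by (simp add: c_def)
      also have "\<dots> \<le> real J * (c1 * V / ?d)"
      proof (rule mult_right_mono)
        show "a * c0 / (3 * \<mu>) \<le> real J" unfolding J_def by linarith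
      qed (use c1 V d in simp)
      finally have "ennreal (c / \<mu> * V / ?d) \<le> ennreal (real J * (c1 * V / ?d))" by (rule ennreal_leI)
      also have "\<dots> = (\<Sum>j<J. ennreal (c1 * V / ?d))"
        unfolding sum_constant card_lessThan ennreal_of_nat_eq_real_of_nat
        by (rule ennreal_mult) (use c1 V d in simp_all)
      also have "\<dots> \<le> (\<Sum>j<J. \<integral>\<^sup>+x. ?u j (N *\<^sub>R x) \<partial>lborel)"
        by (intro sum_mono mj) auto
      also have "\<dots> = (\<integral>\<^sup>+x. (\<Sum>j<J. ?u j (N *\<^sub>R x)) \<partial>lborel)"
        by (rule nn_integral_sum[symmetric]) (use measurable_compose[OF _ um, of "\<lambda>x. N *\<^sub>R x"] in measurable)
      also have "\<dots> \<le> (\<integral>\<^sup>+ x. (SUP t\<in>{t. \<bar>t\<bar> < 1}. ennreal ((cmod (dispersive a (\<lambda>x. ?g (N *\<^sub>R x)) x t))\<^sup>2)) \<partial>lborel)"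
        by (rule nn_integral_mono) (rule low)
      finally show ?thesis unfolding V_def \<rho>_def .
    qed
    show ?thesis by (rule that[OF c0(1,2) c claim])
  qed
qed

theorem theoremB:
  fixes a s :: real
  assumes "a > 0" and "a \<noteq> 1"
    and "CARD('n::finite) \<ge> 2"
    and "\<exists>C::real. \<forall>f :: real ^ 'n \<Rightarrow> complex.
           f \<in> test_functions (UNIV - {0}) \<and> radial f \<longrightarrow>
           esqrt (\<integral>\<^sup>+ x. (SUP t\<in>{t. \<bar>t\<bar> < 1}. ennreal ((cmod (dispersive a f x t))\<^sup>2)) \<partial>lborel)
             \<le> ennreal C * sobolev_norm s f"
  shows "s \<ge> a / 4"
proof (rule ccontr)
  assume "\<not> s \<ge> a / 4"
  \<comment> \<open>Sobolev norms increase with the exponent, so the estimate persists for \<open>s'\<close>\<close>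
  define s' where "s' = max s 0"
  have s': "s \<le> s'" "s' \<ge> 0" "s' < a / 4" using \<open>\<not> s \<ge> a / 4\<close> assms(1) by (auto simp: s'_def)
  let ?n = "DIM(real ^ 'n)"
  define A where "A = 3 + a"
  have A: "A \<ge> 0" using assms(1) by (simp add: A_def)
  obtain C0 where C0: "\<And>f :: real ^ 'n \<Rightarrow> complex. f \<in> test_functions (UNIV - {0}) \<Longrightarrow> radial f \<Longrightarrow>
           esqrt (\<integral>\<^sup>+ x. (SUP t\<in>{t. \<bar>t\<bar> < 1}. ennreal ((cmod (dispersive a f x t))\<^sup>2)) \<partial>lborel)
             \<le> ennreal C0 * sobolev_norm s f"
    using assms(4) by blast
  define C where "C = max C0 0"
  have C: "C \<ge> 0" "ennreal C0 = ennreal C" by (auto simp: C_def max_def ennreal_neg)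
  show False
  proof (rule maximal_function_lower[OF assms(1), where 'a = "real ^ 'n"])
    fix c0 c :: real
    assume c0: "c0 > 0" "c0 \<le> 1" and c: "c > 0" and low: "\<And>\<mu> N. 0 < \<mu> \<Longrightarrow> \<mu> \<le> 1 \<Longrightarrow> 0 < N \<Longrightarrow> N powr a = c0 / \<mu>\<^sup>2 \<Longrightarrow>
       ennreal (c / \<mu> * shell_size ?n \<mu> / N ^ ?n)
       \<le> (\<integral>\<^sup>+ x. (SUP t\<in>{t. \<bar>t\<bar> < 1}. ennreal ((cmod (dispersive a (\<lambda>x::real ^ 'n. wave (bump_packet \<mu> (3 / \<mu>\<^sup>2)) (N *\<^sub>R x)) x t))\<^sup>2)) \<partial>lborel)"
    obtain K where K: "K \<ge> 0" "\<And>\<mu> \<rho>. adm A \<mu> \<rho> \<Longrightarrow>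
      (\<integral>\<^sup>+\<xi>. ennreal ((1 + (norm \<xi>)\<^sup>2) powr s' * (cmod (fourier (wave (bump_packet \<mu> \<rho>)) (\<xi>::real ^ 'n)))\<^sup>2) \<partial>lborel)
        \<le> ennreal (K * shell_size ?n \<mu>)"
      using sobolev_packet_upper[OF s'(2) A, where 'a = "real ^ 'n"] by blast
    define e where "e = 1 - 4 * s' / a"
    have e: "e > 0" using s'(3) assms(1) by (simp add: e_def field_simps)
    define M where "M = C\<^sup>2 * K * c0 powr (2 * s' / a)"
    have key: "c \<le> M * \<mu> powr e" if \<mu>: "0 < \<mu>" "\<mu> \<le> sqrt c0" for \<mu>
    proof -
      have \<mu>1: "\<mu> \<le> 1" using \<mu> c0 by (meson order_trans real_sqrt_le_1_iff)
      have "\<mu>\<^sup>2 \<le> c0" using \<mu> c0 by (metis less_imp_le power_mono real_sqrt_pow2)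
      then have L: "1 \<le> c0 / \<mu>\<^sup>2" using \<mu> by simp
      \<comment> \<open>the dilation for which the interval \<open>\<bar>t\<bar> < 1\<close> becomes the lifetime of the packet\<close>
      define N where "N = (c0 / \<mu>\<^sup>2) powr (1 / a)"
      have N: "N \<ge> 1" "N powr a = c0 / \<mu>\<^sup>2"
        using L assms(1) c0(1) by (auto simp: N_def powr_powr intro!: ge_one_powr_ge_zero)
      have N0: "N > 0" using N by simp
      define V where "V = shell_size ?n \<mu>"
      have V: "V > 0" using \<mu> shell_size_pos by (simp add: V_def)
      have d: "N ^ ?n > 0" using N0 by simp
      have adm: "adm A \<mu> (3 / \<mu>\<^sup>2)"
      proof -
        have "3 / \<mu>\<^sup>2 \<le> A / \<mu>\<^sup>2" using assms(1) by (intro divide_right_mono) (auto simp: A_def)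
        then show ?thesis using \<mu> \<mu>1 by (simp add: adm_def)
      qed
      let ?g = "wave (bump_packet \<mu> (3 / \<mu>\<^sup>2)) :: real ^ 'n \<Rightarrow> complex"
      have gm: "?g \<in> borel_measurable borel" by (rule packet_wave_measurable[OF packet_bump_packet adm])
      let ?f = "\<lambda>x. ?g (N *\<^sub>R x)"
      let ?X = "\<integral>\<^sup>+ x. (SUP t\<in>{t. \<bar>t\<bar> < 1}. ennreal ((cmod (dispersive a ?f x t))\<^sup>2)) \<partial>lborel"
      have "?X = (esqrt ?X)\<^sup>2" by (rule esqrt_power2[symmetric])
      also have "\<dots> \<le> (ennreal C * sobolev_norm s ?f)\<^sup>2"
        using C0[OF dilated_packet_test_function[OF adm N0]] unfolding C(2) by (intro power_mono) auto
      also have "\<dots> = ennreal (C\<^sup>2) * (sobolev_norm s ?f)\<^sup>2"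
        using C(1) by (simp add: power_mult_distrib ennreal_power)
      also have "\<dots> \<le> ennreal (C\<^sup>2) * (ennreal (N powr (2 * s') / N ^ ?n) * ennreal (K * V))"
      proof (rule mult_left_mono)
        have "(sobolev_norm s ?f)\<^sup>2 \<le> ennreal (N powr (2 * s') / N ^ ?n) * (\<integral>\<^sup>+\<xi>. ennreal ((1 + (norm \<xi>)\<^sup>2) powr s' * (cmod (fourier ?g \<xi>))\<^sup>2) \<partial>lborel)"
          by (rule sobolev_dilate_le[OF gm N(1) s'(1,2)])
        also have "\<dots> \<le> ennreal (N powr (2 * s') / N ^ ?n) * ennreal (K * V)"
          unfolding V_def by (intro mult_left_mono K(2) adm) simp
        finally show "(sobolev_norm s ?f)\<^sup>2 \<le> ennreal (N powr (2 * s') / N ^ ?n) * ennreal (K * V)" .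
      qed simp
      also have "\<dots> = ennreal (C\<^sup>2 * (N powr (2 * s') / N ^ ?n * (K * V)))"
      proof -
        have p: "0 \<le> N powr (2 * s') / N ^ ?n" and q: "0 \<le> K * V" using K(1) V d by simp_all
        show ?thesis by (simp only: ennreal_mult[OF zero_le_power2 mult_nonneg_nonneg[OF p q]] ennreal_mult[OF p q])
      qed
      finally have "ennreal (c / \<mu> * V / N ^ ?n) \<le> ennreal (C\<^sup>2 * (N powr (2 * s') / N ^ ?n * (K * V)))"
        using low[OF \<mu>(1) \<mu>1 N0 N(2)] unfolding V_def by (rule order_trans[rotated])
      then have "c / \<mu> * V / N ^ ?n \<le> C\<^sup>2 * (N powr (2 * s') / N ^ ?n * (K * V))"
        using K(1) V d by (subst (asm) ennreal_le_iff) auto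
      then have "c / \<mu> * (V / N ^ ?n) \<le> C\<^sup>2 * K * N powr (2 * s') * (V / N ^ ?n)"
        by (simp add: ac_simps)
      then have "c / \<mu> \<le> C\<^sup>2 * K * N powr (2 * s')"
        using V d by (simp only: mult_le_cancel_right_pos divide_pos_pos)
      moreover have "N powr (2 * s') = c0 powr (2 * s' / a) * \<mu> powr (- (4 * s' / a))"
      proof -
        have "N powr (2 * s') = (c0 / \<mu>\<^sup>2) powr (2 * s' / a)" by (simp add: N_def powr_powr)
        also have "\<dots> = c0 powr (2 * s' / a) / (\<mu>\<^sup>2) powr (2 * s' / a)" using c0 \<mu> by (simp add: powr_divide)
        also have "(\<mu>\<^sup>2) powr (2 * s' / a) = \<mu> powr (4 * s' / a)"
          using \<mu> powr_powr[of \<mu> 2 "2 * s' / a"] by simp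
        finally show ?thesis by (simp add: powr_minus divide_inverse)
      qed
      ultimately have "c / \<mu> \<le> M * \<mu> powr (- (4 * s' / a))" by (simp add: M_def ac_simps)
      then have "c \<le> M * (\<mu> powr (- (4 * s' / a)) * \<mu>)" using \<mu> by (simp add: divide_le_eq mult.assoc)
      also have "\<mu> powr (- (4 * s' / a)) * \<mu> = \<mu> powr e"
        using \<mu> powr_add[of \<mu> "- (4 * s' / a)" 1] by (simp add: e_def)
      finally show ?thesis .
    qed
    \<comment> \<open>\<open>e > 0\<close> expresses \<open>s' < a / 4\<close>, and \<open>key\<close> fails as \<open>\<mu>\<close> tends to 0\<close>
    have "((\<lambda>\<mu>. M * \<mu> powr e) \<longlongrightarrow> M * 0) (at_right 0)"
      by (intro tendsto_mult tendsto_const tendsto_zero_powrI)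
         (use e in \<open>auto intro: tendsto_ident_at eventually_mono[OF eventually_at_right_less]\<close>)
    then have "\<forall>\<^sub>F \<mu> in at_right 0. M * \<mu> powr e < c" using c by (intro order_tendstoD) auto
    moreover have "\<forall>\<^sub>F \<mu> in at_right 0. 0 < \<mu> \<and> \<mu> < sqrt c0"
      using c0 eventually_at_right_less[of 0] eventually_at_right_real[of 0 "sqrt c0"] by (auto elim: eventually_mono)
    ultimately have "\<forall>\<^sub>F \<mu>::real in at_right 0. False"
      by eventually_elim (use key in \<open>meson less_imp_le not_le\<close>)
    then show False by simp
  qed
qed

end
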